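(* Let $q\ge 4$ with $q\equiv 2$ or $4\pmod 6$. Then there exists a Steiner quadruple system on $B_q$ that satisfies the step property with respect to some total order on $B_q$.
   Context: $B_q=\{0,\dots,q-1\}$. A Steiner quadruple system $SQS(q)$ on $B_q$ is a set of 4-element subsets (quadruples) of $B_q$ such that every 3-element subset of $B_q$ is contained in exactly one quadruple. Step property: given a total order $L_0<L_1<\cdots<L_{q-1}$ on $B_q=\{L_0,\dots,L_{q-1}\}$ ($q$ even), the $SQS(q)$ satisfies the step property with respect to this order if for every $t\in\{0,\dots,q/2-1\}$ and every quadruple of the system of the form $\{L_{2t},L_{2t+1},L_a,L_b\}$, either $a<2t$ and $b<2t$, or $a>2t+1$ and $b>2t+1$. *)

theory Defs
  imports Main
begin

definition B :: "nat \<Rightarrow> nat set" where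
  "B q = {0..<q}"

definition is_SQS :: "nat \<Rightarrow> nat set set \<Rightarrow> bool" where
  "is_SQS q S \<longleftrightarrow>
     (\<forall>Q\<in>S. Q \<subseteq> B q \<and> card Q = 4) \<and>
     (\<forall>T. T \<subseteq> B q \<and> card T = 3 \<longrightarrow> (\<exists>!Q. Q \<in> S \<and> T \<subseteq> Q))"

text \<open>A total order L_0 < L_1 < ... < L_(q-1) on B q is encoded by the bijection
  L : {0..<q} -> B q, i |-> L_i.  Step property with respect to that order.\<close>
definition step_property :: "nat \<Rightarrow> nat set set \<Rightarrow> (nat \<Rightarrow> nat) \<Rightarrow> bool" where
  "step_property q S L \<longleftrightarrow>
     (\<forall>t < q div 2. \<forall>a < q. \<forall>b < q.
        {L (2*t), L (2*t+1), L a, L b} \<in> S \<longrightarrow>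
          ((a < 2*t \<and> b < 2*t) \<or> (a > 2*t+1 \<and> b > 2*t+1)))"

end

theory Submission
  imports Defs "HOL-Library.Product_Lexorder"
begin

text \<open>
  Levels are consecutive pairs of positions; the step property says that no block has two points
  on one level, one point strictly below and one strictly above it. The proof is Hanani's recursion
  for quadruple systems, arranged so that levels survive. Its building blocks are candelabra
  systems: a stem of \<open>s\<close> points and groups of \<open>g\<close> points, with blocks that cover once each triple not
  contained in the stem plus a single group. Filling the groups, in order, with a smaller system that
  has the step property keeps it, provided a block through two points of one level of a group has
  its other two points in earlier groups or in later groups.

  A system on \<open>n\<close> points turns a candelabra system with three groups into one with \<open>n - 1\<close> groups:
  blow up every point but one. With direct constructions for three groups
  (\<open>g \<equiv> s\<close> modulo 6), for four groups with stem 2, and two sporadic ones (\<open>g = 3\<close> with stem 1 and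
  \<open>g = 12\<close> with stem 2), this yields the orders \<open>2n\<close>, \<open>3n - 2\<close>, \<open>3n - 4\<close>, \<open>3n - 8\<close>, \<open>4n - 6\<close> and
  \<open>12n - 10\<close>, which together reach every \<open>q \<equiv> 2, 4\<close> modulo 6 starting from 2, 4 and 14.
\<close>

section \<open>Exact covers of triples\<close>

definition triples :: "'a set \<Rightarrow> 'a set set" where
  "triples X = {T. T \<subseteq> X \<and> card T = 3}"

definition exact_cover :: "'a set set \<Rightarrow> 'a set set \<Rightarrow> bool" where
  "exact_cover C TT \<longleftrightarrow> (\<forall>Q\<in>C. card Q = 4 \<and> triples Q \<subseteq> TT) \<and>
     (\<forall>T\<in>TT. card T = 3 \<and> (\<exists>!Q. Q \<in> C \<and> T \<subseteq> Q))"



lemma triples_subset: "T \<in> triples X \<Longrightarrow> T \<subseteq> X"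
  and triples_card: "T \<in> triples X \<Longrightarrow> card T = 3"
  by (simp_all add: triples_def)

lemma triples_mono: "X \<subseteq> Y \<Longrightarrow> triples X \<subseteq> triples Y"
  by (auto simp: triples_def)

lemma finite_triples: "finite X \<Longrightarrow> finite (triples X)"
  by (rule finite_subset[of _ "Pow X"]) (auto simp: triples_def)

lemma card_triples: "finite X \<Longrightarrow> card (triples X) = card X choose 3"
  by (simp add: triples_def n_subsets)

lemma card_triples_le_4:
  assumes "finite Q" "card Q \<le> 4"
  shows "card (triples Q) \<le> 4" and "card (triples Q) = 4 \<Longrightarrow> card Q = 4"
proof -
  have "card Q = 0 \<or> card Q = 1 \<or> card Q = 2 \<or> card Q = 3 \<or> card Q = 4" using assms(2) by linarith
  then show "card (triples Q) \<le> 4" and "card (triples Q) = 4 \<Longrightarrow> card Q = 4"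
    using assms(1) by (auto simp: card_triples numeral_eq_Suc)
qed

lemma image_triples:
  assumes "inj_on h X"
  shows "(`) h ` triples X = triples (h ` X)"
proof (intro equalityI subsetI)
  fix T assume "T \<in> (`) h ` triples X"
  then show "T \<in> triples (h ` X)"
    using assms by (auto simp: triples_def card_image inj_on_subset)
next
  fix T assume "T \<in> triples (h ` X)"
  then obtain U where "U \<subseteq> X" "T = h ` U" "card T = 3"
    by (auto simp: triples_def subset_image_iff)
  moreover from this have "card U = 3" using assms by (simp add: card_image inj_on_subset)
  ultimately show "T \<in> (`) h ` triples X" by (auto simp: triples_def)
qed

lemma exact_coverI:
  assumes "\<And>Q. Q \<in> C \<Longrightarrow> card Q = 4"
    and "\<And>Q T. Q \<in> C \<Longrightarrow> T \<in> triples Q \<Longrightarrow> T \<in> TT"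
    and "\<And>T. T \<in> TT \<Longrightarrow> card T = 3"
    and "\<And>T. T \<in> TT \<Longrightarrow> \<exists>Q\<in>C. T \<subseteq> Q"
    and "\<And>T Q Q'. T \<in> TT \<Longrightarrow> Q \<in> C \<Longrightarrow> Q' \<in> C \<Longrightarrow> T \<subseteq> Q \<Longrightarrow> T \<subseteq> Q' \<Longrightarrow> Q = Q'"
  shows "exact_cover C TT"
  unfolding exact_cover_def
proof (intro conjI ballI subsetI)
  fix T assume "T \<in> TT"
  then show "\<exists>!Q. Q \<in> C \<and> T \<subseteq> Q" using assms(4,5) by metis
qed (use assms(1-3) in auto)

lemma exact_cover_block: "exact_cover C TT \<Longrightarrow> Q \<in> C \<Longrightarrow> card Q = 4"
  by (simp add: exact_cover_def)

lemma exact_cover_triple: "exact_cover C TT \<Longrightarrow> T \<in> TT \<Longrightarrow> card T = 3"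
  by (simp add: exact_cover_def)

lemma exact_cover_sub_block: "exact_cover C TT \<Longrightarrow> Q \<in> C \<Longrightarrow> T \<subseteq> Q \<Longrightarrow> card T = 3 \<Longrightarrow> T \<in> TT"
  by (auto simp: exact_cover_def triples_def)

lemma exact_cover_ex: "exact_cover C TT \<Longrightarrow> T \<in> TT \<Longrightarrow> \<exists>Q\<in>C. T \<subseteq> Q"
  unfolding exact_cover_def by blast

lemma exact_cover_unique:
  "exact_cover C TT \<Longrightarrow> T \<in> TT \<Longrightarrow> Q \<in> C \<Longrightarrow> Q' \<in> C \<Longrightarrow> T \<subseteq> Q \<Longrightarrow> T \<subseteq> Q' \<Longrightarrow> Q = Q'"
  unfolding exact_cover_def by blast

lemma card_3_superset_in_block:
  assumes "card Q = 4" "x \<in> Q"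
  obtains T where "T \<subseteq> Q" "card T = 3" "x \<in> T"
proof -
  have "card (Q - {x}) = 3" using assms by simp
  then obtain y where y: "y \<in> Q - {x}" by (metis card.empty ex_in_conv zero_neq_numeral)
  then have "card (Q - {y}) = 3" using assms(1) by simp
  then show ?thesis using that[of "Q - {y}"] y assms(2) by auto
qed

lemma exact_cover_subset:
  assumes "exact_cover C TT" "\<And>T. T \<in> TT \<Longrightarrow> T \<subseteq> X" "Q \<in> C"
  shows "Q \<subseteq> X"
proof
  fix x assume "x \<in> Q"
  then obtain T where "T \<subseteq> Q" "card T = 3" "x \<in> T"
    using card_3_superset_in_block exact_cover_block[OF assms(1,3)] by metis
  then show "x \<in> X" using assms(2) exact_cover_sub_block[OF assms(1,3)] by blast
qed

lemma exact_cover_block_subset: "exact_cover C (triples X) \<Longrightarrow> Q \<in> C \<Longrightarrow> Q \<subseteq> X"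
  by (rule exact_cover_subset) (auto simp: triples_def)

lemma exact_cover_at_most_4:
  assumes "finite X" "card X \<le> 4" "card X \<noteq> 3"
  shows "exact_cover (if card X = 4 then {X} else {}) (triples X)"
proof -
  have "triples X = {}" if "card X < 3"
  proof -
    have "card T \<noteq> 3" if "T \<subseteq> X" for T using \<open>card X < 3\<close> card_mono[OF assms(1) that] by simp
    then show ?thesis by (auto simp: triples_def)
  qed
  then have "exact_cover {} (triples X)" if "card X < 3" using that by (simp add: exact_cover_def)
  moreover have "exact_cover {X} (triples X)" if "card X = 4"
    using that by (auto simp: exact_cover_def triples_def)
  ultimately show ?thesis using assms(2,3) by auto
qed

text \<open>Counting incident pairs of triples and blocks: with so few blocks no triple is covered twice.\<close>

lemma exact_cover_if_card:
  assumes C: "finite C" "\<And>Q. Q \<in> C \<Longrightarrow> finite Q \<and> card Q \<le> 4"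
    and TT: "\<And>T. T \<in> TT \<Longrightarrow> card T = 3" "\<And>T. T \<in> TT \<Longrightarrow> \<exists>Q\<in>C. T \<subseteq> Q"
    and few: "4 * card C \<le> card TT"
  shows "exact_cover C TT"
proof -
  define R where "R = Sigma C triples"
  have at_most_4: "card (triples Q) \<le> 4" if "Q \<in> C" for Q using C(2)[OF that] card_triples_le_4(1) by blast
  have fin: "finite (triples Q)" if "Q \<in> C" for Q using C(2)[OF that] finite_triples by blast
  have finR: "finite R" and cardR: "card R = (\<Sum>Q\<in>C. card (triples Q))"
    using C(1) fin by (auto simp: R_def card_SigmaI)
  have "TT \<subseteq> snd ` R"
  proof
    fix T assume "T \<in> TT"
    moreover from this obtain Q where "Q \<in> C" "T \<subseteq> Q" using TT(2) by blast
    ultimately have "(Q, T) \<in> R" using TT(1) by (simp add: R_def triples_def)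
    then show "T \<in> snd ` R" by force
  qed
  then have "card TT \<le> card (snd ` R)" using finR by (intro card_mono) auto
  moreover have "card (snd ` R) \<le> card R" using finR by (rule card_image_le)
  moreover have "card R \<le> (\<Sum>Q\<in>C. 4)" unfolding cardR using at_most_4 by (rule sum_mono)
  ultimately have tight: "card R = (\<Sum>Q\<in>C. 4)" "card (snd ` R) = card R" "card TT = card (snd ` R)"
    using few by simp_all
  have inj: "inj_on snd R" using finR tight(2) by (rule eq_card_imp_inj_on)
  have TT_eq: "TT = snd ` R" using finR \<open>TT \<subseteq> snd ` R\<close> tight(3) by (intro card_subset_eq) auto
  have full: "card (triples Q) = 4" if "Q \<in> C" for Q
    by (rule sum_mono_inv[OF tight(1)[unfolded cardR] at_most_4 that C(1)])
  show ?thesis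
  proof (rule exact_coverI)
    show "card Q = 4" if "Q \<in> C" for Q using card_triples_le_4(2) C(2)[OF that] full[OF that] by blast
    show "T \<in> TT" if "Q \<in> C" "T \<in> triples Q" for Q T
      unfolding TT_eq by (rule image_eqI[of _ _ "(Q, T)"]) (use that in \<open>simp_all add: R_def\<close>)
    show "Q = Q'" if "T \<in> TT" "Q \<in> C" "Q' \<in> C" "T \<subseteq> Q" "T \<subseteq> Q'" for T Q Q'
      using inj_onD[OF inj, of "(Q, T)" "(Q', T)"] that TT(1) by (simp add: R_def triples_def)
  qed (use TT in auto)
qed

lemma exact_cover_image:
  assumes cover: "exact_cover C TT" and inj: "inj_on h X" and TT: "\<And>T. T \<in> TT \<Longrightarrow> T \<subseteq> X"
  shows "exact_cover ((`) h ` C) ((`) h ` TT)"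
proof -
  have blocks: "Q \<subseteq> X" if "Q \<in> C" for Q using exact_cover_subset[OF cover TT that] .
  have card: "card (h ` A) = card A" if "A \<subseteq> X" for A
    using card_image inj inj_on_subset that by blast
  show ?thesis
  proof (rule exact_coverI)
    fix Q' T' assume "Q' \<in> (`) h ` C" "T' \<in> triples Q'"
    then obtain Q where Q: "Q \<in> C" "T' \<in> triples (h ` Q)" by blast
    then obtain T where "T \<in> triples Q" "T' = h ` T"
      using image_triples[of h Q] inj_on_subset[OF inj blocks] by (metis imageE)
    then show "T' \<in> (`) h ` TT"
      using exact_cover_sub_block[OF cover Q(1)] by (auto simp: triples_def)
  next
    fix T' Q Q' assume "T' \<in> (`) h ` TT" "Q \<in> (`) h ` C" "Q' \<in> (`) h ` C" "T' \<subseteq> Q" "T' \<subseteq> Q'"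
    then obtain T R R' where "T \<in> TT" "R \<in> C" "R' \<in> C" "h ` T \<subseteq> h ` R" "h ` T \<subseteq> h ` R'"
      "Q = h ` R" "Q' = h ` R'" by blast
    moreover from this have "T \<subseteq> R" "T \<subseteq> R'"
      using inj_on_image_mem_iff[OF inj _ blocks] TT by blast+
    ultimately show "Q = Q'" using exact_cover_unique[OF cover, of T R R'] by simp
  next
    show "card Q = 4" if "Q \<in> (`) h ` C" for Q
      using that card blocks exact_cover_block[OF cover] by auto
    show "card T = 3" if "T \<in> (`) h ` TT" for T
      using that card TT exact_cover_triple[OF cover] by auto
    show "\<exists>Q\<in>(`) h ` C. T \<subseteq> Q" if T: "T \<in> (`) h ` TT" for T
    proof -
      obtain U where U: "U \<in> TT" "T = h ` U" using T by blast
      then obtain Q where "Q \<in> C" "U \<subseteq> Q" using exact_cover_ex[OF cover] by blast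
      then show ?thesis using U(2) by (intro bexI[of _ "h ` Q"]) auto
    qed
  qed
qed

lemma exact_cover_UN:
  assumes cover: "\<And>i. i \<in> I \<Longrightarrow> exact_cover (C i) (TT i)"
    and compatible: "\<And>i j Q T. i \<in> I \<Longrightarrow> j \<in> I \<Longrightarrow> Q \<in> C i \<Longrightarrow> T \<in> TT i \<Longrightarrow> T \<subseteq> Q \<Longrightarrow> T \<in> TT j \<Longrightarrow> Q \<in> C j"
  shows "exact_cover (\<Union>i\<in>I. C i) (\<Union>i\<in>I. TT i)"
proof (rule exact_coverI)
  fix T Q Q' assume T: "T \<in> (\<Union>i\<in>I. TT i)" and Q: "Q \<in> (\<Union>i\<in>I. C i)" "T \<subseteq> Q"
    and Q': "Q' \<in> (\<Union>i\<in>I. C i)" "T \<subseteq> Q'"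
  from Q(1) Q'(1) obtain i j where ij: "i \<in> I" "Q \<in> C i" "j \<in> I" "Q' \<in> C j" by blast
  have "card T = 3" using T cover exact_cover_triple by blast
  then have "T \<in> TT i" "T \<in> TT j" using cover ij Q(2) Q'(2) exact_cover_sub_block by metis+
  moreover from this have "Q' \<in> C i" using compatible[of j i] ij Q'(2) by blast
  ultimately show "Q = Q'" using exact_cover_unique[OF cover[OF ij(1)]] ij Q(2) Q'(2) by blast
qed (use cover in \<open>fastforce simp: exact_cover_def\<close>)+

lemma exact_cover_Un:
  assumes "exact_cover C TT" "exact_cover C' TT'" "TT \<inter> TT' = {}"
  shows "exact_cover (C \<union> C') (TT \<union> TT')"
proof -
  have "exact_cover (\<Union>b\<in>UNIV. if b then C else C') (\<Union>b\<in>UNIV. if b then TT else TT')"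
    by (rule exact_cover_UN) (use assms in \<open>auto split: if_splits\<close>)
  then show ?thesis by (simp add: UNIV_bool Un_commute)
qed

lemma exact_cover_fibred:
  assumes A: "exact_cover A (triples Y)"
    and base: "\<And>T. T \<in> TT \<Longrightarrow> \<sigma> T \<in> triples Y"
    and C: "\<And>X. X \<in> A \<Longrightarrow> exact_cover (C X) {T\<in>TT. \<sigma> T \<subseteq> X}"
  shows "exact_cover (\<Union>X\<in>A. C X) TT"
proof -
  have "exact_cover (\<Union>X\<in>A. C X) (\<Union>X\<in>A. {T\<in>TT. \<sigma> T \<subseteq> X})"
    using C exact_cover_unique[OF A base] by (intro exact_cover_UN) blast+
  moreover have "(\<Union>X\<in>A. {T\<in>TT. \<sigma> T \<subseteq> X}) = TT" using exact_cover_ex[OF A base] by blast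
  ultimately show ?thesis by simp
qed

section \<open>Levels and the step property\<close>

definition one_sided :: "('a \<Rightarrow> 'b::linorder) \<Rightarrow> 'b \<Rightarrow> 'a set \<Rightarrow> bool" where
  "one_sided lev v Z \<longleftrightarrow> (\<forall>z\<in>Z. lev z < v) \<or> (\<forall>z\<in>Z. v < lev z)"

definition stepped :: "('a \<Rightarrow> 'b::linorder) \<Rightarrow> 'a set set \<Rightarrow> bool" where
  "stepped lev C \<longleftrightarrow>
     (\<forall>Q\<in>C. \<forall>x\<in>Q. \<forall>y\<in>Q. x \<noteq> y \<longrightarrow> lev x = lev y \<longrightarrow> one_sided lev (lev x) (Q - {x,y}))"

definition paired :: "('a \<Rightarrow> 'b) \<Rightarrow> 'a set \<Rightarrow> bool" where
  "paired lev X \<longleftrightarrow> (\<forall>x\<in>X. card {y\<in>X. lev y = lev x} = 2)"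

definition steppable :: "nat \<Rightarrow> bool" where
  "steppable n \<longleftrightarrow> (\<exists>S. exact_cover S (triples {0..<n}) \<and> stepped (\<lambda>x. x div 2) S)"

lemma steppedI:
  assumes "\<And>Q x y. Q \<in> C \<Longrightarrow> x \<in> Q \<Longrightarrow> y \<in> Q \<Longrightarrow> x \<noteq> y \<Longrightarrow> lev x = lev y \<Longrightarrow>
    one_sided lev (lev x) (Q - {x,y})"
  shows "stepped lev C"
  using assms unfolding stepped_def by blast

lemma steppedD:
  assumes "stepped lev C" "Q \<in> C" "x \<in> Q" "y \<in> Q" "x \<noteq> y" "lev x = lev y"
  shows "one_sided lev (lev x) (Q - {x,y})"
  using assms unfolding stepped_def by blast

lemma one_sided_refine:
  assumes "one_sided lev (lev x) Z" "\<And>y z. lev y < lev z \<Longrightarrow> lev' y < lev' z"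
  shows "one_sided lev' (lev' x) Z"
  using assms unfolding one_sided_def by blast

lemma stepped_Un: "stepped lev (C \<union> C') \<longleftrightarrow> stepped lev C \<and> stepped lev C'"
  by (simp only: stepped_def ball_Un)

lemma stepped_UN: "stepped lev (\<Union>i\<in>I. C i) \<longleftrightarrow> (\<forall>i\<in>I. stepped lev (C i))"
  by (simp only: stepped_def ball_UN)

lemma paired_mates:
  assumes "paired lev X" "x \<in> X" "y \<in> X" "z \<in> X" "x \<noteq> y" "lev y = lev x" "lev z = lev x"
  shows "z = x \<or> z = y"
proof (rule ccontr)
  assume "\<not> (z = x \<or> z = y)"
  then have "card {x,y,z} = 3" using assms(5) by auto
  moreover have fibre: "card {w\<in>X. lev w = lev x} = 2" using assms(1,2) by (simp add: paired_def)
  have "card {x,y,z} \<le> card {w\<in>X. lev w = lev x}"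
    using assms fibre by (intro card_mono card_ge_0_finite) auto
  ultimately show False using fibre by simp
qed

lemma card_paired:
  assumes "finite X" "paired lev X"
  shows "card X = 2 * card (lev ` X)"
proof -
  have "card X = (\<Sum>v\<in>lev ` X. card {x\<in>X. lev x = v})"
    using sum.image_gen[OF assms(1), of "\<lambda>_. 1::nat" lev] by simp
  also have "\<dots> = (\<Sum>v\<in>lev ` X. 2)" using assms(2) by (intro sum.cong) (auto simp: paired_def)
  finally show ?thesis by simp
qed

lemma paired_ranking:
  fixes lev :: "'a \<Rightarrow> 'b::linorder"
  assumes fin: "finite X" and paired: "paired lev X"
  obtains h where "bij_betw h X {0..<card X}"
    "\<And>x y. x \<in> X \<Longrightarrow> y \<in> X \<Longrightarrow> h x div 2 < h y div 2 \<longleftrightarrow> lev x < lev y"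
proof -
  define rank where "rank v = card {w \<in> lev ` X. w < v}" for v
  have rank_less: "rank v < rank w" if "v \<in> lev ` X" "v < w" for v w
    unfolding rank_def using that fin by (intro psubset_card_mono) auto
  have rank_less_iff: "rank v < rank w \<longleftrightarrow> v < w" if "v \<in> lev ` X" "w \<in> lev ` X" for v w
    using rank_less that by (metis less_irrefl less_trans linorder_neqE)
  define first where "first v = (SOME x. x \<in> X \<and> lev x = v)" for v
  have first: "first (lev x) \<in> X \<and> lev (first (lev x)) = lev x" if "x \<in> X" for x
    unfolding first_def using that by (intro someI[where P = "\<lambda>z. z \<in> X \<and> lev z = lev x"]) auto
  define h where "h x = 2 * rank (lev x) + (if x = first (lev x) then 0 else 1)" for x
  have half: "h x div 2 = rank (lev x)" for x by (simp add: h_def)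
  have inj: "inj_on h X"
  proof (rule inj_onI)
    fix x y assume xy: "x \<in> X" "y \<in> X" "h x = h y"
    then have "lev x = lev y" using half rank_less_iff by (metis imageI less_irrefl linorder_neqE)
    moreover from this have "x = first (lev x) \<longleftrightarrow> y = first (lev x)"
      using xy(3) by (auto simp: h_def split: if_splits)
    ultimately show "x = y"
      using paired_mates[OF paired, of "first (lev x)" x y] first[OF xy(1)] xy by metis
  qed
  have "h x < card X" if "x \<in> X" for x
  proof -
    have "rank (lev x) < card (lev ` X)"
      unfolding rank_def using that fin by (intro psubset_card_mono) auto
    then show ?thesis using card_paired[OF fin paired] by (auto simp: h_def)
  qed
  then have "h ` X \<subseteq> {0..<card X}" by auto
  then have "h ` X = {0..<card X}" using inj by (intro card_subset_eq) (simp_all add: card_image)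
  then show ?thesis using that[of h] inj rank_less_iff by (simp add: bij_betw_def half)
qed

lemma stepped_image:
  assumes C: "stepped lev C" "\<And>Q. Q \<in> C \<Longrightarrow> Q \<subseteq> X"
    and h: "inj_on h X" "\<And>x y. x \<in> X \<Longrightarrow> y \<in> X \<Longrightarrow> lev' (h x) < lev' (h y) \<longleftrightarrow> lev x < lev y"
  shows "stepped lev' ((`) h ` C)"
proof (rule steppedI)
  fix R x' y' assume R: "R \<in> (`) h ` C" "x' \<in> R" "y' \<in> R" "x' \<noteq> y'" "lev' x' = lev' y'"
  then obtain Q x y where Q: "Q \<in> C" "R = h ` Q" "x \<in> Q" "y \<in> Q" "x' = h x" "y' = h y" by blast
  have X: "z \<in> X" if "z \<in> Q" for z using that C(2) Q(1) by blast
  have "x \<noteq> y" using R(4) Q by blast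
  moreover have "lev x = lev y"
    using h(2)[OF X X] Q(3-6) R(5) by (metis less_irrefl linorder_neqE)
  ultimately have "one_sided lev (lev x) (Q - {x,y})" by (rule steppedD[OF C(1) Q(1,3,4)])
  then show "one_sided lev' (lev' x') (R - {x',y'})"
    using h(2)[OF X X] Q unfolding one_sided_def by auto
qed

lemma steppableI:
  assumes X: "finite X" "paired lev X" and C: "exact_cover C (triples X)" "stepped lev C"
  shows "steppable (card X)"
proof -
  obtain h where h: "bij_betw h X {0..<card X}"
    "\<And>x y. x \<in> X \<Longrightarrow> y \<in> X \<Longrightarrow> h x div 2 < h y div 2 \<longleftrightarrow> lev x < lev y"
    using paired_ranking[OF X] by blast
  have inj: "inj_on h X" and im: "h ` X = {0..<card X}" using h(1) by (auto simp: bij_betw_def)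
  have "exact_cover ((`) h ` C) (triples {0..<card X})"
    using exact_cover_image[OF C(1) inj] image_triples[OF inj] im by (simp add: triples_subset)
  moreover have "stepped (\<lambda>x. x div 2) ((`) h ` C)"
    by (rule stepped_image[OF C(2) exact_cover_block_subset[OF C(1)] inj h(2)])
  ultimately show ?thesis unfolding steppable_def by blast
qed

lemma steppable_system_exists:
  assumes "steppable (card X)" "finite X" "paired lev X"
  shows "\<exists>S. exact_cover S (triples X) \<and> stepped lev S"
proof -
  obtain S where S: "exact_cover S (triples {0..<card X})" "stepped (\<lambda>x. x div 2) S"
    using assms(1) unfolding steppable_def by blast
  obtain h where h: "bij_betw h X {0..<card X}"
    "\<And>x y. x \<in> X \<Longrightarrow> y \<in> X \<Longrightarrow> h x div 2 < h y div 2 \<longleftrightarrow> lev x < lev y"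
    using paired_ranking[OF assms(2,3)] by blast
  define k where "k = the_inv_into X h"
  have k: "bij_betw k {0..<card X} X" "\<And>m. m \<in> {0..<card X} \<Longrightarrow> h (k m) = m"
    using h(1) bij_betw_the_inv_into[OF h(1)] f_the_inv_into_f_bij_betw[OF h(1)]
    by (simp_all add: k_def)
  then have inj: "inj_on k {0..<card X}" and im: "k ` {0..<card X} = X" by (auto simp: bij_betw_def)
  have mono: "lev (k m) < lev (k n) \<longleftrightarrow> m div 2 < n div 2"
    if "m \<in> {0..<card X}" "n \<in> {0..<card X}" for m n
    using h(2)[of "k m" "k n"] k that bij_betwE[OF k(1)] by auto
  have "exact_cover ((`) k ` S) (triples X)"
    using exact_cover_image[OF S(1) inj] image_triples[OF inj] im by (simp add: triples_subset)
  moreover have "stepped lev ((`) k ` S)"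
    by (rule stepped_image[OF S(2) exact_cover_block_subset[OF S(1)] inj mono])
  ultimately show ?thesis by blast
qed

lemma two_lowest_levels_block:
  assumes S: "exact_cover S (triples X)" "stepped lev S"
    and X: "{w,w',z,z'} \<subseteq> X" "card {w,w',z,z'} = 4"
    and lev: "lev z' = lev z" "lev w < lev z" "\<And>v. v \<in> X \<Longrightarrow> lev v < lev z \<Longrightarrow> v \<in> {w,w'}"
  shows "{w,w',z,z'} \<in> S"
proof -
  have distinct: "w \<noteq> z" "w \<noteq> z'" "z \<noteq> z'"
    using X(2) by (auto simp: card_insert_if split: if_splits)
  then have "{w,z,z'} \<in> triples X" using X(1) by (simp add: triples_def)
  then obtain Q where Q: "Q \<in> S" "{w,z,z'} \<subseteq> Q" using exact_cover_ex[OF S(1)] by blast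
  have "card (Q - {w,z,z'}) = 1"
    using exact_cover_block[OF S(1) Q(1)] Q(2) distinct by (subst card_Diff_subset) auto
  then obtain v where v: "Q - {w,z,z'} = {v}" by (rule card_1_singletonE)
  have "v \<in> Q" "v \<in> X" "v \<notin> {w,z,z'}" using v exact_cover_block_subset[OF S(1) Q(1)] by auto
  moreover have "one_sided lev (lev z) (Q - {z,z'})"
    using Q(2) distinct(3) lev(1) by (intro steppedD[OF S(2) Q(1)]) auto
  moreover have "w \<in> Q - {z,z'}" using Q(2) distinct by simp
  ultimately have "lev v < lev z"
    using lev(2) unfolding one_sided_def by (metis insertCI insertE Diff_iff less_asym singletonD)
  then have "v = w'" using lev(3) \<open>v \<in> X\<close> \<open>v \<notin> {w,z,z'}\<close> by blast
  then have "Q = {w,w',z,z'}" using v Q(2) by blast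
  then show ?thesis using Q(1) by simp
qed

lemma is_SQS_if_exact_cover:
  assumes "exact_cover S (triples {0..<q})"
  shows "is_SQS q S"
  using assms exact_cover_block_subset[OF assms]
  unfolding exact_cover_def is_SQS_def B_def triples_def by auto

lemma step_property_if_stepped:
  assumes S: "exact_cover S (triples {0..<q})" and step: "stepped (\<lambda>x. x div 2) S"
  shows "step_property q S id"
  unfolding step_property_def
proof (intro allI impI)
  fix t a b assume Q: "{id (2*t), id (2*t+1), id a, id b} \<in> S"
  have "card {2*t, 2*t+1, a, b} = 4" using exact_cover_block[OF S Q] by simp
  then have "{a, b} \<inter> {2*t, 2*t+1} = {}" by (auto simp: card_insert_if split: if_splits)
  then show "a < 2*t \<and> b < 2*t \<or> a > 2*t+1 \<and> b > 2*t+1"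
    using steppedD[OF step Q, of "2*t" "2*t+1"] by (auto simp: one_sided_def)
qed

section \<open>Candelabra systems\<close>

text \<open>The point \<open>(i, a)\<close> is the \<open>a\<close>-th point of group \<open>i\<close>; the index 0 is reserved for the stem.\<close>

definition points :: "nat set \<Rightarrow> nat \<Rightarrow> nat \<Rightarrow> (nat \<times> int) set" where
  "points I g s = {0} \<times> {0..<int s} \<union> I \<times> {0..<int g}"

definition cross_triples :: "nat set \<Rightarrow> nat \<Rightarrow> nat \<Rightarrow> (nat \<times> int) set set" where
  "cross_triples I g s = {T \<in> triples (points I g s). 2 \<le> card (fst ` T - {0})}"

abbreviation candelabra_system :: "nat set \<Rightarrow> nat \<Rightarrow> nat \<Rightarrow> (nat \<times> int) set set \<Rightarrow> bool" where
  "candelabra_system I g s C \<equiv> exact_cover C (cross_triples I g s)"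

lemma finite_points: "finite I \<Longrightarrow> finite (points I g s)"
  by (simp add: points_def)

lemma card_points: "finite I \<Longrightarrow> 0 \<notin> I \<Longrightarrow> card (points I g s) = s + card I * g"
  unfolding points_def by (subst card_Un_disjoint) (auto simp: card_cartesian_product)

lemma points_one_group: "0 \<notin> I \<Longrightarrow> x \<in> points I g s \<Longrightarrow> fst x \<in> {0,i} \<Longrightarrow> x \<in> points {i} g s"
  by (auto simp: points_def)

lemma cross_triples_subset_points: "T \<in> cross_triples I g s \<Longrightarrow> T \<subseteq> points I g s"
  by (simp add: cross_triples_def triples_def)

lemma not_cross_triple_iff:
  assumes "0 \<notin> I" "I \<noteq> {}" "T \<in> triples (points I g s)"
  shows "T \<notin> cross_triples I g s \<longleftrightarrow> (\<exists>i\<in>I. T \<subseteq> points {i} g s)"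
proof
  assume "T \<notin> cross_triples I g s"
  then have "card (fst ` T - {0}) \<le> Suc 0" using assms(3) by (simp add: cross_triples_def)
  moreover have "finite (fst ` T - {0})"
    using triples_card[OF assms(3)] by (simp add: card_ge_0_finite)
  ultimately have one_group: "\<forall>i\<in>fst ` T - {0}. \<forall>j\<in>fst ` T - {0}. i = j"
    by (rule iffD1[OF card_le_Suc0_iff_eq, rotated])
  have "fst ` T - {0} \<subseteq> I" using triples_subset[OF assms(3)] by (auto simp: points_def)
  moreover obtain i\<^sub>0 where "i\<^sub>0 \<in> I" using assms(2) by blast
  ultimately have "\<exists>i\<in>I. fst ` T - {0} \<subseteq> {i}"
  proof (cases "fst ` T - {0} = {}")
    case False
    then obtain i where "i \<in> fst ` T - {0}" by blast
    moreover from this have "fst ` T - {0} \<subseteq> {i}"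
      using one_group[rule_format, of _ i] by (metis singleton_iff subsetI)
    ultimately show ?thesis using \<open>fst ` T - {0} \<subseteq> I\<close> by blast
  qed auto
  then obtain i where "i \<in> I" "fst ` T - {0} \<subseteq> {i}" by (rule bexE)
  moreover from this have "fst x \<in> {0,i}" if "x \<in> T" for x using that by auto
  ultimately have "T \<subseteq> points {i} g s"
    using points_one_group[OF assms(1)] triples_subset[OF assms(3)] by (meson subset_iff)
  then show "\<exists>i\<in>I. T \<subseteq> points {i} g s" using \<open>i \<in> I\<close> by blast
next
  assume "\<exists>i\<in>I. T \<subseteq> points {i} g s"
  then obtain i where "T \<subseteq> points {i} g s" by blast
  then have "card (fst ` T - {0}) \<le> card {i}" by (intro card_mono) (auto simp: points_def)
  then show "T \<notin> cross_triples I g s" by (simp add: cross_triples_def)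
qed

lemma triples_points:
  assumes "0 \<notin> I" "I \<noteq> {}"
  shows "triples (points I g s) = cross_triples I g s \<union> (\<Union>i\<in>I. triples (points {i} g s))"
    and "cross_triples I g s \<inter> (\<Union>i\<in>I. triples (points {i} g s)) = {}"
proof -
  have "points {i} g s \<subseteq> points I g s" if "i \<in> I" for i using that by (auto simp: points_def)
  then have "triples (points {i} g s) \<subseteq> triples (points I g s)" if "i \<in> I" for i
    using that triples_mono by metis
  moreover have "cross_triples I g s \<subseteq> triples (points I g s)" by (auto simp: cross_triples_def)
  moreover have "T \<notin> cross_triples I g s \<longleftrightarrow> (\<exists>i\<in>I. T \<in> triples (points {i} g s))"
    if "T \<in> triples (points I g s)" for T
    using not_cross_triple_iff[OF assms that] triples_card[OF that] by (simp add: triples_def)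
  ultimately show "triples (points I g s) = cross_triples I g s \<union> (\<Union>i\<in>I. triples (points {i} g s))"
    and "cross_triples I g s \<inter> (\<Union>i\<in>I. triples (points {i} g s)) = {}"
    by blast+
qed

lemma triples_two_groups:
  assumes "T \<in> triples (points {i} g s)" "T \<in> triples (points {j} g s)" "i \<noteq> j"
  shows "T \<in> triples (points {} g s)"
  using assms by (fastforce simp: triples_def points_def)

lemma exact_cover_fill:
  assumes C: "candelabra_system I g s C" and I: "0 \<notin> I" "I \<noteq> {}"
    and A: "\<And>i. i \<in> I \<Longrightarrow> exact_cover (A i) (triples (points {i} g s))"
    and stem: "exact_cover D (triples (points {} g s))" "\<And>i. i \<in> I \<Longrightarrow> D \<subseteq> A i"
  shows "exact_cover (C \<union> (\<Union>i\<in>I. A i)) (triples (points I g s))"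
proof -
  have "exact_cover (\<Union>i\<in>I. A i) (\<Union>i\<in>I. triples (points {i} g s))"
  proof (rule exact_cover_UN[OF A])
    fix i j Q T
    assume ij: "i \<in> I" "j \<in> I" and Q: "Q \<in> A i" "T \<subseteq> Q"
      and T: "T \<in> triples (points {i} g s)" "T \<in> triples (points {j} g s)"
    show "Q \<in> A j"
    proof (cases "i = j")
      case False
      then obtain R where "R \<in> D" "T \<subseteq> R" using exact_cover_ex[OF stem(1) triples_two_groups[OF T]] by blast
      moreover from this have "R = Q"
        using exact_cover_unique[OF A[OF ij(1)] T(1)] stem(2)[OF ij(1)] Q by blast
      ultimately show ?thesis using stem(2)[OF ij(2)] by blast
    qed (use Q in simp)
  qed
  then show ?thesis unfolding triples_points[OF I] using C triples_points(2)[OF I]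
    by (intro exact_cover_Un)
qed

lemma int_choose_3: "6 * int (n choose 3) = int n * (int n - 1) * (int n - 2)"
proof (induction n)
  case (Suc n)
  have "2 * int (n choose 2) = int n * (int n - 1)"
    by (induction n) (auto simp: numeral_2_eq_2 algebra_simps)
  then show ?case using Suc by (simp add: numeral_3_eq_3 numeral_2_eq_2 algebra_simps)
qed simp

lemma card_triples_points:
  fixes I :: "nat set" and g s :: nat
  assumes "finite I" "0 \<notin> I"
  defines "n \<equiv> int s + int (card I) * int g"
  shows "6 * int (card (triples (points I g s))) = n * (n - 1) * (n - 2)"
  using assms by (simp add: card_triples finite_points card_points int_choose_3)

lemma card_triples_within_groups:
  fixes I :: "nat set" and g s :: nat
  assumes I: "finite I" "0 \<notin> I" "I \<noteq> {}"
  defines "t \<equiv> int s" and "n \<equiv> int s + int g"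
  shows "6 * int (card (\<Union>i\<in>I. triples (points {i} g s))) =
    t * (t - 1) * (t - 2) + int (card I) * (n * (n - 1) * (n - 2) - t * (t - 1) * (t - 2))"
proof -
  let ?S = "triples (points {} g s)" and ?G = "\<lambda>i. triples (points {i} g s)"
  have fin: "finite (triples (points J g s))" if "finite J" for J
    using that by (simp add: finite_triples finite_points)
  have S_subset: "?S \<subseteq> ?G i" for i by (rule triples_mono) (auto simp: points_def)
  have excess: "6 * int (card (?G i - ?S)) = n * (n - 1) * (n - 2) - t * (t - 1) * (t - 2)" if "i \<in> I" for i
  proof -
    have "card (?G i) = card (?G i - ?S) + card ?S"
      using card_Diff_subset[OF _ S_subset] card_mono[OF _ S_subset] fin by simp
    moreover have "i \<noteq> 0" using that I(2) by metis
    ultimately show ?thesis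
      using card_triples_points[of "{i}" g s] card_triples_points[of "{}" g s] by (simp add: t_def n_def)
  qed
  have "(\<Union>i\<in>I. ?G i) = ?S \<union> (\<Union>i\<in>I. ?G i - ?S)" using I(3) S_subset by blast
  also have "card \<dots> = card ?S + card (\<Union>i\<in>I. ?G i - ?S)"
    using I(1) fin by (intro card_Un_disjoint) auto
  also have "card (\<Union>i\<in>I. ?G i - ?S) = (\<Sum>i\<in>I. card (?G i - ?S))"
    using I(1) fin triples_two_groups by (intro card_UN_disjoint) blast+
  finally have "6 * int (card (\<Union>i\<in>I. ?G i)) = t * (t - 1) * (t - 2) + (\<Sum>i\<in>I. 6 * int (card (?G i - ?S)))"
    using card_triples_points[of "{}" g s] by (simp add: sum_distrib_left t_def)
  then show ?thesis using excess by simp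
qed

lemma card_cross_triples:
  assumes I: "finite I" "0 \<notin> I" "I \<noteq> {}"
  defines "u \<equiv> int (card I)"
  shows "6 * int (card (cross_triples I g s)) =
    u * (u - 1) * int g ^ 2 * (3 * int s + 3 * (int g - 1) + (u - 2) * int g)"
proof -
  let ?groups = "\<Union>i\<in>I. triples (points {i} g s)"
  have "finite (triples (points I g s))" using I(1) by (simp add: finite_triples finite_points)
  then have "card (triples (points I g s)) = card (cross_triples I g s) + card ?groups"
    unfolding triples_points(1)[OF I(2,3)] using triples_points(2)[OF I(2,3)]
    by (intro card_Un_disjoint) simp_all
  then have "6 * int (card (cross_triples I g s)) =
      6 * int (card (triples (points I g s))) - 6 * int (card ?groups)" by simp
  then show ?thesis unfolding card_triples_points[OF I(1,2)] card_triples_within_groups[OF I]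
    by (simp add: u_def algebra_simps power2_eq_square)
qed

lemma card_cross_triples_3: "int (card (cross_triples {1..3} g s)) = int g ^ 2 * (4 * int g + 3 * int s - 3)"
  using card_cross_triples[of "{1..3}" g s] by (simp add: algebra_simps)

lemma card_cross_triples_4:
  "int (card (cross_triples {1..4} g s)) = 2 * int g ^ 2 * (5 * int g + 3 * int s - 3)"
  using card_cross_triples[of "{1..4}" g s] by (simp add: algebra_simps)

lemma candelabra_system_if_card:
  assumes "finite C" "\<And>Q. Q \<in> C \<Longrightarrow> \<exists>a b c d. Q = {a,b,c,d}"
    and "\<And>T. T \<in> cross_triples I g s \<Longrightarrow> \<exists>Q\<in>C. T \<subseteq> Q"
    and "4 * card C \<le> card (cross_triples I g s)"
  shows "candelabra_system I g s C"
proof (rule exact_cover_if_card)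
  have "finite {a,b,c,d} \<and> card {a,b,c,d} \<le> 4" for a b c d :: "nat \<times> int"
    by (simp add: card_insert_if)
  then show "finite Q \<and> card Q \<le> 4" if "Q \<in> C" for Q using assms(2)[OF that] by auto
qed (use assms in \<open>auto simp: cross_triples_def triples_def\<close>)

lemma card_3_sorted:
  fixes f :: "'a \<Rightarrow> 'b::linorder"
  assumes "card T = 3"
  obtains x y z where "T = {x,y,z}" "x \<noteq> y" "y \<noteq> z" "x \<noteq> z" "f x \<le> f y" "f y \<le> f z"
proof -
  obtain a b c where T: "T = {a,b,c}" "a \<noteq> b" "b \<noteq> c" "a \<noteq> c"
    using assms by (metis card_3_iff)
  consider "f a \<le> f b" "f b \<le> f c" | "f a \<le> f c" "f c \<le> f b" | "f b \<le> f a" "f a \<le> f c"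
    | "f b \<le> f c" "f c \<le> f a" | "f c \<le> f a" "f a \<le> f b" | "f c \<le> f b" "f b \<le> f a"
    by (meson linear)
  then show ?thesis by cases (use T that in \<open>auto simp: insert_commute\<close>)
qed

lemma card_nonzero_indices_cases:
  fixes i j k :: nat
  assumes card: "2 \<le> card ({i,j,k} - {0})" and sorted: "i \<le> j" "j \<le> k"
  obtains (stem) "i = 0" "0 < j" "j < k" | (first_two) "0 < i" "i = j" "j < k"
  | (last_two) "0 < i" "i < j" "j = k" | (distinct) "0 < i" "i < j" "j < k"
proof -
  have "\<not> {i,j,k} - {0} \<subseteq> {k}"
  proof
    assume "{i,j,k} - {0} \<subseteq> {k}"
    then have "card ({i,j,k} - {0}) \<le> card {k}" by (intro card_mono) auto
    then show False using card by simp
  qed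
  then have "\<not> (i = 0 \<and> j = k)" "\<not> (i = j \<and> j = k)" "\<not> (i = 0 \<and> j = 0)" by blast+
  moreover have "i = 0 \<or> 0 < i" "i = j \<or> i < j" "j = k \<or> j < k" "j = 0 \<or> 0 < j" using sorted by auto
  ultimately show ?thesis using stem first_two last_two distinct sorted(1) by (metis le_zero_eq)
qed

lemma cross_triples_cases [consumes 2, case_names stem two three]:
  assumes T: "T \<in> cross_triples I g s" and I: "0 \<notin> I"
  obtains (stem) l i j a b where "T = {(0,l),(i,a),(j,b)}" "l \<in> {0..<int s}" "i \<in> I" "j \<in> I" "i < j"
      "a \<in> {0..<int g}" "b \<in> {0..<int g}"
  | (two) i j a a' b where "T = {(i,a),(i,a'),(j,b)}" "i \<in> I" "j \<in> I" "i \<noteq> j" "a \<noteq> a'"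
      "a \<in> {0..<int g}" "a' \<in> {0..<int g}" "b \<in> {0..<int g}"
  | (three) i j k a b c where "T = {(i,a),(j,b),(k,c)}" "i \<in> I" "j \<in> I" "k \<in> I" "i < j" "j < k"
      "a \<in> {0..<int g}" "b \<in> {0..<int g}" "c \<in> {0..<int g}"
proof -
  have "card T = 3" using T by (simp add: cross_triples_def triples_def)
  then obtain x y z where xyz: "T = {x,y,z}" "x \<noteq> y" "y \<noteq> z" "x \<noteq> z" "fst x \<le> fst y" "fst y \<le> fst z"
    by (rule card_3_sorted)
  obtain i a j b k c where coordinates: "x = (i,a)" "y = (j,b)" "z = (k,c)" by (metis surj_pair)
  have in_points: "(i,a) \<in> points I g s" "(j,b) \<in> points I g s" "(k,c) \<in> points I g s"
    using cross_triples_subset_points[OF T] xyz coordinates by auto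
  have "2 \<le> card ({i,j,k} - {0})" using T xyz(1) coordinates by (simp add: cross_triples_def)
  moreover have "i \<le> j" "j \<le> k" using xyz coordinates by auto
  ultimately show ?thesis
  proof (cases rule: card_nonzero_indices_cases)
    case stem
    then show ?thesis using in_points I coordinates
      by (intro that(1)[of a j b k c]) (auto simp: points_def xyz(1))
  next
    case first_two
    then show ?thesis using in_points I xyz(2) coordinates
      by (intro two[of i a b k c]) (auto simp: points_def xyz(1))
  next
    case last_two
    then show ?thesis using in_points I xyz(3) coordinates
      by (intro two[of j b c i a]) (auto simp: points_def xyz(1))
  next
    case distinct
    then show ?thesis using in_points I coordinates
      by (intro three[of i a j b k c]) (auto simp: points_def xyz(1))
  qed
qed

section \<open>Filling the groups of a candelabra system\<close>

definition group_level :: "(int \<Rightarrow> int) \<Rightarrow> nat \<times> int \<Rightarrow> nat \<times> int" where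
  "group_level l x = (fst x, if fst x = 0 then snd x div 2 else l (snd x))"

definition aligned :: "(int \<Rightarrow> int) \<Rightarrow> (nat \<times> int) set set \<Rightarrow> bool" where
  "aligned l C \<longleftrightarrow> (\<forall>Q\<in>C. \<forall>x\<in>Q. \<forall>y\<in>Q. x \<noteq> y \<longrightarrow> fst x \<noteq> 0 \<longrightarrow> fst x = fst y \<longrightarrow> l (snd x) = l (snd y) \<longrightarrow>
     (\<forall>z\<in>Q - {x,y}. \<forall>w\<in>Q - {x,y}. fst z = fst w))"

lemma alignedI:
  assumes "\<And>Q x y z w. Q \<in> C \<Longrightarrow> {x,y,z,w} \<subseteq> Q \<Longrightarrow> x \<noteq> y \<Longrightarrow> z \<notin> {x,y} \<Longrightarrow> w \<notin> {x,y} \<Longrightarrow>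
    fst x \<noteq> 0 \<Longrightarrow> fst x = fst y \<Longrightarrow> l (snd x) = l (snd y) \<Longrightarrow> fst z = fst w"
  shows "aligned l C"
  unfolding aligned_def
proof (intro ballI impI)
  fix Q x y z w
  assume "Q \<in> C" "x \<in> Q" "y \<in> Q" "x \<noteq> y" "fst x \<noteq> 0" "fst x = fst y" "l (snd x) = l (snd y)"
    "z \<in> Q - {x,y}" "w \<in> Q - {x,y}"
  then show "fst z = fst w" using assms[of Q x y z w] by simp
qed

lemma alignedD:
  assumes "aligned l C" "Q \<in> C" "{x,y,z,w} \<subseteq> Q" "x \<noteq> y" "z \<notin> {x,y}" "w \<notin> {x,y}"
    "fst x \<noteq> 0" "fst x = fst y" "l (snd x) = l (snd y)"
  shows "fst z = fst w"
  using assms(1)[unfolded aligned_def, rule_format, of Q x y z w] assms(2-) by simp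

lemma aligned_if_inj_on_fst:
  assumes "\<And>Q. Q \<in> C \<Longrightarrow> inj_on fst Q"
  shows "aligned l C"
proof (rule alignedI)
  fix Q x y z w assume "Q \<in> C" "{x,y,z,w} \<subseteq> Q" "x \<noteq> y" "fst x = fst y"
  then show "fst z = fst w" using inj_onD[OF assms, of Q x y] by simp
qed

lemma aligned_Un: "aligned l (C \<union> C') \<longleftrightarrow> aligned l C \<and> aligned l C'"
  by (simp only: aligned_def ball_Un)

lemma aligned_UN: "aligned l (\<Union>i\<in>I. C i) \<longleftrightarrow> (\<forall>i\<in>I. aligned l (C i))"
  by (simp only: aligned_def ball_UN)

lemma aligned_image:
  assumes C: "aligned l C"
    and h: "\<And>Q x y. Q \<in> C \<Longrightarrow> x \<in> Q \<Longrightarrow> y \<in> Q \<Longrightarrow> fst (h x) = fst (h y) \<longleftrightarrow> fst x = fst y"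
      "\<And>x. fst x = 0 \<Longrightarrow> fst (h x) = 0"
      "\<And>x y. fst x = fst y \<Longrightarrow> l (snd (h x)) = l (snd (h y)) \<Longrightarrow> l (snd x) = l (snd y)"
  shows "aligned l ((`) h ` C)"
proof (rule alignedI)
  fix R x' y' z' w'
  assume R: "R \<in> (`) h ` C" "{x',y',z',w'} \<subseteq> R" "x' \<noteq> y'" "z' \<notin> {x',y'}" "w' \<notin> {x',y'}"
    "fst x' \<noteq> 0" "fst x' = fst y'" "l (snd x') = l (snd y')"
  obtain Q where Q: "Q \<in> C" "R = h ` Q" using R(1) by blast
  then have "x' \<in> h ` Q" "y' \<in> h ` Q" "z' \<in> h ` Q" "w' \<in> h ` Q" using R(2) by simp_all
  then obtain x y z w where preimages: "x \<in> Q" "y \<in> Q" "z \<in> Q" "w \<in> Q"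
    and images: "x' = h x" "y' = h y" "z' = h z" "w' = h w" by (elim imageE)
  have "fst x \<noteq> 0" using R(6) h(2)[of x] images(1) by metis
  moreover have "fst x = fst y" using R(7) h(1)[OF Q(1) preimages(1,2)] images(1,2) by simp
  moreover from this have "l (snd x) = l (snd y)" using h(3)[of x y] R(8) images(1,2) by blast
  moreover have "x \<noteq> y" "z \<notin> {x,y}" "w \<notin> {x,y}" using R(3-5) images by auto
  ultimately have "fst z = fst w" using alignedD[OF C Q(1), of x y z w] preimages by simp
  then show "fst z' = fst w'" using h(1)[OF Q(1) preimages(3,4)] images(3,4) by simp
qed

lemma candelabra_block_subset: "candelabra_system I g s C \<Longrightarrow> Q \<in> C \<Longrightarrow> Q \<subseteq> points I g s"
  using exact_cover_subset cross_triples_subset_points by metis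

lemma candelabra_block_groups:
  assumes C: "candelabra_system I g s C" and Q: "Q \<in> C" "{x,y,z} \<subseteq> Q" "x \<noteq> y" "z \<notin> {x,y}"
    and i: "fst x \<in> {0,i}" "fst y \<in> {0,i}"
  shows "fst z \<notin> {0,i}"
proof
  assume "fst z \<in> {0,i}"
  then have "card (fst ` {x,y,z} - {0}) \<le> card {i}" using i by (intro card_mono) auto
  moreover have "card {x,y,z} = 3" using Q(3,4) by auto
  then have "{x,y,z} \<in> cross_triples I g s" using exact_cover_sub_block[OF C Q(1,2)] by blast
  ultimately show False by (simp add: cross_triples_def)
qed

lemma group_level_less: "fst x < fst y \<Longrightarrow> group_level l x < group_level l y"
  by (simp add: group_level_def)

lemma stepped_if_aligned:
  assumes C: "candelabra_system I g s C" and D: "D \<subseteq> C" "aligned l D"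
  shows "stepped (group_level l) D"
proof (rule steppedI)
  fix Q x y assume Q: "Q \<in> D" "x \<in> Q" "y \<in> Q" "x \<noteq> y" and lev: "group_level l x = group_level l y"
  then have same: "fst x = fst y" by (simp add: group_level_def)
  have "Q \<in> C" using Q(1) D(1) by blast
  note other_group = candelabra_block_groups[OF C this, of x y]
  have "fst x \<noteq> 0"
  proof
    assume "fst x = 0"
    have "card (Q - {x,y}) = 2"
      using exact_cover_block[OF C \<open>Q \<in> C\<close>] Q(2-4) by (subst card_Diff_subset) auto
    then obtain z where "z \<in> Q" "z \<notin> {x,y}" by (metis Diff_iff card.empty ex_in_conv zero_neq_numeral)
    then show False using other_group[of z "fst z"] Q same \<open>fst x = 0\<close> by auto
  qed
  moreover from this have "l (snd x) = l (snd y)" using lev same by (simp add: group_level_def)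
  ultimately have "fst z = fst w" if "z \<in> Q - {x,y}" "w \<in> Q - {x,y}" for z w
    using alignedD[OF D(2) Q(1) _ Q(4) _ _ _ same] that Q(2,3) by auto
  moreover have "fst z \<noteq> fst x" if "z \<in> Q - {x,y}" for z
    using other_group[of z "fst x"] that Q same by auto
  ultimately have "one_sided fst (fst x) (Q - {x,y})"
    unfolding one_sided_def by (metis linorder_neqE)
  then show "one_sided (group_level l) (group_level l x) (Q - {x,y})"
    using group_level_less by (rule one_sided_refine)
qed

lemma paired_half:
  assumes "even n"
  shows "paired (\<lambda>a. a div 2) {0..<int n}"
  unfolding paired_def
proof
  fix a assume a: "a \<in> {0..<int n}"
  obtain m where half: "n = 2 * m" using assms by (rule evenE)
  then have "0 \<le> a div 2" "a div 2 < int m" using a by auto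
  then have "{b \<in> {0..<int n}. b div 2 = a div 2} = {2 * (a div 2), 2 * (a div 2) + 1}" using half by auto
  then show "card {b \<in> {0..<int n}. b div 2 = a div 2} = 2" by simp
qed

lemma paired_group_level:
  assumes l: "paired l {0..<int g}" and s: "even s" and I: "0 \<notin> I"
  shows "paired (group_level l) (points I g s)"
  unfolding paired_def
proof
  fix x assume "x \<in> points I g s"
  then consider (stem) a where "x = (0,a)" "a \<in> {0..<int s}" |
    (group) i a where "x = (i,a)" "i \<in> I" "a \<in> {0..<int g}" by (auto simp: points_def)
  then show "card {y \<in> points I g s. group_level l y = group_level l x} = 2"
  proof cases
    case stem
    have "{y \<in> points I g s. group_level l y = group_level l x} = {0} \<times> {b\<in>{0..<int s}. b div 2 = a div 2}"
      using stem I by (auto simp: points_def group_level_def)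
    then show ?thesis using paired_half[OF s] stem(2) by (simp add: card_cartesian_product paired_def)
  next
    case group
    then have "i \<noteq> 0" using I by metis
    then have "{y \<in> points I g s. group_level l y = group_level l x} = {i} \<times> {b\<in>{0..<int g}. l b = l a}"
      using group by (auto simp: points_def group_level_def)
    then show ?thesis using l group(3) by (simp add: card_cartesian_product paired_def)
  qed
qed

lemma stem_block:
  assumes S: "exact_cover S (triples (points {i} g 4))" "stepped (group_level l) S" and i: "i \<noteq> 0"
  shows "points {} g 4 \<in> S"
proof -
  have "{0..<4::int} = {0,1,2,3}" by auto
  then have stem: "points {} g 4 = {(0,0),(0,1),(0,2),(0,3)}" by (auto simp: points_def)
  have "v \<in> {(0,0),(0,1)}" if "v \<in> points {i} g 4" "group_level l v < group_level l (0,2)" for v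
    using that i by (auto simp: points_def group_level_def)
  moreover have "{(0,0),(0,1),(0,2),(0,3)} \<subseteq> points {i} g 4" by (auto simp: points_def)
  ultimately show ?thesis unfolding stem
    by (intro two_lowest_levels_block[OF S]) (auto simp: group_level_def)
qed

lemma steppable_fill:
  assumes C: "candelabra_system I g s C" "stepped (group_level l) C"
    and I: "finite I" "0 \<notin> I" "I \<noteq> {}" and s: "s = 2 \<or> s = 4"
    and l: "paired l {0..<int g}" and gs: "steppable (s + g)"
  shows "steppable (s + card I * g)"
proof -
  have "\<exists>A. exact_cover A (triples (points {i} g s)) \<and> stepped (group_level l) A" if "i \<in> I" for i
  proof -
    have "i \<noteq> 0" using that I(2) by metis
    then have "card (points {i} g s) = s + g" by (simp add: card_points)
    moreover have "paired (group_level l) (points {i} g s)"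
      using \<open>i \<noteq> 0\<close> s by (intro paired_group_level[OF l]) auto
    ultimately show ?thesis
      using gs finite_points[of "{i}"] by (intro steppable_system_exists) auto
  qed
  then obtain A where A: "\<And>i. i \<in> I \<Longrightarrow> exact_cover (A i) (triples (points {i} g s))"
    "\<And>i. i \<in> I \<Longrightarrow> stepped (group_level l) (A i)" by metis
  define D where "D = (if s = 4 then {points {} g s} else {})"
  have "exact_cover D (triples (points {} g s))"
    using exact_cover_at_most_4[of "points {} g s"] s by (auto simp: D_def card_points finite_points)
  moreover have "D \<subseteq> A i" if "i \<in> I" for i
    using stem_block[of "A i" i g l] A[OF that] that I(2) by (auto simp: D_def)
  ultimately have "exact_cover (C \<union> (\<Union>i\<in>I. A i)) (triples (points I g s))"
    using exact_cover_fill[OF C(1) I(2,3), of A D] A(1) by blast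
  moreover have "stepped (group_level l) (C \<union> (\<Union>i\<in>I. A i))"
    using C(2) A(2) by (simp add: stepped_Un stepped_UN)
  ultimately have "steppable (card (points I g s))"
    using paired_group_level[OF l _ I(2), of s] s I(1) by (intro steppableI) (auto simp: finite_points)
  then show ?thesis using I by (simp add: card_points)
qed

section \<open>Blowing up a quadruple system\<close>

definition transversals :: "nat set \<Rightarrow> nat \<Rightarrow> (nat \<times> int) set set" where
  "transversals X w =
    {(\<lambda>x. (x, f x)) ` X | f. (\<forall>x\<in>X. f x \<in> {0..<int w}) \<and> int w dvd (\<Sum>x\<in>X. f x)}"

definition blow_up :: "nat set set \<Rightarrow> nat \<Rightarrow> (nat set \<Rightarrow> (nat \<times> int) set set) \<Rightarrow> (nat \<times> int) set set" where
  "blow_up A w C = (\<Union>X\<in>A. if 0 \<in> X then C X else transversals X w)"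

lemma residue_unique:
  assumes "x \<in> {0..<int g}"
  shows "int g dvd z + x \<longleftrightarrow> x = (- z) mod int g"
proof -
  have "int g dvd z + x \<longleftrightarrow> x mod int g = (- z) mod int g" by (simp add: mod_eq_dvd_iff add.commute)
  then show ?thesis using assms by simp
qed

lemma residue_exists:
  assumes "g > 0"
  obtains x where "x \<in> {0..<int g}" "int g dvd z + x"
  using that[of "(- z) mod int g"] assms residue_unique[of "(- z) mod int g" g z] by simp

lemma transversals_inj_on_fst: "Q \<in> transversals X w \<Longrightarrow> inj_on fst Q"
  by (auto simp: transversals_def inj_on_def)

lemma graph_of_inj_on_fst:
  assumes "inj_on fst T"
  obtains t where "T = (\<lambda>x. (x, t x)) ` fst ` T"
proof
  show "T = (\<lambda>x. (x, snd (the_inv_into T fst x))) ` fst ` T"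
    using assms by (force simp: image_image the_inv_into_f_f)
qed

lemma transversal_through_unique:
  assumes Y: "finite Y" "m \<notin> Y" and w: "w > 0" and range: "\<And>x. x \<in> Y \<Longrightarrow> t x \<in> {0..<int w}"
  shows "\<exists>!Q. Q \<in> transversals (insert m Y) w \<and> (\<lambda>x. (x, t x)) ` Y \<subseteq> Q"
proof -
  obtain r where r: "r \<in> {0..<int w}" "int w dvd (\<Sum>x\<in>Y. t x) + r" using residue_exists[OF w] .
  define h where "h = t(m := r)"
  have h_Y: "h x = t x" if "x \<in> Y" for x using that Y(2) by (auto simp: h_def)
  let ?Q = "(\<lambda>x. (x, h x)) ` insert m Y"
  have "(\<Sum>x\<in>insert m Y. h x) = (\<Sum>x\<in>Y. t x) + r"
    using Y h_Y by (simp add: add.commute) (simp add: h_def)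
  moreover have "\<forall>x\<in>insert m Y. h x \<in> {0..<int w}" using r(1) range h_Y by (auto simp: h_def)
  ultimately have transversal: "?Q \<in> transversals (insert m Y) w"
    using r(2) unfolding transversals_def by (intro CollectI exI[of _ h]) simp
  have through: "(\<lambda>x. (x, t x)) ` Y \<subseteq> ?Q" using h_Y by auto
  have unique: "Q = ?Q" if Q: "Q \<in> transversals (insert m Y) w" "(\<lambda>x. (x, t x)) ` Y \<subseteq> Q" for Q
  proof -
    obtain f where f: "Q = (\<lambda>x. (x, f x)) ` insert m Y" "\<forall>x\<in>insert m Y. f x \<in> {0..<int w}"
      "int w dvd (\<Sum>x\<in>insert m Y. f x)" using Q(1) by (auto simp: transversals_def)
    have f_Y: "f x = t x" if "x \<in> Y" for x
    proof -
      have "(x, t x) \<in> Q" using Q(2) that by blast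
      then show ?thesis using f(1) by auto
    qed
    then have "int w dvd (\<Sum>x\<in>Y. t x) + f m" using f(3) Y by (simp add: add.commute)
    then have "f m = r" using f(2) r residue_unique by (metis insertI1)
    then have "f x = h x" if "x \<in> insert m Y" for x using that f_Y h_Y by (auto simp: h_def)
    then show ?thesis using f(1) by (auto intro!: image_cong)
  qed
  show ?thesis
  proof (rule ex1I[of _ ?Q])
    show "?Q \<in> transversals (insert m Y) w \<and> (\<lambda>x. (x, t x)) ` Y \<subseteq> ?Q"
      using transversal through by (rule conjI)
  qed (elim conjE, rule unique)
qed

lemma exact_cover_transversals:
  assumes X: "card X = 4" and w: "w > 0"
  shows "exact_cover (transversals X w) {T \<in> triples (X \<times> {0..<int w}). inj_on fst T}"
proof (rule exact_coverI)
  fix Q assume Q: "Q \<in> transversals X w"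
  then obtain f where f: "Q = (\<lambda>x. (x, f x)) ` X" "\<forall>x\<in>X. f x \<in> {0..<int w}"
    by (auto simp: transversals_def)
  show "card Q = 4" unfolding f(1) using X by (subst card_image) (auto simp: inj_on_def)
  show "T \<in> {T \<in> triples (X \<times> {0..<int w}). inj_on fst T}" if "T \<in> triples Q" for T
    using that f inj_on_subset[OF transversals_inj_on_fst[OF Q]] by (auto simp: triples_def)
next
  fix T assume T: "T \<in> {T \<in> triples (X \<times> {0..<int w}). inj_on fst T}"
  then have T: "card T = 3" "T \<subseteq> X \<times> {0..<int w}" "inj_on fst T" by (auto simp: triples_def)
  then show "card T = 3" by simp
  obtain t where t: "T = (\<lambda>x. (x, t x)) ` fst ` T" using graph_of_inj_on_fst T(3) .
  have Y: "card (fst ` T) = 3" "fst ` T \<subseteq> X" using T by (auto simp: card_image)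
  then have "card (X - fst ` T) = 1" using X by (subst card_Diff_subset) (auto intro: card_ge_0_finite)
  then obtain m where "X - fst ` T = {m}" by (rule card_1_singletonE)
  then have m: "X = insert m (fst ` T)" "m \<notin> fst ` T" using Y(2) by auto
  have "finite (fst ` T)" using Y(1) by (simp add: card_ge_0_finite)
  moreover have "t x \<in> {0..<int w}" if "x \<in> fst ` T" for x
  proof -
    have "(x, t x) \<in> T" using that t by (metis imageI)
    then show ?thesis using T(2) by blast
  qed
  ultimately have through: "\<exists>!Q. Q \<in> transversals X w \<and> T \<subseteq> Q"
    using transversal_through_unique[OF _ m(2) w, of t] m(1) t by simp
  then show "\<exists>Q\<in>transversals X w. T \<subseteq> Q" by blast
  show "Q = Q'" if "Q \<in> transversals X w" "Q' \<in> transversals X w" "T \<subseteq> Q" "T \<subseteq> Q'" for Q Q'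
    using that through by blast
qed

text \<open>
  Hartman's fundamental construction: the point 0 of the quadruple system disappears into the stem. A
  cross triple lies over the three points of the quadruple system given by its shadow.
\<close>

definition shadow :: "(nat \<times> int) set \<Rightarrow> nat set" where
  "shadow T = (if inj_on fst T then fst ` T else insert 0 (fst ` T))"

lemma shadow_cross_triple:
  assumes "T \<in> cross_triples I w s"
  shows "shadow T \<in> triples (insert 0 I)"
proof -
  have T: "card T = 3" "T \<subseteq> points I w s" "2 \<le> card (fst ` T - {0})"
    using assms by (auto simp: cross_triples_def triples_def)
  then have fin: "finite T" by (simp add: card_ge_0_finite)
  have "card (shadow T) = 3"
  proof (cases "inj_on fst T")
    case False
    then have "card (fst ` T) < 3" using T(1) fin card_image_le eq_card_imp_inj_on by (metis le_neq_implies_less)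
    moreover have "card (fst ` T - {0}) \<le> card (fst ` T)" using fin by (intro card_mono) auto
    moreover have "0 \<notin> fst ` T"
    proof
      assume "0 \<in> fst ` T"
      then have "card (fst ` T - {0}) < card (fst ` T)" using fin by (intro psubset_card_mono) auto
      then show False using T(3) \<open>card (fst ` T) < 3\<close> by simp
    qed
    ultimately show ?thesis using T(3) False fin by (simp add: shadow_def)
  qed (use T(1) in \<open>simp add: shadow_def card_image\<close>)
  moreover have "shadow T \<subseteq> insert 0 I" using T(2) by (auto simp: shadow_def points_def)
  ultimately show ?thesis by (simp add: triples_def)
qed

lemma cross_triples_over_pointed_block:
  assumes "0 \<in> X" "X \<subseteq> insert 0 I" "0 \<notin> I"
  shows "{T \<in> cross_triples I w s. shadow T \<subseteq> X} = cross_triples (X - {0}) w s"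
proof -
  have "fst ` T \<subseteq> X \<longleftrightarrow> T \<subseteq> points (X - {0}) w s" if "T \<subseteq> points I w s" for T
    using that assms by (fastforce simp: points_def)
  moreover have "points (X - {0}) w s \<subseteq> points I w s" using assms(2) by (auto simp: points_def)
  ultimately have "T \<in> triples (points I w s) \<and> fst ` T \<subseteq> X \<longleftrightarrow> T \<in> triples (points (X - {0}) w s)" for T
    unfolding triples_def mem_Collect_eq by (meson order_trans)
  moreover have "shadow T \<subseteq> X \<longleftrightarrow> fst ` T \<subseteq> X" for T using assms(1) by (simp add: shadow_def)
  ultimately show ?thesis unfolding cross_triples_def by blast
qed

lemma cross_triples_over_free_block:
  assumes "0 \<notin> X" "X \<subseteq> insert 0 I"
  shows "{T \<in> cross_triples I w s. shadow T \<subseteq> X} = {T \<in> triples (X \<times> {0..<int w}). inj_on fst T}"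
proof (intro equalityI subsetI)
  fix T assume T: "T \<in> {T \<in> cross_triples I w s. shadow T \<subseteq> X}"
  then have "inj_on fst T" "fst ` T \<subseteq> X" using assms(1) by (auto simp: shadow_def split: if_splits)
  moreover have "T \<subseteq> points I w s" "card T = 3" using T by (auto simp: cross_triples_def triples_def)
  moreover have "T \<subseteq> X \<times> {0..<int w}"
  proof
    fix x assume "x \<in> T"
    then have "x \<in> points I w s" "fst x \<in> X" using \<open>T \<subseteq> points I w s\<close> \<open>fst ` T \<subseteq> X\<close> by auto
    then show "x \<in> X \<times> {0..<int w}" using assms(1) by (auto simp: points_def)
  qed
  ultimately show "T \<in> {T \<in> triples (X \<times> {0..<int w}). inj_on fst T}" by (simp add: triples_def)
next
  fix T assume "T \<in> {T \<in> triples (X \<times> {0..<int w}). inj_on fst T}"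
  then have T: "T \<subseteq> X \<times> {0..<int w}" "card T = 3" "inj_on fst T" by (auto simp: triples_def)
  then have "0 \<notin> fst ` T" using assms(1) by auto
  then have "card (fst ` T - {0}) = 3" using T by (simp add: card_image)
  moreover have "T \<subseteq> points I w s" using T(1) assms by (fastforce simp: points_def)
  ultimately show "T \<in> {T \<in> cross_triples I w s. shadow T \<subseteq> X}"
    using T by (auto simp: cross_triples_def triples_def shadow_def)
qed

lemma candelabra_system_blow_up:
  assumes A: "exact_cover A (triples (insert 0 I))" and I: "0 \<notin> I" and w: "w > 0"
    and C: "\<And>X. X \<in> A \<Longrightarrow> 0 \<in> X \<Longrightarrow> candelabra_system (X - {0}) w s (C X)"
  shows "candelabra_system I w s (blow_up A w C)"
  unfolding blow_up_def
proof (rule exact_cover_fibred[OF A shadow_cross_triple])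
  fix X assume X: "X \<in> A"
  then have "X \<subseteq> insert 0 I" "card X = 4"
    using exact_cover_block_subset[OF A] exact_cover_block[OF A] by blast+
  then show "exact_cover (if 0 \<in> X then C X else transversals X w) {T \<in> cross_triples I w s. shadow T \<subseteq> X}"
    using C[OF X] exact_cover_transversals[OF _ w] I
    by (simp add: cross_triples_over_pointed_block cross_triples_over_free_block)
qed

lemma aligned_blow_up:
  assumes "\<And>X. X \<in> A \<Longrightarrow> 0 \<in> X \<Longrightarrow> aligned l (C X)"
  shows "aligned l (blow_up A w C)"
  using assms transversals_inj_on_fst unfolding blow_up_def aligned_UN
  by (auto intro!: aligned_if_inj_on_fst)

definition relabel :: "(nat \<Rightarrow> nat) \<Rightarrow> (nat \<times> int) set set \<Rightarrow> (nat \<times> int) set set" where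
  "relabel e C = (`) (map_prod e id) ` C"

lemma candelabra_system_relabel:
  assumes C: "candelabra_system I g s C" and labelling: "inj_on e (insert 0 I)" "e 0 = 0"
  shows "candelabra_system (e ` I) g s (relabel e C)"
proof -
  let ?h = "map_prod e id"
  have "inj_on ?h (insert 0 I \<times> UNIV)" by (rule map_prod_inj_on[OF labelling(1)]) simp
  then have inj: "inj_on ?h (points I g s)" by (rule inj_on_subset) (auto simp: points_def)
  have im: "?h ` points I g s = points (e ` I) g s"
    using labelling(2) by (force simp: points_def image_iff)
  have "card (fst ` ?h ` T - {0}) = card (fst ` T - {0})" if "T \<subseteq> points I g s" for T
  proof -
    have sub: "fst ` T \<subseteq> insert 0 I" using that by (auto simp: points_def)
    have "fst ` ?h ` T = e ` fst ` T" by (simp add: image_image)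
    moreover have "e ` (fst ` T - {0}) = e ` fst ` T - e ` {0}"
      using sub by (intro inj_on_image_set_diff[OF labelling(1)]) auto
    ultimately have "fst ` ?h ` T - {0} = e ` (fst ` T - {0})" using labelling(2) by simp
    moreover have "inj_on e (fst ` T - {0})" using sub by (intro inj_on_subset[OF labelling(1)]) auto
    ultimately show ?thesis by (simp add: card_image)
  qed
  then have "(`) ?h ` cross_triples I g s = {T \<in> (`) ?h ` triples (points I g s). 2 \<le> card (fst ` T - {0})}"
    by (auto simp: cross_triples_def triples_def)
  then have "(`) ?h ` cross_triples I g s = cross_triples (e ` I) g s"
    by (simp add: image_triples[OF inj] im cross_triples_def)
  then show ?thesis
    using exact_cover_image[OF C inj cross_triples_subset_points] by (simp add: relabel_def)
qed

lemma aligned_relabel: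
  assumes C: "aligned l C" "\<And>Q. Q \<in> C \<Longrightarrow> fst ` Q \<subseteq> insert 0 I"
    and labelling: "inj_on e (insert 0 I)" "e 0 = 0"
  shows "aligned l (relabel e C)"
  unfolding relabel_def
proof (rule aligned_image[OF C(1)])
  fix Q x y assume "Q \<in> C" "x \<in> Q" "y \<in> Q"
  then have "fst x \<in> insert 0 I" "fst y \<in> insert 0 I" using C(2) by blast+
  then show "fst (map_prod e id x) = fst (map_prod e id y) \<longleftrightarrow> fst x = fst y"
    using inj_onD[OF labelling(1)] by auto
qed (use labelling(2) in auto)

lemma block_labelling:
  fixes X :: "nat set"
  assumes "card X = 4" "0 \<in> X"
  obtains e where "inj_on e (insert 0 {1..3::nat})" "e 0 = 0" "e ` {1..3} = X - {0}"
proof -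
  have "card {1..3::nat} = card (X - {0})" using assms by simp
  then obtain b where b: "bij_betw b {1..3::nat} (X - {0})"
    using finite_same_card_bij[of "{1..3::nat}" "X - {0}"] assms card_ge_0_finite[of X] by auto
  show ?thesis
  proof (rule that[of "b(0 := 0)"])
    show im: "(b(0 := 0)) ` {1..3} = X - {0}" using b by (simp add: bij_betw_def)
    have "inj_on (b(0 := 0)) {1..3}" using b by (auto simp: bij_betw_def inj_on_def)
    then show "inj_on (b(0 := 0)) (insert 0 {1..3})" using im by simp
  qed simp
qed

lemma candelabra_system_fst:
  "candelabra_system I g s C \<Longrightarrow> Q \<in> C \<Longrightarrow> fst ` Q \<subseteq> insert 0 I"
  using candelabra_block_subset by (fastforce simp: points_def)

lemma aligned_candelabra_system_on_block:
  assumes C: "candelabra_system {1..3} g s C" "aligned l C" and X: "card X = 4" "0 \<in> X"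
  shows "\<exists>C'. candelabra_system (X - {0}) g s C' \<and> aligned l C'"
proof -
  obtain e :: "nat \<Rightarrow> nat" where labelling: "inj_on e (insert 0 {1..3})" "e 0 = 0" "e ` {1..3} = X - {0}"
    using block_labelling[OF X] .
  have "candelabra_system (X - {0}) g s (relabel e C)"
    using candelabra_system_relabel[OF C(1) labelling(1,2)] labelling(3) by simp
  then show ?thesis using aligned_relabel[OF C(2) candelabra_system_fst[OF C(1)] labelling(1,2)] by blast
qed

lemma steppable_blow_up:
  assumes n: "steppable n" "n \<ge> 2" and g: "g > 0" "steppable (s + g)" and s: "s = 2 \<or> s = 4"
    and C: "candelabra_system {1..3} g s C" "aligned l C" and l: "paired l {0..<int g}"
  shows "steppable (s + (n - 1) * g)"
proof -
  have insert_0: "insert 0 {1..<n} = {0..<n}" using n(2) by auto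
  obtain A where A: "exact_cover A (triples (insert 0 {1..<n}))"
    using n(1) unfolding steppable_def insert_0 by blast
  have "\<exists>C'. candelabra_system (X - {0}) g s C' \<and> aligned l C'" if "X \<in> A" "0 \<in> X" for X
    using aligned_candelabra_system_on_block[OF C exact_cover_block[OF A that(1)] that(2)] .
  then obtain C' where C': "\<And>X. X \<in> A \<Longrightarrow> 0 \<in> X \<Longrightarrow> candelabra_system (X - {0}) g s (C' X)"
    "\<And>X. X \<in> A \<Longrightarrow> 0 \<in> X \<Longrightarrow> aligned l (C' X)" by metis
  have system: "candelabra_system {1..<n} g s (blow_up A g C')"
    using C'(1) by (intro candelabra_system_blow_up[OF A _ g(1)]) auto
  have "stepped (group_level l) (blow_up A g C')"
    using stepped_if_aligned[OF system order_refl aligned_blow_up] C'(2) by blast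
  then have "steppable (s + card {1..<n} * g)"
    using n(2) s by (intro steppable_fill[OF system _ _ _ _ _ l g(2)]) auto
  then show ?thesis by simp
qed

section \<open>One-factorizations\<close>

definition matching :: "'a set \<Rightarrow> ('a \<Rightarrow> 'a) \<Rightarrow> bool" where
  "matching X m \<longleftrightarrow> (\<forall>x\<in>X. m x \<in> X \<and> m (m x) = x \<and> m x \<noteq> x)"

definition matchings_cover :: "'a set \<Rightarrow> ('a \<Rightarrow> 'a \<Rightarrow> bool) \<Rightarrow> ('a \<Rightarrow> 'a) set \<Rightarrow> bool" where
  "matchings_cover X E F \<longleftrightarrow> finite F \<and> (\<forall>m\<in>F. matching X m) \<and>
     (\<forall>x\<in>X. \<forall>y\<in>X. E x y \<longrightarrow> (\<exists>m\<in>F. m x = y))"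

lemma matchingI:
  assumes "\<And>x. x \<in> X \<Longrightarrow> m x \<in> X" "\<And>x. x \<in> X \<Longrightarrow> m (m x) = x" "\<And>x. x \<in> X \<Longrightarrow> m x \<noteq> x"
  shows "matching X m"
  using assms by (simp add: matching_def)

lemma card_edges_matching:
  assumes "finite X" "matching X m"
  shows "2 * card ((\<lambda>x. {x, m x}) ` X) = card X"
proof -
  let ?E = "(\<lambda>x. {x, m x}) ` X"
  have involution: "m x \<in> X" "m (m x) = x" "m x \<noteq> x" if "x \<in> X" for x
    using assms(2) that by (auto simp: matching_def)
  have "\<Union>?E = X" using involution(1) by auto
  moreover have "2 * card ?E = card (\<Union>?E)"
  proof (rule card_partition)
    fix e e' assume "e \<in> ?E" "e' \<in> ?E" "e \<noteq> e'"
    then obtain x y where edges: "e = {x, m x}" "e' = {y, m y}" "x \<in> X" "y \<in> X" by auto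
    have "{x, m x} = {z, m z}" if "x \<in> X" "z \<in> {x, m x}" for x z using that involution(2) by auto
    then have "e = e'" if "z \<in> e" "z \<in> e'" for z using that edges by metis
    then show "e \<inter> e' = {}" using \<open>e \<noteq> e'\<close> by blast
  qed (use assms(1) involution(3) \<open>\<Union>?E = X\<close> in \<open>auto simp: card_2_iff\<close>)
  ultimately show ?thesis by simp
qed

lemma matchings_cover_Un:
  assumes "matchings_cover X E F" "matchings_cover X E' F'"
    and "\<And>x y. x \<in> X \<Longrightarrow> y \<in> X \<Longrightarrow> H x y \<Longrightarrow> E x y \<or> E' x y"
  shows "matchings_cover X H (F \<union> F')"
  using assms unfolding matchings_cover_def by (metis UnE UnI1 UnI2 finite_UnI)

lemma residue_eqI:
  fixes n :: int
  assumes "n dvd x - y" "x \<in> {0..<n}" "y \<in> {0..<n}"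
  shows "x = y"
  using assms by (simp flip: mod_eq_dvd_iff)

text \<open>The round robin schedule: the colour of an edge is its sum modulo the odd number \<open>h\<close>.\<close>

definition round_robin :: "int \<Rightarrow> int \<Rightarrow> int \<Rightarrow> int" where
  "round_robin h c x = (if x = h then (c * ((h + 1) div 2)) mod h
     else if h dvd 2 * x - c then h else (c - x) mod h)"

lemma round_robin_last_iff:
  assumes h: "odd h" "h > 0" and x: "x \<in> {0..<h}"
  shows "round_robin h c h = x \<longleftrightarrow> h dvd 2 * x - c"
proof -
  let ?y = "round_robin h c h"
  have y: "?y = (c * ((h + 1) div 2)) mod h" by (simp add: round_robin_def)
  have "h dvd c * ((h + 1) div 2) - ?y" unfolding y by (simp flip: mod_eq_dvd_iff)
  then have "h dvd c * h - 2 * (c * ((h + 1) div 2) - ?y)"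
    by (rule dvd_diff[OF dvd_triv_right dvd_mult])
  moreover have "2 * ((h + 1) div 2) = h + 1" using h(1) by presburger
  then have "c * h - 2 * (c * ((h + 1) div 2) - ?y) = 2 * ?y - c" by algebra
  ultimately have "h dvd 2 * ?y - c" by (simp only:)
  moreover have "?y \<in> {0..<h}" unfolding y using h(2) by simp
  moreover have "coprime h 2" using h(1) by simp
  moreover have "2 * ?y - c - (2 * x - c) = 2 * (?y - x)" by simp
  ultimately show ?thesis
    using x residue_eqI[of h ?y x] coprime_dvd_mult_right_iff[of h 2 "?y - x"] dvd_diff by metis
qed

lemma matching_round_robin:
  assumes h: "odd h" "h > 0"
  shows "matching {0..<h + 1} (round_robin h c)"
  unfolding matching_def
proof
  fix x assume x: "x \<in> {0..<h + 1}"
  let ?y = "round_robin h c x"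
  consider (last) "x = h" | (fixed) "x \<in> {0..<h}" "h dvd 2 * x - c"
    | (moved) "x \<in> {0..<h}" "\<not> h dvd 2 * x - c" using x by force
  then show "?y \<in> {0..<h + 1} \<and> round_robin h c ?y = x \<and> ?y \<noteq> x"
  proof cases
    case last
    then have "?y \<in> {0..<h}" using h(2) by (simp add: round_robin_def)
    then show ?thesis using round_robin_last_iff[OF h, of ?y c] last by (auto simp: round_robin_def)
  next
    case fixed
    then show ?thesis using round_robin_last_iff[OF h fixed(1)] h(2) by (auto simp: round_robin_def)
  next
    case moved
    then have y: "?y = (c - x) mod h" by (auto simp: round_robin_def)
    have y_range: "?y \<in> {0..<h}" unfolding y using h(2) by simp
    have "h dvd c - x - ?y" unfolding y by (simp flip: mod_eq_dvd_iff)
    then have "h dvd (2 * ?y - c) + 2 * (c - x - ?y) \<longleftrightarrow> h dvd 2 * ?y - c"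
      by (intro dvd_add_left_iff dvd_mult)
    moreover have "(2 * ?y - c) + 2 * (c - x - ?y) = - (2 * x - c)" by simp
    ultimately have "\<not> h dvd 2 * ?y - c" using moved(2) by (metis dvd_minus_iff)
    then have "round_robin h c ?y = (c - (c - x) mod h) mod h"
      using y_range y by (auto simp: round_robin_def)
    also have "\<dots> = x" using moved(1) by (simp add: mod_diff_right_eq)
    finally have "round_robin h c ?y = x" .
    moreover have "?y \<noteq> x"
      using \<open>h dvd c - x - ?y\<close> moved(2) by (metis diff_diff_eq mult_2 dvd_minus_iff minus_diff_eq)
    ultimately show ?thesis using y_range by simp
  qed
qed

lemma round_robin_colour_exists:
  assumes h: "odd h" "h > 0" and xy: "x \<in> {0..<h + 1}" "y \<in> {0..<h + 1}" "x \<noteq> y"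
  shows "\<exists>c\<in>{0..<h}. round_robin h c x = y"
proof -
  have mod_dvd: "h dvd z - z mod h" for z by (simp flip: mod_eq_dvd_iff)
  consider (to_last) "y = h" "x \<in> {0..<h}" | (from_last) "x = h" "y \<in> {0..<h}"
    | (other) "x \<in> {0..<h}" "y \<in> {0..<h}" using xy by force
  then show ?thesis
  proof cases
    case to_last
    then show ?thesis using h(2) mod_dvd[of "2 * x"]
      by (intro bexI[of _ "(2 * x) mod h"]) (auto simp: round_robin_def)
  next
    case from_last
    then show ?thesis using h(2) mod_dvd[of "2 * y"] round_robin_last_iff[OF h from_last(2)]
      by (intro bexI[of _ "(2 * y) mod h"]) auto
  next
    case other
    have "h dvd x + y - (x + y) mod h" by (rule mod_dvd)
    then have "h dvd (x - y) + (x + y - (x + y) mod h) \<longleftrightarrow> h dvd x - y"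
      by (rule dvd_add_left_iff)
    moreover have "(x - y) + (x + y - (x + y) mod h) = 2 * x - (x + y) mod h" by simp
    moreover have "\<not> h dvd x - y" using residue_eqI[of h x y] other xy(3) by blast
    ultimately have "\<not> h dvd 2 * x - (x + y) mod h" by metis
    then have "round_robin h ((x + y) mod h) x = ((x + y) mod h - x) mod h"
      using other(1) by (auto simp: round_robin_def)
    also have "\<dots> = y" using other(2) by (simp add: mod_diff_left_eq)
    finally show ?thesis using h(2) by (intro bexI[of _ "(x + y) mod h"]) auto
  qed
qed

lemma one_factorization:
  assumes n: "even n" "n > 0"
  shows "\<exists>F. matchings_cover {0..<int n} (\<noteq>) F \<and> card F \<le> n - 1"
proof -
  define h where "h = int n - 1"
  have h: "odd h" "h > 0" "int n = h + 1" using n by (auto simp: h_def elim!: evenE)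
  have "matchings_cover {0..<int n} (\<noteq>) (round_robin h ` {0..<h})"
    using matching_round_robin[OF h(1,2)] round_robin_colour_exists[OF h(1,2)] h(3)
    by (simp add: matchings_cover_def)
  moreover have "card (round_robin h ` {0..<h}) \<le> n - 1"
    using card_image_le[of "{0..<h}" "round_robin h"] by (simp add: h_def)
  ultimately show ?thesis by blast
qed

definition doubled :: "(int \<Rightarrow> int) \<Rightarrow> int \<Rightarrow> int" where
  "doubled f x = 2 * f (x div 2) + x mod 2"

lemma even_differences_cover:
  fixes k :: int
  assumes F: "matchings_cover {0..<k} (\<noteq>) F"
  shows "matchings_cover {0..<2 * k} (\<lambda>x y. x \<noteq> y \<and> even (y - x)) (doubled ` F)"
    (is "matchings_cover ?X ?E _")
proof -
  have half: "x div 2 \<in> {0..<k}" if "x \<in> ?X" for x :: int using that by auto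
  have "matching ?X (doubled f)" if "f \<in> F" for f
  proof (rule matchingI)
    fix x assume "x \<in> ?X"
    then have f: "f (x div 2) \<in> {0..<k}" "f (f (x div 2)) = x div 2" "f (x div 2) \<noteq> x div 2"
      using F half that by (auto simp: matchings_cover_def matching_def)
    have x: "x = 2 * (x div 2) + x mod 2" "0 \<le> x mod 2" "x mod 2 < 2" by simp_all
    show "doubled f x \<in> ?X" using f(1) x(2,3) by (auto simp: doubled_def)
    show "doubled f x \<noteq> x" using f(3) x(1) by (simp add: doubled_def)
    show "doubled f (doubled f x) = x" using f(2) x by (simp add: doubled_def)
  qed
  moreover have "\<exists>f\<in>F. doubled f x = y" if xy: "x \<in> ?X" "y \<in> ?X" "?E x y" for x y
  proof -
    have "x mod 2 = y mod 2" using xy(3) by presburger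
    moreover from this have "x div 2 \<noteq> y div 2" using xy(3) by (metis div_mult_mod_eq)
    then obtain f where "f \<in> F" "f (x div 2) = y div 2"
      using F half xy(1,2) unfolding matchings_cover_def by blast
    ultimately show ?thesis by (intro bexI[of _ f]) (simp_all add: doubled_def)
  qed
  ultimately show ?thesis using F by (auto simp: matchings_cover_def)
qed

definition alternating_shift :: "int \<Rightarrow> int \<Rightarrow> int \<Rightarrow> int" where
  "alternating_shift g d x = (if even x then (x + d) mod g else (x - d) mod g)"

lemma odd_differences_cover:
  fixes g :: int
  assumes g: "even g" "g > 0" and D: "D \<subseteq> {0..<g}" "\<And>d. d \<in> D \<Longrightarrow> odd d"
  shows "matchings_cover {0..<g} (\<lambda>x y. (y - x) mod g \<in> D \<and> (x - y) mod g \<in> D) (alternating_shift g ` D)"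
proof -
  have parity: "even (z mod g) \<longleftrightarrow> even z" for z using g(1) by (simp add: dvd_mod_iff)
  have "matching {0..<g} (alternating_shift g d)" if "d \<in> D" for d
  proof (rule matchingI)
    fix x assume x: "x \<in> {0..<g}"
    have "odd d" using D(2) that .
    show "alternating_shift g d x \<in> {0..<g}" using g(2) by (simp add: alternating_shift_def)
    have "even (alternating_shift g d x) \<longleftrightarrow> odd x" using \<open>odd d\<close> parity by (simp add: alternating_shift_def)
    then show "alternating_shift g d x \<noteq> x" by auto
    show "alternating_shift g d (alternating_shift g d x) = x"
      using \<open>odd d\<close> parity x by (simp add: alternating_shift_def mod_diff_left_eq mod_add_left_eq)
  qed
  moreover have "\<exists>d\<in>D. alternating_shift g d x = y"
    if xy: "x \<in> {0..<g}" "y \<in> {0..<g}" "(y - x) mod g \<in> D" "(x - y) mod g \<in> D" for x y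
  proof (cases "even x")
    case True
    then show ?thesis using xy
      by (intro bexI[of _ "(y - x) mod g"]) (simp_all add: alternating_shift_def mod_add_right_eq)
  next
    case False
    then show ?thesis using xy
      by (intro bexI[of _ "(x - y) mod g"]) (simp_all add: alternating_shift_def mod_diff_right_eq)
  qed
  moreover have "finite D" using D(1) by (rule finite_subset) simp
  ultimately show ?thesis by (auto simp: matchings_cover_def)
qed

text \<open>The two fixed points \<open>c\<close> and \<open>c + k\<close> of the reflection \<open>x \<mapsto> 2 c - x\<close> modulo \<open>2 k\<close> are exchanged.\<close>

definition reflection :: "int \<Rightarrow> int \<Rightarrow> int \<Rightarrow> int" where
  "reflection k c x = (if x = c then c + k else if x = c + k then c else (2 * c - x) mod (2 * k))"

lemma reflection_fixed_points:
  fixes c k x :: int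
  assumes c: "c \<in> {0..<k}" and x: "x \<in> {0..<2 * k}" "k dvd c - x"
  shows "x = c \<or> x = c + k"
proof (cases "x < k")
  case True
  then show ?thesis using c x residue_eqI[of k c x] by auto
next
  case False
  have "k dvd c - (x - k)" using x(2) by (simp add: algebra_simps flip: dvd_add_triv_right_iff[of k "c - x"])
  then show ?thesis using residue_eqI[of k c "x - k"] x(1) False c by auto
qed

lemma matching_reflection:
  assumes c: "c \<in> {0..<k}"
  shows "matching {0..<2 * k} (reflection k c)"
  unfolding matching_def
proof
  fix x assume x: "x \<in> {0..<2 * k}"
  show "reflection k c x \<in> {0..<2 * k} \<and> reflection k c (reflection k c x) = x \<and> reflection k c x \<noteq> x"
  proof (cases "x = c \<or> x = c + k")
    case True
    then show ?thesis using c by (auto simp: reflection_def)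
  next
    case False
    define y where "y = (2 * c - x) mod (2 * k)"
    have y: "reflection k c x = y" "y \<in> {0..<2 * k}" using False c by (auto simp: reflection_def y_def)
    have y_dvd: "2 * k dvd 2 * c - x - y" unfolding y_def by (simp flip: mod_eq_dvd_iff)
    have "y \<noteq> x"
    proof
      assume "y = x"
      then have "2 * k dvd 2 * (c - x)" using y_dvd by (simp add: algebra_simps)
      then have "k dvd c - x" by (subst (asm) dvd_mult_cancel_left) simp
      then show False using reflection_fixed_points[OF c x] False by auto
    qed
    moreover have "y \<noteq> c \<and> y \<noteq> c + k"
    proof (rule ccontr)
      assume "\<not> (y \<noteq> c \<and> y \<noteq> c + k)"
      then have "2 * k dvd c - x \<or> 2 * k dvd c - x - k" using y_dvd by (auto simp: algebra_simps)
      then have "k dvd c - x \<or> k dvd c - x - k" by (meson dvd_mult_right)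
      then have "k dvd c - x" by (metis diff_add_cancel dvd_add_triv_right_iff)
      then show False using reflection_fixed_points[OF c x] False by auto
    qed
    moreover have "(2 * c - y) mod (2 * k) = x" using x by (simp add: y_def mod_diff_right_eq)
    ultimately show ?thesis using y by (simp add: reflection_def)
  qed
qed

lemma reflections_cover:
  assumes "k > 0"
  shows "matchings_cover {0..<2 * k} (\<lambda>x y. x \<noteq> y \<and> (even (y - x) \<or> \<bar>y - x\<bar> = k)) (reflection k ` {0..<k})"
proof -
  have "\<exists>c\<in>{0..<k}. reflection k c x = y"
    if xy: "x \<in> {0..<2 * k}" "y \<in> {0..<2 * k}" "x \<noteq> y" "even (y - x) \<or> \<bar>y - x\<bar> = k" for x y
  proof (cases "\<bar>y - x\<bar> = k")
    case True
    then show ?thesis using xy(1,2)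
      by (intro bexI[of _ "min x y"]) (auto simp: reflection_def min_def abs_if split: if_splits)
  next
    case False
    then obtain n where n: "x + y = 2 * n" using xy(4) by (metis dvd_def even_add even_diff)
    let ?c = "n mod k"
    have "k dvd n - ?c" by (simp flip: mod_eq_dvd_iff)
    then have "2 * k dvd 2 * (n - ?c)" by (rule mult_dvd_mono[OF dvd_refl])
    then have reflected: "2 * k dvd 2 * ?c - x - y" using n by (simp add: algebra_simps dvd_diff_commute)
    have "\<not> 2 * k dvd x - y" using residue_eqI[of "2 * k" x y] xy(1-3) by blast
    moreover have "2 * k dvd x - y" if "x = ?c + k"
      using dvd_add[OF reflected dvd_refl] that by (simp add: algebra_simps)
    ultimately have "x \<noteq> ?c" "x \<noteq> ?c + k" using reflected by auto
    moreover have "(2 * ?c - x) mod (2 * k) = y mod (2 * k)" using reflected by (simp add: mod_eq_dvd_iff)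
    ultimately show ?thesis using xy(2) assms by (intro bexI[of _ ?c]) (auto simp: reflection_def)
  qed
  then show ?thesis using matching_reflection by (auto simp: matchings_cover_def)
qed

definition odd_distances :: "nat \<Rightarrow> nat \<Rightarrow> int set" where
  "odd_distances p g = {d. odd d \<and> 2 * int p < d \<and> d < int g - 2 * int p}"

definition even_or_distant :: "nat \<Rightarrow> nat \<Rightarrow> int \<Rightarrow> int \<Rightarrow> bool" where
  "even_or_distant p g x y \<longleftrightarrow> x \<noteq> y \<and>
     (even (y - x) \<or> 2 * int p < \<bar>y - x\<bar> \<and> \<bar>y - x\<bar> < int g - 2 * int p)"

lemma card_odd_distances:
  assumes "4 * p + 2 \<le> 2 * k"
  shows "finite (odd_distances p (2 * k))" "card (odd_distances p (2 * k)) \<le> k - 2 * p"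
proof -
  have sub: "odd_distances p (2 * k) \<subseteq> (\<lambda>e. 2 * e + 1) ` {int p..<int k - int p}"
    by (auto simp: odd_distances_def elim!: oddE)
  then show "finite (odd_distances p (2 * k))" by (auto intro: finite_subset)
  have "card (odd_distances p (2 * k)) \<le> card {int p..<int k - int p}" using sub by (intro surj_card_le) simp_all
  then show "card (odd_distances p (2 * k)) \<le> k - 2 * p" using assms by simp
qed

lemma difference_mod:
  fixes g :: int
  assumes "x \<in> {0..<g}" "y \<in> {0..<g}"
  shows "(y - x) mod g = (if x \<le> y then y - x else y - x + g)"
  using assms mod_add_self2[of "y - x" g] by (auto simp del: mod_add_self2)

lemma distant_in_odd_distances:
  assumes "x \<in> {0..<2 * int k}" "y \<in> {0..<2 * int k}" "even_or_distant p (2 * k) x y" "odd (y - x)"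
  shows "(y - x) mod (2 * int k) \<in> odd_distances p (2 * k)" "(x - y) mod (2 * int k) \<in> odd_distances p (2 * k)"
  using assms difference_mod[of x "2 * int k" y] difference_mod[of y "2 * int k" x]
  by (auto simp: odd_distances_def even_or_distant_def)

lemma half_not_difference:
  fixes k :: int
  assumes "x \<in> {0..<2 * k}" "y \<in> {0..<2 * k}" "\<bar>y - x\<bar> \<noteq> k"
  shows "(y - x) mod (2 * k) \<noteq> k" "(x - y) mod (2 * k) \<noteq> k"
  using assms difference_mod[of x "2 * k" y] difference_mod[of y "2 * k" x] by auto

lemma alternating_shifts_cover:
  assumes "4 * p + 2 \<le> 2 * k" "D \<subseteq> odd_distances p (2 * k)"
  shows "matchings_cover {0..<2 * int k} (\<lambda>x y. (y - x) mod (2 * int k) \<in> D \<and> (x - y) mod (2 * int k) \<in> D)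
    (alternating_shift (2 * int k) ` D)"
  using assms by (intro odd_differences_cover) (auto simp: odd_distances_def)

lemma partial_one_factorization_even:
  assumes k: "even k" "4 * p + 2 \<le> 2 * k"
  shows "\<exists>F. matchings_cover {0..<2 * int k} (even_or_distant p (2 * k)) F \<and> card F + 2 * p + 1 \<le> 2 * k"
proof -
  define D where "D = odd_distances p (2 * k)"
  have D: "finite D" "card D \<le> k - 2 * p" using card_odd_distances[OF k(2)] by (simp_all add: D_def)
  obtain F where F: "matchings_cover {0..<int k} (\<noteq>) F" "card F \<le> k - 1"
    using one_factorization[OF k(1)] k(2) by auto
  let ?F = "doubled ` F \<union> alternating_shift (2 * int k) ` D"
  have "card ?F \<le> card F + card D"
    using F(1) D(1) by (intro order_trans[OF card_Un_le] add_mono card_image_le) (auto simp: matchings_cover_def)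
  moreover have "matchings_cover {0..<2 * int k} (even_or_distant p (2 * k)) ?F"
  proof (rule matchings_cover_Un[OF even_differences_cover[OF F(1)] alternating_shifts_cover[OF k(2)]])
    fix x y assume "x \<in> {0..<2 * int k}" "y \<in> {0..<2 * int k}" "even_or_distant p (2 * k) x y"
    then show "(x \<noteq> y \<and> even (y - x)) \<or> ((y - x) mod (2 * int k) \<in> D \<and> (x - y) mod (2 * int k) \<in> D)"
      using distant_in_odd_distances[of x k y p] by (auto simp: D_def even_or_distant_def)
  qed (simp add: D_def)
  ultimately show ?thesis using F(2) D(2) k(2) by (intro exI[of _ ?F]) linarith
qed

lemma partial_one_factorization_odd:
  assumes k: "odd k" "4 * p + 2 \<le> 2 * k"
  shows "\<exists>F. matchings_cover {0..<2 * int k} (even_or_distant p (2 * k)) F \<and> card F + 2 * p + 1 \<le> 2 * k"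
proof -
  define D where "D = odd_distances p (2 * k)"
  have D: "finite D" "card D \<le> k - 2 * p" using card_odd_distances[OF k(2)] by (simp_all add: D_def)
  let ?F = "reflection (int k) ` {0..<int k} \<union> alternating_shift (2 * int k) ` (D - {int k})"
  have "int k \<in> D" using k by (auto simp: D_def odd_distances_def)
  then have "card D = Suc (card (D - {int k}))" by (rule card.remove[OF D(1)])
  moreover have "card ?F \<le> card {0..<int k} + card (D - {int k})"
    using D(1) by (intro order_trans[OF card_Un_le] add_mono card_image_le) auto
  moreover have "matchings_cover {0..<2 * int k} (even_or_distant p (2 * k)) ?F"
  proof (rule matchings_cover_Un[OF reflections_cover alternating_shifts_cover[OF k(2)]])
    fix x y assume xy: "x \<in> {0..<2 * int k}" "y \<in> {0..<2 * int k}" "even_or_distant p (2 * k) x y"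
    show "(x \<noteq> y \<and> (even (y - x) \<or> \<bar>y - x\<bar> = int k)) \<or>
        ((y - x) mod (2 * int k) \<in> D - {int k} \<and> (x - y) mod (2 * int k) \<in> D - {int k})"
    proof (cases "even (y - x) \<or> \<bar>y - x\<bar> = int k")
      case True
      then show ?thesis using xy(3) by (simp add: even_or_distant_def)
    next
      case False
      then show ?thesis
        using distant_in_odd_distances[OF xy(1-3)] half_not_difference[OF xy(1,2)] by (simp add: D_def)
    qed
  qed (use k(2) in \<open>auto simp: D_def\<close>)
  ultimately show ?thesis using D(2) k(2) by (intro exI[of _ ?F]) simp
qed

lemma partial_one_factorization:
  assumes "even g" "4 * p + 2 \<le> g"
  shows "\<exists>F. matchings_cover {0..<int g} (even_or_distant p g) F \<and> card F + 2 * p + 1 \<le> g"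
proof -
  obtain k where "g = 2 * k" using assms(1) by (rule evenE)
  then show ?thesis
    using partial_one_factorization_even[of k p] partial_one_factorization_odd[of k p] assms(2)
    by (cases "even k") simp_all
qed

section \<open>Pairs of edges of equal colour\<close>

definition squares :: "int set \<Rightarrow> (int \<Rightarrow> int) set \<Rightarrow> nat \<Rightarrow> nat \<Rightarrow> (nat \<times> int) set set" where
  "squares Z F i j = {{(i,x),(i,m x),(j,y),(j,m y)} | m x y. m \<in> F \<and> x \<in> Z \<and> y \<in> Z}"

lemma squares_commute: "squares Z F i j = squares Z F j i"
proof -
  have "squares Z F i j \<subseteq> squares Z F j i" for i j
  proof
    fix Q assume "Q \<in> squares Z F i j"
    then obtain m x y where "Q = {(i,x),(i,m x),(j,y),(j,m y)}" "m \<in> F" "x \<in> Z" "y \<in> Z"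
      by (auto simp: squares_def)
    moreover from this have "Q = {(j,y),(j,m y),(i,x),(i,m x)}" by (simp add: insert_commute)
    ultimately show "Q \<in> squares Z F j i" unfolding squares_def by blast
  qed
  then show ?thesis by blast
qed

lemma squares_cover:
  assumes "matchings_cover Z E F" "x \<in> Z" "x' \<in> Z" "y \<in> Z" "E x x'"
  shows "\<exists>Q\<in>squares Z F i j. {(i,x),(i,x'),(j,y)} \<subseteq> Q"
proof -
  obtain m where "m \<in> F" "m x = x'" using assms unfolding matchings_cover_def by blast
  then have "{(i,x),(i,x'),(j,y),(j,m y)} \<in> squares Z F i j"
    using assms(2,4) unfolding squares_def by blast
  then show ?thesis by (rule rev_bexI) auto
qed

lemma card_squares:
  assumes Z: "finite Z" and F: "matchings_cover Z E F"
  shows "finite (squares Z F i j)" "4 * card (squares Z F i j) \<le> card F * card Z ^ 2"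
proof -
  define edges where "edges m = (\<lambda>x. {x, m x}) ` Z" for m :: "int \<Rightarrow> int"
  let ?square = "\<lambda>(e,e'). {i} \<times> e \<union> {j} \<times> e'"
  let ?S = "\<Union>m\<in>F. ?square ` (edges m \<times> edges m)"
  have sub: "squares Z F i j \<subseteq> ?S"
  proof
    fix Q assume "Q \<in> squares Z F i j"
    then obtain m x y where "Q = {(i,x),(i,m x),(j,y),(j,m y)}" "m \<in> F" "x \<in> Z" "y \<in> Z"
      unfolding squares_def by blast
    moreover from this have "Q = ?square ({x, m x}, {y, m y})" by auto
    ultimately show "Q \<in> ?S" unfolding edges_def by blast
  qed
  have edges: "2 * card (edges m) = card Z" if "m \<in> F" for m
    using F card_edges_matching[OF Z] that by (auto simp: edges_def matchings_cover_def)
  have "finite F" using F by (simp add: matchings_cover_def)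
  then have finS: "finite ?S" using Z by (simp add: edges_def)
  then show "finite (squares Z F i j)" by (rule finite_subset[OF sub])
  have "card (squares Z F i j) \<le> card ?S" by (rule card_mono[OF finS sub])
  also have "\<dots> \<le> (\<Sum>m\<in>F. card (?square ` (edges m \<times> edges m)))"
    by (rule card_UN_le[OF \<open>finite F\<close>])
  also have "\<dots> \<le> (\<Sum>m\<in>F. card (edges m) ^ 2)"
  proof (rule sum_mono)
    fix m
    have "card (?square ` (edges m \<times> edges m)) \<le> card (edges m \<times> edges m)"
      using Z by (intro card_image_le) (simp add: edges_def)
    then show "card (?square ` (edges m \<times> edges m)) \<le> card (edges m) ^ 2"
      by (simp add: card_cartesian_product power2_eq_square)
  qed
  finally have "card (squares Z F i j) \<le> (\<Sum>m\<in>F. card (edges m) ^ 2)" .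
  moreover have "(\<Sum>m\<in>F. (2 * card (edges m)) ^ 2) = 4 * (\<Sum>m\<in>F. card (edges m) ^ 2)"
    by (simp add: power_mult_distrib sum_distrib_left)
  ultimately have "4 * card (squares Z F i j) \<le> (\<Sum>m\<in>F. (2 * card (edges m)) ^ 2)" by simp
  also have "\<dots> = card F * card Z ^ 2" using edges by simp
  finally show "4 * card (squares Z F i j) \<le> card F * card Z ^ 2" .
qed

lemma squares_block: "Q \<in> squares Z F i j \<Longrightarrow> \<exists>a b c d. Q = {a,b,c,d}"
  unfolding squares_def by blast

lemma aligned_squares:
  assumes "i \<noteq> j"
  shows "aligned l (squares Z F i j)"
proof (rule alignedI)
  fix Q u v z w
  assume "Q \<in> squares Z F i j" "{u,v,z,w} \<subseteq> Q" and uv_ne: "u \<noteq> v" "fst u = fst v"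
    and not_uv: "z \<notin> {u,v}" "w \<notin> {u,v}"
  then obtain m x y where "Q = {(i,x),(i,m x),(j,y),(j,m y)}" unfolding squares_def by blast
  then have Q: "Q = {(i,x),(i,m x)} \<union> {(j,y),(j,m y)}" (is "_ = ?P \<union> ?R") by auto
  have uv: "u \<in> Q" "v \<in> Q" and zw: "z \<in> Q" "w \<in> Q" using \<open>{u,v,z,w} \<subseteq> Q\<close> by auto
  have doubleton: "{a,b} = {c,d}" if "c \<in> {a,b}" "d \<in> {a,b}" "c \<noteq> d" for a b c d :: "nat \<times> int"
    using that by auto
  have in_P: "p \<in> ?P" if "p \<in> Q" "fst p = i" for p using that Q assms by auto
  have in_R: "p \<in> ?R" if "p \<in> Q" "fst p \<noteq> i" for p using that Q by auto
  show "fst z = fst w"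
  proof (cases "fst u = i")
    case True
    then have "u \<in> ?P" "v \<in> ?P" using in_P uv uv_ne(2) by simp_all
    then have "?P = {u,v}" using uv_ne(1) by (rule doubleton)
    then have "z \<in> ?R" "w \<in> ?R" using zw not_uv in_P in_R by metis+
    then show ?thesis by auto
  next
    case False
    then have "u \<in> ?R" "v \<in> ?R" using in_R uv uv_ne(2) by simp_all
    then have "?R = {u,v}" using uv_ne(1) by (rule doubleton)
    then have "z \<in> ?P" "w \<in> ?P" using zw not_uv in_P in_R by metis+
    then show ?thesis by auto
  qed
qed

section \<open>Three groups\<close>

text \<open>
  A transversal triple with coordinate sum \<open>6 p + l\<close> is completed by the stem point \<open>l\<close>. The other
  sums form three intervals of length \<open>2 p\<close>, one for each group \<open>i\<close>; the triples whose sums are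
  mirror images of each other in the \<open>i\<close>-th interval are joined at two points of group \<open>i\<close>, whose
  difference is odd and less than \<open>2 p\<close>. All remaining pairs of a group are combined with the equally
  coloured pairs of the next group. Points at cyclic distance \<open>2 p + 1\<close> share a level.
\<close>

locale tripling =
  fixes p s g :: nat
  assumes g: "g = 6 * p + s" and s: "even s" "s \<ge> 2"
begin

lemma g_pos: "g > 0" and g_even: "even g"
  using g s by auto

definition stem_blocks :: "(nat \<times> int) set set" where
  "stem_blocks = {{(0,l),(1,a),(2,b),(3,c)} | l a b c. l \<in> {0..<int s} \<and>
     a \<in> {0..<int g} \<and> b \<in> {0..<int g} \<and> c \<in> {0..<int g} \<and> int g dvd a + b + c - (6 * int p + l)}"

definition interval :: "nat \<Rightarrow> int set" where
  "interval i = {2 * int p * (int i - 1)..<2 * int p * int i}"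

definition mirror :: "nat \<Rightarrow> int \<Rightarrow> int" where
  "mirror i u = 2 * int p * (2 * int i - 1) - 1 - u"

definition mirror_blocks :: "nat \<Rightarrow> nat \<Rightarrow> nat \<Rightarrow> (nat \<times> int) set set" where
  "mirror_blocks i j k = {{(i,x),(i,y),(j,b),(k,c)} | x y b c u. u \<in> interval i \<and>
     x \<in> {0..<int g} \<and> y \<in> {0..<int g} \<and> b \<in> {0..<int g} \<and> c \<in> {0..<int g} \<and>
     int g dvd x + b + c - u \<and> int g dvd y + b + c - mirror i u}"

definition level :: "int \<Rightarrow> int" where
  "level a = (if even a then a else (a - 2 * int p - 1) mod int g)"

lemma mirror_mirror: "mirror i (mirror i u) = u"
  by (simp add: mirror_def)

lemma mirror_blocks_commute: "mirror_blocks i j k = mirror_blocks i k j"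
proof -
  have "mirror_blocks i j k \<subseteq> mirror_blocks i k j" for j k
  proof
    fix Q assume "Q \<in> mirror_blocks i j k"
    then obtain x y b c u where Q: "Q = {(i,x),(i,y),(j,b),(k,c)}" "u \<in> interval i"
      "x \<in> {0..<int g}" "y \<in> {0..<int g}" "b \<in> {0..<int g}" "c \<in> {0..<int g}"
      "int g dvd x + b + c - u" "int g dvd y + b + c - mirror i u"
      unfolding mirror_blocks_def by blast
    then have "Q = {(i,x),(i,y),(k,c),(j,b)}" "int g dvd x + c + b - u" "int g dvd y + c + b - mirror i u"
      by (simp_all add: insert_commute ac_simps)
    then show "Q \<in> mirror_blocks i k j" using Q(2-6) unfolding mirror_blocks_def by blast
  qed
  then show ?thesis by blast
qed

lemma card_stem_blocks: "finite stem_blocks" "card stem_blocks \<le> s * g ^ 2"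
proof -
  let ?block = "\<lambda>(l,a,b). {(0,l),(1,a),(2,b),(3, (- (a + b - (6 * int p + l))) mod int g)} :: (nat \<times> int) set"
  let ?I = "{0..<int s} \<times> {0..<int g} \<times> {0..<int g}"
  have sub: "stem_blocks \<subseteq> ?block ` ?I"
  proof
    fix Q assume "Q \<in> stem_blocks"
    then obtain l a b c where Q: "Q = {(0,l),(1,a),(2,b),(3,c)}" "(l,a,b) \<in> ?I" "c \<in> {0..<int g}"
      "int g dvd (a + b - (6 * int p + l)) + c" unfolding stem_blocks_def by (auto simp: algebra_simps)
    then have "Q = ?block (l,a,b)" using residue_unique[OF Q(3)] by simp
    then show "Q \<in> ?block ` ?I" using Q(2) by blast
  qed
  then show "finite stem_blocks" by (rule finite_subset) simp
  show "card stem_blocks \<le> s * g ^ 2"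
    using surj_card_le[OF _ sub] by (simp add: card_cartesian_product power2_eq_square)
qed

lemma card_mirror_blocks: "finite (mirror_blocks i j k)" "card (mirror_blocks i j k) \<le> p * g ^ 2"
proof -
  let ?block = "\<lambda>(u,b,c). {(i, (- (b + c - u)) mod int g), (i, (- (b + c - mirror i u)) mod int g), (j,b), (k,c)}"
  let ?lower = "{2 * int p * (int i - 1)..<2 * int p * (int i - 1) + int p}"
  let ?I = "?lower \<times> {0..<int g} \<times> {0..<int g}"
  have sub: "mirror_blocks i j k \<subseteq> ?block ` ?I"
  proof
    fix Q assume "Q \<in> mirror_blocks i j k"
    then obtain x y b c u where Q: "Q = {(i,x),(i,y),(j,b),(k,c)}" "u \<in> interval i"
      "x \<in> {0..<int g}" "y \<in> {0..<int g}" "b \<in> {0..<int g}" "c \<in> {0..<int g}"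
      "int g dvd x + b + c - u" "int g dvd y + b + c - mirror i u"
      unfolding mirror_blocks_def by blast
    have xy: "x = (- (b + c - u)) mod int g" "y = (- (b + c - mirror i u)) mod int g"
      using residue_unique[OF Q(3), of "b + c - u"] residue_unique[OF Q(4), of "b + c - mirror i u"] Q(7,8)
      by (simp_all add: algebra_simps)
    show "Q \<in> ?block ` ?I"
    proof (cases "u \<in> ?lower")
      case True
      then show ?thesis using Q(1,5,6) xy by (intro image_eqI[of _ _ "(u,b,c)"]) simp_all
    next
      case False
      then have "mirror i u \<in> ?lower" using Q(2) by (auto simp: interval_def mirror_def algebra_simps)
      then show ?thesis using Q(1,5,6) xy
        by (intro image_eqI[of _ _ "(mirror i u,b,c)"]) (simp_all add: mirror_mirror insert_commute)
    qed
  qed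
  then show "finite (mirror_blocks i j k)" by (rule finite_subset) simp
  show "card (mirror_blocks i j k) \<le> p * g ^ 2"
    using surj_card_le[OF _ sub] by (simp add: card_cartesian_product power2_eq_square)
qed

lemma stem_blocks_cover_transversal:
  assumes "l \<in> {0..<int s}" "a \<in> {0..<int g}" "b \<in> {0..<int g}" "c \<in> {0..<int g}"
    and "int g dvd a + b + c - (6 * int p + l)"
  shows "\<exists>Q\<in>stem_blocks. {(0,l),(1,a),(2,b),(3,c)} \<subseteq> Q"
proof -
  have "{(0,l),(1,a),(2,b),(3,c)} \<in> stem_blocks" using assms unfolding stem_blocks_def by blast
  then show ?thesis by blast
qed

lemma stem_blocks_cover:
  assumes l: "l \<in> {0..<int s}" and ab: "a \<in> {0..<int g}" "b \<in> {0..<int g}"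
    and ij: "i \<in> {1..3}" "j \<in> {1..3}" "i < j"
  shows "\<exists>Q\<in>stem_blocks. {(0,l),(i,a),(j,b)} \<subseteq> Q"
proof -
  obtain c where completion: "c \<in> {0..<int g}" "int g dvd (a + b - (6 * int p + l)) + c"
    using residue_exists[OF g_pos] .
  then have c_sum: "int g dvd a + b + c - (6 * int p + l)" "int g dvd a + c + b - (6 * int p + l)"
    "int g dvd c + a + b - (6 * int p + l)" by (simp_all add: algebra_simps)
  consider (first_second) "i = 1" "j = 2" | (first_third) "i = 1" "j = 3" | (second_third) "i = 2" "j = 3"
    using ij by force
  then show ?thesis
  proof cases
    case first_second
    then show ?thesis using stem_blocks_cover_transversal[OF l ab completion(1) c_sum(1)] by auto
  next
    case first_third
    then show ?thesis using stem_blocks_cover_transversal[OF l ab(1) completion(1) ab(2) c_sum(2)] by auto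
  next
    case second_third
    then show ?thesis using stem_blocks_cover_transversal[OF l completion(1) ab c_sum(3)] by auto
  qed
qed

lemma mirror_blocks_cover_pair:
  assumes xy: "x \<in> {0..<int g}" "y \<in> {0..<int g}" and b: "b \<in> {0..<int g}"
    and d: "odd d" "\<bar>d\<bar> < 2 * int p" "int g dvd y - x - d"
  shows "\<exists>Q\<in>mirror_blocks i j k. {(i,x),(i,y),(j,b)} \<subseteq> Q"
proof -
  obtain n where half: "d = 2 * n + 1" using d(1) by (rule oddE)
  define u where "u = int p * (2 * int i - 1) - 1 - n"
  have u: "u \<in> interval i" "mirror i u - u = d"
    using d(2) half by (auto simp: u_def interval_def mirror_def algebra_simps)
  obtain c where completion: "c \<in> {0..<int g}" "int g dvd (x + b - u) + c" using residue_exists[OF g_pos] .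
  have "int g dvd x + b + c - u" using completion(2) by (simp add: algebra_simps)
  moreover have "int g dvd y + b + c - mirror i u"
    using dvd_add[OF completion(2) d(3)] u(2) by (simp add: algebra_simps)
  ultimately have "{(i,x),(i,y),(j,b),(k,c)} \<in> mirror_blocks i j k"
    using u(1) xy b completion(1) unfolding mirror_blocks_def by blast
  then show ?thesis by (rule rev_bexI) auto
qed

lemma mirror_blocks_cover_transversal:
  assumes xbc: "x \<in> {0..<int g}" "b \<in> {0..<int g}" "c \<in> {0..<int g}"
    and u: "u \<in> interval i" "int g dvd x + b + c - u"
  shows "\<exists>Q\<in>mirror_blocks i j k. {(i,x),(j,b),(k,c)} \<subseteq> Q"
proof -
  obtain y where completion: "y \<in> {0..<int g}" "int g dvd (b + c - mirror i u) + y" using residue_exists[OF g_pos] .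
  have "int g dvd y + b + c - mirror i u" using completion(2) by (simp add: algebra_simps)
  then have "{(i,x),(i,y),(j,b),(k,c)} \<in> mirror_blocks i j k"
    using xbc u completion(1) unfolding mirror_blocks_def by blast
  then show ?thesis by (rule rev_bexI) auto
qed

lemma level_in_range: "a \<in> {0..<int g} \<Longrightarrow> level a \<in> {0..<int g}"
  using g_pos by (simp add: level_def)

lemma even_level: "even (level a)"
  using g_even by (simp add: level_def dvd_mod_iff)

lemma level_eq_iff:
  assumes e: "e \<in> {0..<int g}" "even e" and a: "a \<in> {0..<int g}"
  shows "level a = e \<longleftrightarrow> a = e \<or> a = (e + 2 * int p + 1) mod int g"
proof (cases "even a")
  case True
  then have "a \<noteq> (e + 2 * int p + 1) mod int g" using e(2) g_even by (auto simp: dvd_mod_iff)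
  then show ?thesis using True by (simp add: level_def)
next
  case False
  have "(a - 2 * int p - 1) mod int g = e mod int g \<longleftrightarrow> a mod int g = (e + 2 * int p + 1) mod int g"
    by (simp add: mod_eq_dvd_iff algebra_simps)
  then show ?thesis using False e a by (auto simp: level_def)
qed

lemma paired_level: "paired level {0..<int g}"
  unfolding paired_def
proof
  fix a assume "a \<in> {0..<int g}"
  then have level: "level a \<in> {0..<int g}" "even (level a)" using even_level level_in_range by auto
  have mate: "(level a + 2 * int p + 1) mod int g \<in> {0..<int g}" using g_pos by simp
  have "odd ((level a + 2 * int p + 1) mod int g)" using level(2) g_even by (simp add: dvd_mod_iff)
  then have "level a \<noteq> (level a + 2 * int p + 1) mod int g" using level(2) by auto
  moreover have "{b \<in> {0..<int g}. level b = level a} = {level a, (level a + 2 * int p + 1) mod int g}"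
    using level_eq_iff[OF level] level(1) mate by blast
  ultimately show "card {b \<in> {0..<int g}. level b = level a} = 2" by simp
qed

lemma level_eq_imp_dvd:
  assumes "x \<in> {0..<int g}" "y \<in> {0..<int g}" "x \<noteq> y" "level x = level y"
  shows "int g dvd y - x - (2 * int p + 1) \<or> int g dvd x - y - (2 * int p + 1)"
proof -
  have mate_dvd: "int g dvd (e + 2 * int p + 1) mod int g - e - (2 * int p + 1)" for e
  proof -
    have "int g dvd (e + 2 * int p + 1) mod int g - (e + 2 * int p + 1)" by (simp flip: mod_eq_dvd_iff)
    then show ?thesis by (simp add: algebra_simps)
  qed
  define e where "e = level x"
  have "level a = e \<longleftrightarrow> a = e \<or> a = (e + 2 * int p + 1) mod int g" if "a \<in> {0..<int g}" for a
    unfolding e_def by (rule level_eq_iff[OF level_in_range[OF assms(1)] even_level that])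
  then consider "x = e" "y = (e + 2 * int p + 1) mod int g"
    | "y = e" "x = (e + 2 * int p + 1) mod int g" using assms e_def by metis
  then show ?thesis by cases (use mate_dvd[of e] in simp_all)
qed

lemma aligned_stem_blocks: "aligned l stem_blocks"
  by (rule aligned_if_inj_on_fst) (auto simp: stem_blocks_def)

lemma aligned_mirror_blocks:
  assumes distinct: "i \<noteq> j" "i \<noteq> k" "j \<noteq> k"
  shows "aligned level (mirror_blocks i j k)"
proof (rule alignedI)
  fix Q v w z z'
  assume Q: "Q \<in> mirror_blocks i j k" "{v,w,z,z'} \<subseteq> Q" and vw: "v \<noteq> w" "fst v = fst w" "level (snd v) = level (snd w)"
  obtain x y b c u where block: "Q = {(i,x),(i,y),(j,b),(k,c)}" and u: "u \<in> interval i"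
    and xy: "x \<in> {0..<int g}" "y \<in> {0..<int g}"
    and sums: "int g dvd x + b + c - u" "int g dvd y + b + c - mirror i u"
    using Q(1) unfolding mirror_blocks_def by blast
  define d where "d = mirror i u - u"
  have "\<bar>d\<bar> < 2 * int p" using u by (auto simp: d_def mirror_def interval_def algebra_simps)
  have d_dvd: "int g dvd y - x - d" using dvd_diff[OF sums(2,1)] by (simp add: d_def algebra_simps)
  have "v \<in> Q" "w \<in> Q" using Q(2) by simp_all
  then have "v \<in> {(i,x),(i,y)}" "w \<in> {(i,x),(i,y)}"
    using vw(1,2) distinct unfolding block by (elim insertE emptyE; simp)+
  then have "x \<noteq> y" "level x = level y" using vw(1,3) by auto
  then consider (forward) "int g dvd y - x - (2 * int p + 1)" | (backward) "int g dvd x - y - (2 * int p + 1)"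
    using level_eq_imp_dvd[OF xy] by blast
  then have "int g dvd 2 * int p + 1 - d \<or> int g dvd 2 * int p + 1 + d"
  proof cases
    case forward
    show ?thesis using dvd_diff[OF d_dvd forward] by (simp add: algebra_simps)
  next
    case backward
    have "int g dvd - (2 * int p + 1 + d)" using dvd_add[OF d_dvd backward] by (simp add: algebra_simps)
    then show ?thesis unfolding dvd_minus_iff ..
  qed
  then have False using \<open>\<bar>d\<bar> < 2 * int p\<close> g zdvd_not_zless[of "2 * int p + 1 - d" "int g"]
      zdvd_not_zless[of "2 * int p + 1 + d" "int g"] by auto
  then show "fst z = fst z'" ..
qed

definition blocks :: "(int \<Rightarrow> int) set \<Rightarrow> (nat \<times> int) set set" where
  "blocks F = stem_blocks \<union> (\<Union>(i,j,k)\<in>{(1,2,3),(2,3,1),(3,1,2)}.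
     mirror_blocks i j k \<union> squares {0..<int g} F i j)"

lemma blocks_of_groups:
  assumes "i \<in> {1..3}" "j \<in> {1..3}" "i \<noteq> j"
  obtains k where "mirror_blocks i j k \<subseteq> blocks F" "squares {0..<int g} F i j \<subseteq> blocks F"
proof -
  let ?sq = "squares {0..<int g} F"
  have cyclic: "mirror_blocks 1 2 3 \<subseteq> blocks F" "mirror_blocks 2 3 1 \<subseteq> blocks F" "mirror_blocks 3 1 2 \<subseteq> blocks F"
    "?sq 1 2 \<subseteq> blocks F" "?sq 2 3 \<subseteq> blocks F" "?sq 3 1 \<subseteq> blocks F" by (auto simp: blocks_def)
  have "i = 1 \<or> i = 2 \<or> i = 3" "j = 1 \<or> j = 2 \<or> j = 3" using assms(1,2) by auto
  then have "(i,j) \<in> {(1,2),(2,3),(3,1),(2,1),(3,2),(1,3)}" using assms(3) by blast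
  then show ?thesis
    using that[of 1] that[of 2] that[of 3] cyclic squares_commute[of _ F j i]
      mirror_blocks_commute[of 2 1 3] mirror_blocks_commute[of 3 2 1] mirror_blocks_commute[of 1 3 2]
    by auto
qed

lemma short_difference_exists:
  assumes xy: "x \<in> {0..<int g}" "y \<in> {0..<int g}" "x \<noteq> y" "\<not> even_or_distant p g x y"
  obtains d where "odd d" "\<bar>d\<bar> < 2 * int p" "int g dvd y - x - d"
proof -
  have odd: "odd (y - x)" using xy(3,4) by (simp add: even_or_distant_def)
  then have "\<bar>y - x\<bar> \<noteq> 2 * int p" "\<bar>y - x\<bar> \<noteq> int g - 2 * int p" using g_even by presburger+
  then consider (near) "\<bar>y - x\<bar> < 2 * int p" | (wrap_up) "x \<le> y" "int g - (y - x) < 2 * int p"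
    | (wrap_down) "y \<le> x" "int g - (x - y) < 2 * int p"
    using xy(3,4) unfolding even_or_distant_def by linarith
  then show ?thesis
  proof cases
    case near
    then show ?thesis using that[of "y - x"] odd by simp
  next
    case wrap_up
    then show ?thesis using that[of "y - x - int g"] xy(1,2) odd g_even by auto
  next
    case wrap_down
    then show ?thesis using that[of "y - x + int g"] xy(1,2) odd g_even by auto
  qed
qed

lemma blocks_cover_two:
  assumes F: "matchings_cover {0..<int g} (even_or_distant p g) F"
    and ij: "i \<in> {1..3}" "j \<in> {1..3}" "i \<noteq> j"
    and xyb: "x \<in> {0..<int g}" "y \<in> {0..<int g}" "x \<noteq> y" "b \<in> {0..<int g}"
  shows "\<exists>Q\<in>blocks F. {(i,x),(i,y),(j,b)} \<subseteq> Q"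
proof -
  obtain k where k: "mirror_blocks i j k \<subseteq> blocks F" "squares {0..<int g} F i j \<subseteq> blocks F"
    using blocks_of_groups[OF ij] .
  show ?thesis
  proof (cases "even_or_distant p g x y")
    case True
    then show ?thesis using squares_cover[OF F xyb(1,2,4), of i j] k(2) by blast
  next
    case False
    then obtain d where "odd d" "\<bar>d\<bar> < 2 * int p" "int g dvd y - x - d"
      using short_difference_exists[OF xyb(1-3)] by blast
    then show ?thesis using mirror_blocks_cover_pair[OF xyb(1,2,4), of d i j k] k(1) by blast
  qed
qed

lemma blocks_cover_three:
  assumes abc: "a \<in> {0..<int g}" "b \<in> {0..<int g}" "c \<in> {0..<int g}"
  shows "\<exists>Q\<in>blocks F. {(1,a),(2,b),(3,c)} \<subseteq> Q"
proof -
  define u where "u = (a + b + c) mod int g"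
  have u: "int g dvd a + b + c - u" "0 \<le> u" "u < int g"
    using g_pos by (simp_all add: u_def flip: mod_eq_dvd_iff)
  then have rotated: "int g dvd b + c + a - u" "int g dvd c + a + b - u" by (simp_all add: ac_simps)
  consider (first) "u \<in> interval 1" | (second) "u \<in> interval 2" | (third) "u \<in> interval 3"
    | (stem) "6 * int p \<le> u"
    using u(2) by (force simp: interval_def)
  then show ?thesis
  proof cases
    case first
    then have "\<exists>Q\<in>mirror_blocks 1 2 3. {(1,a),(2,b),(3,c)} \<subseteq> Q"
      using u(1) by (rule mirror_blocks_cover_transversal[OF abc])
    then show ?thesis unfolding blocks_def by blast
  next
    case second
    then have "\<exists>Q\<in>mirror_blocks 2 3 1. {(2,b),(3,c),(1,a)} \<subseteq> Q"
      using rotated(1) by (rule mirror_blocks_cover_transversal[OF abc(2,3,1)])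
    then show ?thesis unfolding blocks_def by blast
  next
    case third
    then have "\<exists>Q\<in>mirror_blocks 3 1 2. {(3,c),(1,a),(2,b)} \<subseteq> Q"
      using rotated(2) by (rule mirror_blocks_cover_transversal[OF abc(3,1,2)])
    then show ?thesis unfolding blocks_def by blast
  next
    case stem
    then have "u - 6 * int p \<in> {0..<int s}" using u(3) g by simp
    moreover have "int g dvd a + b + c - (6 * int p + (u - 6 * int p))" using u(1) by simp
    ultimately have "\<exists>Q\<in>stem_blocks. {(0,u - 6 * int p),(1,a),(2,b),(3,c)} \<subseteq> Q"
      by (rule stem_blocks_cover_transversal[OF _ abc])
    then show ?thesis unfolding blocks_def by blast
  qed
qed

lemma card_blocks:
  assumes F: "matchings_cover {0..<int g} E F" "card F + 2 * p + 1 \<le> g"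
  shows "finite (blocks F)" "4 * card (blocks F) \<le> card (cross_triples {1..3} g s)"
proof -
  let ?sq = "squares {0..<int g} F"
  let ?parts = "\<lambda>i j k. mirror_blocks i j k \<union> ?sq i j"
  have fin: "finite (?parts i j k)" and parts: "4 * card (?parts i j k) \<le> (4 * p + card F) * g ^ 2" for i j k
    using card_mirror_blocks[of i j k] card_squares[OF _ F(1), of i j] card_Un_le[of "mirror_blocks i j k" "?sq i j"]
    by (auto simp: algebra_simps)
  have blocks: "blocks F = stem_blocks \<union> (?parts 1 2 3 \<union> (?parts 2 3 1 \<union> ?parts 3 1 2))"
    by (auto simp: blocks_def)
  then show "finite (blocks F)" using fin card_stem_blocks(1) by simp
  have "card (blocks F) \<le> card stem_blocks + (card (?parts 1 2 3) + (card (?parts 2 3 1) + card (?parts 3 1 2)))"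
    unfolding blocks by (intro order_trans[OF card_Un_le] add_mono order_refl)
  then have "4 * card (blocks F) \<le> 4 * (s * g ^ 2) + 3 * ((4 * p + card F) * g ^ 2)"
    using card_stem_blocks(2) parts[of 1 2 3] parts[of 2 3 1] parts[of 3 1 2] by linarith
  also have "\<dots> = (4 * s + 12 * p + 3 * card F) * g ^ 2" by (simp add: algebra_simps)
  also have "\<dots> \<le> (4 * g + 3 * s - 3) * g ^ 2" using F(2) g by (intro mult_le_mono1) linarith
  also have "\<dots> = card (cross_triples {1..3} g s)"
  proof -
    have "int (4 * g + 3 * s - 3) = 4 * int g + 3 * int s - 3" using g_pos by linarith
    then have "int ((4 * g + 3 * s - 3) * g ^ 2) = int (card (cross_triples {1..3} g s))"
      unfolding card_cross_triples_3 by (simp only: of_nat_mult of_nat_power mult.commute)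
    then show ?thesis by (simp only: of_nat_eq_iff)
  qed
  finally show "4 * card (blocks F) \<le> card (cross_triples {1..3} g s)" .
qed

lemma blocks_four_points:
  assumes "Q \<in> blocks F"
  shows "\<exists>a b c d. Q = {a,b,c,d}"
proof -
  consider (stem) "Q \<in> stem_blocks" | (mirror) i j k where "Q \<in> mirror_blocks i j k"
    | (square) i j where "Q \<in> squares {0..<int g} F i j" using assms by (auto simp: blocks_def)
  then show ?thesis
  proof cases
    case stem then show ?thesis unfolding stem_blocks_def by blast
  next
    case mirror then show ?thesis unfolding mirror_blocks_def by blast
  next
    case square then show ?thesis by (rule squares_block)
  qed
qed

lemma candelabra_system_exists:
  "\<exists>C. candelabra_system {1..3} g s C \<and> aligned level C"
proof -
  have "4 * p + 2 \<le> g" using g s by simp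
  then obtain F where F: "matchings_cover {0..<int g} (even_or_distant p g) F" "card F + 2 * p + 1 \<le> g"
    using partial_one_factorization[OF g_even] by blast
  have "candelabra_system {1..3} g s (blocks F)"
  proof (rule candelabra_system_if_card[OF card_blocks(1)[OF F] blocks_four_points _ card_blocks(2)[OF F]])
    fix T assume "T \<in> cross_triples {1..3} g s"
    moreover have "0 \<notin> {1..3::nat}" by simp
    ultimately show "\<exists>Q\<in>blocks F. T \<subseteq> Q"
    proof (cases rule: cross_triples_cases)
      case (stem l i j a b)
      then show ?thesis using stem_blocks_cover[of l a b i j] unfolding blocks_def by blast
    next
      case (two i j a a' b)
      then show ?thesis using blocks_cover_two[OF F(1), of i j a a' b] by simp
    next
      case (three i j k a b c)
      then have T: "T = {(1,a),(2,b),(3,c)}" by auto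
      show ?thesis unfolding T by (rule blocks_cover_three) fact+
    qed
  qed
  moreover have "aligned level (blocks F)"
    by (simp add: blocks_def aligned_Un aligned_UN aligned_stem_blocks aligned_mirror_blocks aligned_squares)
  ultimately show ?thesis by blast
qed

end

section \<open>Four groups\<close>

text \<open>
  The groups form two sides. A point \<open>a < 2 k\<close> has a residue modulo \<open>k\<close> and a half \<open>a div k\<close>. For points
  \<open>a\<close> and \<open>b\<close> in the two groups of one side, their halves select the group of the other side whose
  pairs of even sum \<open>- 2 (a + b)\<close> complete them; these pairs miss exactly two points, which go to
  the two stem points. In the other group of that side the pairs of odd sum \<open>- 2 (a + b) - 1\<close> miss nothing.
\<close>

locale quadrupling =
  fixes k :: nat
  assumes k_pos: "k > 0"
begin

abbreviation half :: "int \<Rightarrow> int" where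
  "half a \<equiv> a div int k"

definition side :: "nat \<Rightarrow> nat \<Rightarrow> nat" where
  "side \<sigma> e = 1 + 2 * \<sigma> + e"

definition sum_edges :: "int \<Rightarrow> int set set" where
  "sum_edges w = {{r,r'} | r r'. r \<in> {0..<2 * int k} \<and> r' \<in> {0..<2 * int k} \<and> r \<noteq> r' \<and>
     2 * int k dvd r + r' + w}"

definition stem_blocks :: "nat \<Rightarrow> (nat \<times> int) set set" where
  "stem_blocks \<sigma> = {{(0,l),(side \<sigma> 0,a),(side \<sigma> 1,b),(side (1 - \<sigma>) j,r)} | l a b j r.
     l \<in> {0,1} \<and> j \<in> {0,1} \<and> a \<in> {0..<2 * int k} \<and> b \<in> {0..<2 * int k} \<and> r \<in> {0..<2 * int k} \<and>
     int k dvd a + b + r \<and> even (half a + half b + int j) \<and> even (l + half a + half r + int \<sigma>)}"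

definition edge_blocks :: "nat \<Rightarrow> (nat \<times> int) set set" where
  "edge_blocks \<sigma> = {{(side \<sigma> 0,a),(side \<sigma> 1,b)} \<union> {side (1 - \<sigma>) j} \<times> e | a b j e t.
     j \<in> {0,1} \<and> t \<in> {0,1} \<and> a \<in> {0..<2 * int k} \<and> b \<in> {0..<2 * int k} \<and>
     e \<in> sum_edges (2 * (a + b) + t) \<and> even (half a + half b + t + int j)}"

lemma half_cases: "a \<in> {0..<2 * int k} \<Longrightarrow> half a = 0 \<or> half a = 1"
  using k_pos by (cases "a < int k") (auto simp: div_pos_geq)

lemma residue_and_half_exist:
  obtains r where "r \<in> {0..<2 * int k}" "int k dvd z + r" "even (half r + w)"
proof -
  let ?r = "(- z) mod int k + int k * (w mod 2)"
  have k: "int k > 0" using k_pos by simp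
  have "half ?r = w mod 2" using k by simp
  then have "even (half ?r + w)" by (simp add: even_add)
  moreover have "int k dvd z + ?r" by (simp add: mod_0_imp_dvd mod_simps flip: add.assoc)
  moreover have "w mod 2 = 0 \<or> w mod 2 = 1" by presburger
  then have "?r \<in> {0..<2 * int k}" using pos_mod_sign[OF k, of "- z"] pos_mod_bound[OF k, of "- z"] by auto
  ultimately show ?thesis using that by blast
qed

lemma residue_and_half_unique:
  assumes "r \<in> {0..<2 * int k}"
  shows "int k dvd z + r \<and> even (half r + w) \<longleftrightarrow> r = (- z) mod int k + int k * (w mod 2)"
proof -
  have "int k dvd z + r \<longleftrightarrow> r mod int k = (- z) mod int k" by (simp add: mod_eq_dvd_iff add.commute)
  moreover have "even (h + w) \<longleftrightarrow> h = w mod 2" if "h = 0 \<or> h = 1" for h using that by presburger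
  then have "even (half r + w) \<longleftrightarrow> half r = w mod 2" using half_cases[OF assms] .
  moreover have "r = (- z) mod int k + int k * (w mod 2) \<longleftrightarrow> r mod int k = (- z) mod int k \<and> half r = w mod 2"
  proof
    assume "r = (- z) mod int k + int k * (w mod 2)"
    then show "r mod int k = (- z) mod int k \<and> half r = w mod 2" using k_pos by simp
  next
    assume "r mod int k = (- z) mod int k \<and> half r = w mod 2"
    then show "r = (- z) mod int k + int k * (w mod 2)" by (metis mod_mult_div_eq add.commute)
  qed
  ultimately show ?thesis by blast
qed

lemma card_sum_edges:
  shows "2 * card (sum_edges w) \<le> 2 * k" and "even w \<Longrightarrow> 2 * card (sum_edges w) + 2 \<le> 2 * k"
proof -
  define m where "m x = (- w - x) mod (2 * int k)" for x
  define X where "X = {x \<in> {0..<2 * int k}. m x \<noteq> x}"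
  have partner: "2 * int k dvd x + y + w \<longleftrightarrow> y = m x" if "y \<in> {0..<2 * int k}" for x y
    using residue_unique[of y "2 * k" "x + w"] that by (simp add: m_def algebra_simps)
  have m_range: "m x \<in> {0..<2 * int k}" for x using k_pos by (simp add: m_def)
  have "matching X m"
  proof (rule matchingI)
    fix x assume "x \<in> X"
    then have x: "x \<in> {0..<2 * int k}" "m x \<noteq> x" by (auto simp: X_def)
    have "2 * int k dvd m x + x + w" using partner[OF m_range, of x x] by (simp add: add.commute)
    then show "m (m x) = x" using partner[OF x(1)] by simp
    then show "m x \<in> X" "m x \<noteq> x" using x m_range by (auto simp: X_def)
  qed
  moreover have "finite X" by (rule finite_subset[of _ "{0..<2 * int k}"]) (auto simp: X_def)
  ultimately have "2 * card ((\<lambda>x. {x, m x}) ` X) = card X" by (intro card_edges_matching)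
  moreover have "sum_edges w \<subseteq> (\<lambda>x. {x, m x}) ` X"
    using partner by (fastforce simp: sum_edges_def X_def)
  then have "card (sum_edges w) \<le> card ((\<lambda>x. {x, m x}) ` X)" using \<open>finite X\<close> by (intro card_mono) auto
  ultimately have twice_edges_le: "2 * card (sum_edges w) \<le> card X" by simp
  have "card X \<le> card {0..<2 * int k}" by (intro card_mono) (auto simp: X_def)
  then show "2 * card (sum_edges w) \<le> 2 * k" using twice_edges_le by simp
  assume "even w"
  then obtain v where v: "w = 2 * v" by (rule evenE)
  obtain u where u: "u \<in> {0..<int k}" "int k dvd v + u" using residue_exists[OF k_pos] .
  have dvd: "2 * int k dvd 2 * (v + u)" using u(2) by (rule mult_dvd_mono[OF dvd_refl])
  then have "2 * int k dvd 2 * (v + u) + 2 * int k" by (rule dvd_add[OF _ dvd_refl])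
  then have "m u = u" "m (u + int k) = u + int k"
    using partner[of u u] partner[of "u + int k" "u + int k"] u(1) v dvd by (auto simp: algebra_simps)
  then have "X \<subseteq> {0..<2 * int k} - {u, u + int k}" by (auto simp: X_def)
  then have "card X \<le> card ({0..<2 * int k} - {u, u + int k})" by (intro card_mono) auto
  also have "\<dots> = 2 * k - 2" using u(1) k_pos by (subst card_Diff_subset) auto
  finally show "2 * card (sum_edges w) + 2 \<le> 2 * k" using twice_edges_le k_pos by linarith
qed

lemma finite_sum_edges: "finite (sum_edges w)"
  by (rule finite_subset[of _ "Pow {0..<2 * int k}"]) (auto simp: sum_edges_def)

lemma parity_determines: "j \<in> {0,1} \<Longrightarrow> even (z + int j) \<longleftrightarrow> j = nat (z mod 2)"
  by (cases "even z") (auto simp: odd_iff_mod_2_eq_one)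

lemma card_stem_blocks: "finite (stem_blocks \<sigma>)" "card (stem_blocks \<sigma>) \<le> 2 * (2 * k) ^ 2"
proof -
  let ?block = "\<lambda>(l,a,b). {(0,l), (side \<sigma> 0,a), (side \<sigma> 1,b), (side (1 - \<sigma>) (nat ((half a + half b) mod 2)),
     (- (a + b)) mod int k + int k * ((l + half a + int \<sigma>) mod 2))}"
  let ?I = "{0,1} \<times> {0..<2 * int k} \<times> {0..<2 * int k}"
  have sub: "stem_blocks \<sigma> \<subseteq> ?block ` ?I"
  proof
    fix Q assume "Q \<in> stem_blocks \<sigma>"
    then obtain l a b j r where Q: "Q = {(0,l),(side \<sigma> 0,a),(side \<sigma> 1,b),(side (1 - \<sigma>) j,r)}"
      "(l,a,b) \<in> ?I" "j \<in> {0,1}" "r \<in> {0..<2 * int k}" "int k dvd a + b + r"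
      "even (half a + half b + int j)" "even (l + half a + half r + int \<sigma>)"
      unfolding stem_blocks_def by blast
    have "even (half r + (l + half a + int \<sigma>))" using Q(7) by (simp add: ac_simps)
    then have "r = (- (a + b)) mod int k + int k * ((l + half a + int \<sigma>) mod 2)"
      using residue_and_half_unique[OF Q(4)] Q(5) by blast
    moreover have "j = nat ((half a + half b) mod 2)" using parity_determines[OF Q(3)] Q(6) by blast
    ultimately have "Q = ?block (l,a,b)" using Q(1) by simp
    then show "Q \<in> ?block ` ?I" using Q(2) by blast
  qed
  then show "finite (stem_blocks \<sigma>)" by (rule finite_subset) simp
  show "card (stem_blocks \<sigma>) \<le> 2 * (2 * k) ^ 2"
    using surj_card_le[OF _ sub] by (simp add: card_cartesian_product power2_eq_square nat_mult_distrib)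
qed

lemma card_edge_blocks: "finite (edge_blocks \<sigma>)" "card (edge_blocks \<sigma>) \<le> (2 * k - 1) * (2 * k) ^ 2"
proof -
  let ?block = "\<lambda>a b t e. {(side \<sigma> 0,a),(side \<sigma> 1,b)} \<union> {side (1 - \<sigma>) (nat ((half a + half b + t) mod 2))} \<times> e"
  let ?E = "\<lambda>(a,b). \<Union>t\<in>{0,1}. ?block a b t ` sum_edges (2 * (a + b) + t)"
  let ?I = "{0..<2 * int k} \<times> {0..<2 * int k}"
  have sub: "edge_blocks \<sigma> \<subseteq> (\<Union>ab\<in>?I. ?E ab)"
  proof
    fix Q assume "Q \<in> edge_blocks \<sigma>"
    then obtain a b j e t where Q: "Q = {(side \<sigma> 0,a),(side \<sigma> 1,b)} \<union> {side (1 - \<sigma>) j} \<times> e"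
      "(a,b) \<in> ?I" "j \<in> {0,1}" "t \<in> {0,1}" "e \<in> sum_edges (2 * (a + b) + t)" "even (half a + half b + t + int j)"
      unfolding edge_blocks_def by blast
    have "j = nat ((half a + half b + t) mod 2)" using parity_determines[OF Q(3)] Q(6) by blast
    then have "Q = ?block a b t e" using Q(1) by simp
    then have "Q \<in> ?E (a,b)" using Q(4,5) by blast
    then show "Q \<in> (\<Union>ab\<in>?I. ?E ab)" using Q(2) by (rule UN_I[rotated])
  qed
  have fin: "finite (\<Union>ab\<in>?I. ?E ab)" by (auto simp: finite_sum_edges)
  then show "finite (edge_blocks \<sigma>)" by (rule finite_subset[OF sub])
  have "card (?E ab) \<le> 2 * k - 1" if "ab \<in> ?I" for ab
  proof -
    obtain a b where ab: "ab = (a,b)" by (cases ab)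
    let ?w = "2 * (a + b)"
    have "card (?E ab) \<le> card (?block a b 0 ` sum_edges (?w + 0)) + card (?block a b 1 ` sum_edges (?w + 1))"
      unfolding ab by (simp add: card_Un_le)
    also have "\<dots> \<le> card (sum_edges (?w + 0)) + card (sum_edges (?w + 1))"
      by (intro add_mono card_image_le finite_sum_edges)
    finally show ?thesis using card_sum_edges(2)[of "?w + 0"] card_sum_edges(1)[of "?w + 1"] by simp
  qed
  then have "(\<Sum>ab\<in>?I. card (?E ab)) \<le> (\<Sum>ab\<in>?I. 2 * k - 1)" by (rule sum_mono)
  also have "\<dots> = (2 * k - 1) * (2 * k) ^ 2"
    by (simp add: card_cartesian_product power2_eq_square nat_mult_distrib)
  finally have "(\<Sum>ab\<in>?I. card (?E ab)) \<le> (2 * k - 1) * (2 * k) ^ 2" .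
  moreover have "card (edge_blocks \<sigma>) \<le> card (\<Union>ab\<in>?I. ?E ab)" by (rule card_mono[OF fin sub])
  moreover have "card (\<Union>ab\<in>?I. ?E ab) \<le> (\<Sum>ab\<in>?I. card (?E ab))" by (rule card_UN_le) simp
  ultimately show "card (edge_blocks \<sigma>) \<le> (2 * k - 1) * (2 * k) ^ 2" by linarith
qed

lemma parity_exists:
  obtains j :: nat where "j \<in> {0,1}" "even (z + int j)"
  using that[of 0] that[of 1] by (cases "even z") auto

lemma stem_blocks_cover_same_side:
  assumes "l \<in> {0,1}" "a \<in> {0..<2 * int k}" "b \<in> {0..<2 * int k}"
  shows "\<exists>Q\<in>stem_blocks \<sigma>. {(0,l),(side \<sigma> 0,a),(side \<sigma> 1,b)} \<subseteq> Q"
proof -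
  obtain j :: nat where parity: "j \<in> {0,1}" "even (half a + half b + int j)" using parity_exists .
  obtain r where completion: "r \<in> {0..<2 * int k}" "int k dvd a + b + r" "even (half r + (l + half a + int \<sigma>))"
    using residue_and_half_exist .
  have "even (l + half a + half r + int \<sigma>)" using completion(3) by (simp add: ac_simps)
  then have "{(0,l),(side \<sigma> 0,a),(side \<sigma> 1,b),(side (1 - \<sigma>) j,r)} \<in> stem_blocks \<sigma>"
    using assms parity completion unfolding stem_blocks_def by blast
  then show ?thesis by (rule rev_bexI) auto
qed

lemma stem_blocks_cover_across:
  assumes l: "l \<in> {0,1}" and ar: "a \<in> {0..<2 * int k}" "r \<in> {0..<2 * int k}"
    and ej: "e \<in> {0,1}" "j \<in> {0,1}" and parity: "even (l + half a + half r + int (e * j) + int \<sigma>)"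
  shows "\<exists>Q\<in>stem_blocks \<sigma>. {(0,l),(side \<sigma> e,a),(side (1 - \<sigma>) j,r)} \<subseteq> Q"
proof -
  obtain b where completion: "b \<in> {0..<2 * int k}" "int k dvd (a + r) + b" "even (half b + (half a + int j))"
    using residue_and_half_exist .
  from ej(1) consider (zero) "e = 0" | (one) "e = 1" by blast
  then show ?thesis
  proof cases
    case zero
    have "int k dvd a + b + r" "even (half a + half b + int j)" using completion(2,3) by (simp_all add: ac_simps)
    moreover have "even (l + half a + half r + int \<sigma>)" using parity zero by simp
    ultimately have "{(0,l),(side \<sigma> 0,a),(side \<sigma> 1,b),(side (1 - \<sigma>) j,r)} \<in> stem_blocks \<sigma>"
      using l ar completion(1) ej(2) unfolding stem_blocks_def by blast
    then show ?thesis using zero by (intro rev_bexI) auto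
  next
    case one
    have "int k dvd b + a + r" "even (half b + half a + int j)" using completion(2,3) by (simp_all add: ac_simps)
    moreover have "even (l + half b + half r + int \<sigma>)" using parity completion(3) one by auto
    ultimately have "{(0,l),(side \<sigma> 0,b),(side \<sigma> 1,a),(side (1 - \<sigma>) j,r)} \<in> stem_blocks \<sigma>"
      using l ar completion(1) ej(2) unfolding stem_blocks_def by blast
    then show ?thesis using one by (intro rev_bexI) auto
  qed
qed

lemma edge_blocks_cover:
  assumes "a \<in> {0..<2 * int k}" "b \<in> {0..<2 * int k}" "j \<in> {0,1}" "t \<in> {0,1}"
    and "r \<in> {0..<2 * int k}" "r' \<in> {0..<2 * int k}" "r \<noteq> r'"
    and "2 * int k dvd r + r' + (2 * (a + b) + t)" "even (half a + half b + t + int j)"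
  shows "\<exists>Q\<in>edge_blocks \<sigma>. {(side \<sigma> 0,a),(side \<sigma> 1,b),(side (1 - \<sigma>) j,r),(side (1 - \<sigma>) j,r')} \<subseteq> Q"
proof -
  have "{r,r'} \<in> sum_edges (2 * (a + b) + t)" using assms(5-8) unfolding sum_edges_def by blast
  then have "{(side \<sigma> 0,a),(side \<sigma> 1,b)} \<union> {side (1 - \<sigma>) j} \<times> {r,r'} \<in> edge_blocks \<sigma>"
    using assms(1-4,9) unfolding edge_blocks_def by blast
  then show ?thesis by (rule rev_bexI) auto
qed

lemma cover_both_sides:
  assumes ab: "a \<in> {0..<2 * int k}" "b \<in> {0..<2 * int k}" and r: "r \<in> {0..<2 * int k}" and j: "j \<in> {0,1}"
  shows "\<exists>Q\<in>stem_blocks \<sigma> \<union> edge_blocks \<sigma>. {(side \<sigma> 0,a),(side \<sigma> 1,b),(side (1 - \<sigma>) j,r)} \<subseteq> Q"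
proof (cases "even (half a + half b + int j) \<and> int k dvd a + b + r")
  case True
  obtain l :: nat where "l \<in> {0,1}" "even (half a + half r + int \<sigma> + int l)" using parity_exists .
  then have "int l \<in> {0,1}" "even (int l + half a + half r + int \<sigma>)" by (auto simp: ac_simps)
  then have "{(0,int l),(side \<sigma> 0,a),(side \<sigma> 1,b),(side (1 - \<sigma>) j,r)} \<in> stem_blocks \<sigma>"
    using True ab r j unfolding stem_blocks_def by blast
  then show ?thesis by (intro rev_bexI) auto
next
  case False
  obtain t :: nat where t: "t \<in> {0,1}" "even (half a + half b + int j + int t)" using parity_exists .
  obtain r' where completion: "r' \<in> {0..<2 * int k}" "2 * int k dvd (r + (2 * (a + b) + int t)) + r'"
    using residue_exists[of "2 * k"] k_pos by auto
  have "r \<noteq> r'"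
  proof
    assume "r = r'"
    then have dvd: "2 * int k dvd 2 * (a + b + r) + int t" using completion(2) by (simp add: algebra_simps)
    then have "even (2 * (a + b + r) + int t)" by (rule dvd_mult_left)
    then have "t = 0" using t(1) by auto
    then have "int k dvd a + b + r" using dvd by (simp only: of_nat_0 add_0_right dvd_mult_cancel_left) simp
    then show False using False t(2) \<open>t = 0\<close> by simp
  qed
  then have "\<exists>Q\<in>edge_blocks \<sigma>. {(side \<sigma> 0,a),(side \<sigma> 1,b),(side (1 - \<sigma>) j,r),(side (1 - \<sigma>) j,r')} \<subseteq> Q"
    using ab r completion j t by (intro edge_blocks_cover[where t = "int t"]) (auto simp: ac_simps)
  then show ?thesis by blast
qed

lemma edge_blocks_cover_pair:
  assumes r: "r \<in> {0..<2 * int k}" "r' \<in> {0..<2 * int k}" "r \<noteq> r'" and a: "a \<in> {0..<2 * int k}"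
    and ej: "e \<in> {0,1}" "j \<in> {0,1}"
  shows "\<exists>Q\<in>edge_blocks \<sigma>. {(side (1 - \<sigma>) j,r),(side (1 - \<sigma>) j,r'),(side \<sigma> e,a)} \<subseteq> Q"
proof -
  obtain t :: nat where t: "t \<in> {0,1}" "even (r + r' + int t)" using parity_exists .
  obtain n where n: "r + r' + int t = 2 * n" using t(2) by (rule evenE)
  obtain b where completion: "b \<in> {0..<2 * int k}" "int k dvd (n + a) + b" "even (half b + (half a + int t + int j))"
    using residue_and_half_exist .
  have "2 * int k dvd 2 * (n + a + b)" using completion(2) by (rule mult_dvd_mono[OF dvd_refl])
  moreover have "2 * (n + a + b) = r + r' + (2 * (a + b) + int t)" using n by simp
  ultimately have dvd: "2 * int k dvd r + r' + (2 * (a + b) + int t)" by (simp only:)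
  from ej(1) consider (zero) "e = 0" | (one) "e = 1" by blast
  then show ?thesis
  proof cases
    case zero
    have "\<exists>Q\<in>edge_blocks \<sigma>. {(side \<sigma> 0,a),(side \<sigma> 1,b),(side (1 - \<sigma>) j,r),(side (1 - \<sigma>) j,r')} \<subseteq> Q"
      using a completion(1,3) ej(2) t(1) r dvd by (intro edge_blocks_cover[where t = "int t"]) (auto simp: ac_simps)
    then show ?thesis using zero by blast
  next
    case one
    have "\<exists>Q\<in>edge_blocks \<sigma>. {(side \<sigma> 0,b),(side \<sigma> 1,a),(side (1 - \<sigma>) j,r),(side (1 - \<sigma>) j,r')} \<subseteq> Q"
      using a completion(1,3) ej(2) t(1) r dvd by (intro edge_blocks_cover[where t = "int t"]) (auto simp: ac_simps)
    then show ?thesis using one by blast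
  qed
qed

lemma side_distinct:
  "\<sigma> \<in> {0,1} \<Longrightarrow> j \<in> {0,1} \<Longrightarrow>
    side \<sigma> 0 \<noteq> side \<sigma> 1 \<and> side (1 - \<sigma>) j \<noteq> side \<sigma> 0 \<and> side (1 - \<sigma>) j \<noteq> side \<sigma> 1"
  by (auto simp: side_def)

lemma aligned_stem_blocks:
  assumes "\<sigma> \<in> {0,1}"
  shows "aligned l (stem_blocks \<sigma>)"
proof (rule aligned_if_inj_on_fst)
  fix Q assume "Q \<in> stem_blocks \<sigma>"
  then obtain m a b j r where Q: "Q = {(0,m),(side \<sigma> 0,a),(side \<sigma> 1,b),(side (1 - \<sigma>) j,r)}" "j \<in> {0,1}"
    unfolding stem_blocks_def by blast
  have "0 < side \<tau> e" for \<tau> e by (simp add: side_def)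
  then show "inj_on fst Q" unfolding Q(1) using side_distinct[OF assms Q(2)] by simp
qed

lemma stepped_edge_blocks:
  assumes "\<sigma> \<in> {0,1}"
  shows "stepped (group_level l) (edge_blocks \<sigma>)"
proof (rule steppedI)
  fix Q x y assume Q: "Q \<in> edge_blocks \<sigma>" "x \<in> Q" "y \<in> Q" "x \<noteq> y" "group_level l x = group_level l y"
  obtain a b j e w where block: "Q = {(side \<sigma> 0,a),(side \<sigma> 1,b)} \<union> {side (1 - \<sigma>) j} \<times> e"
    and j: "j \<in> {0,1}" and "e \<in> sum_edges w" using Q(1) unfolding edge_blocks_def by blast
  then have "card e = 2" by (auto simp: sum_edges_def)
  have same: "fst x = fst y" using Q(5) by (simp add: group_level_def)
  have in_pair: "z \<in> {side (1 - \<sigma>) j} \<times> e" if "z \<in> Q" "fst z = side (1 - \<sigma>) j" for z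
    using that side_distinct[OF assms j] unfolding block by auto
  have "fst x = side (1 - \<sigma>) j"
  proof (rule ccontr)
    assume "fst x \<noteq> side (1 - \<sigma>) j"
    then have "x \<in> {(side \<sigma> 0,a),(side \<sigma> 1,b)}" "y \<in> {(side \<sigma> 0,a),(side \<sigma> 1,b)}"
      using Q(2,3) same unfolding block by auto
    then show False using same Q(4) side_distinct[OF assms j] by auto
  qed
  then have "x \<in> {side (1 - \<sigma>) j} \<times> e" "y \<in> {side (1 - \<sigma>) j} \<times> e"
    using in_pair Q(2,3) same by auto
  moreover have "card ({side (1 - \<sigma>) j} \<times> e) = card {x,y}"
    using \<open>card e = 2\<close> Q(4) by (simp add: card_cartesian_product)
  ultimately have pair: "{side (1 - \<sigma>) j} \<times> e = {x,y}"
    using \<open>card e = 2\<close> by (intro card_subset_eq[symmetric]) (simp_all add: card_ge_0_finite)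
  have "Q - {x,y} \<subseteq> {(side \<sigma> 0,a),(side \<sigma> 1,b)}" unfolding block pair by blast
  then have others: "fst z \<in> {side \<sigma> 0, side \<sigma> 1}" if "z \<in> Q - {x,y}" for z using that by auto
  have "(\<forall>i\<in>{side \<sigma> 0, side \<sigma> 1}. i < fst x) \<or> (\<forall>i\<in>{side \<sigma> 0, side \<sigma> 1}. fst x < i)"
    unfolding \<open>fst x = side (1 - \<sigma>) j\<close> using assms j by (auto simp: side_def)
  then have "one_sided fst (fst x) (Q - {x,y})" using others unfolding one_sided_def by metis
  then show "one_sided (group_level l) (group_level l x) (Q - {x,y})"
    using group_level_less by (rule one_sided_refine)
qed

definition blocks :: "(int \<Rightarrow> int) set \<Rightarrow> (nat \<times> int) set set" where
  "blocks F = (\<Union>\<sigma>\<in>{0,1}. stem_blocks \<sigma> \<union> edge_blocks \<sigma> \<union> squares {0..<2 * int k} F (side \<sigma> 0) (side \<sigma> 1))"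

lemma side_exists:
  assumes "i \<in> {1..4}"
  obtains \<sigma> e where "\<sigma> \<in> {0,1}" "e \<in> {0,1}" "i = side \<sigma> e"
proof (rule that[of "(i - 1) div 2" "(i - 1) mod 2"])
  show "i = side ((i - 1) div 2) ((i - 1) mod 2)" using assms by (simp add: side_def)
qed (use assms in auto)

lemma blocks_cover_two:
  assumes F: "matchings_cover {0..<2 * int k} (\<noteq>) F"
    and ij: "i \<in> {1..4}" "j \<in> {1..4}" "i \<noteq> j"
    and xyb: "x \<in> {0..<2 * int k}" "y \<in> {0..<2 * int k}" "x \<noteq> y" "b \<in> {0..<2 * int k}"
  shows "\<exists>Q\<in>blocks F. {(i,x),(i,y),(j,b)} \<subseteq> Q"
proof -
  obtain \<sigma> e where i: "\<sigma> \<in> {0,1}" "e \<in> {0,1}" "i = side \<sigma> e" using side_exists[OF ij(1)] .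
  obtain \<tau> f where j: "\<tau> \<in> {0,1}" "f \<in> {0,1}" "j = side \<tau> f" using side_exists[OF ij(2)] .
  show ?thesis
  proof (cases "\<sigma> = \<tau>")
    case True
    then have "{i,j} = {side \<sigma> 0, side \<sigma> 1}" using i j ij(3) by auto
    then have "squares {0..<2 * int k} F i j \<subseteq> blocks F"
      using i(1) squares_commute[of _ F i j] unfolding blocks_def doubleton_eq_iff by blast
    then show ?thesis using squares_cover[OF F xyb(1,2,4,3), of i j] by blast
  next
    case False
    then have "\<sigma> = 1 - \<tau>" using i(1) j(1) by auto
    then have "\<exists>Q\<in>edge_blocks \<tau>. {(i,x),(i,y),(j,b)} \<subseteq> Q"
      unfolding i(3) j(3) using edge_blocks_cover_pair[OF xyb j(2) i(2)] by simp
    then show ?thesis using j(1) unfolding blocks_def by blast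
  qed
qed

lemma blocks_cover_stem:
  assumes l: "l \<in> {0,1}" and ab: "a \<in> {0..<2 * int k}" "b \<in> {0..<2 * int k}"
    and ij: "i \<in> {1..4}" "j \<in> {1..4}" "i < j"
  shows "\<exists>Q\<in>blocks F. {(0,l),(i,a),(j,b)} \<subseteq> Q"
proof -
  obtain \<sigma> e where i: "\<sigma> \<in> {0,1}" "e \<in> {0,1}" "i = side \<sigma> e" using side_exists[OF ij(1)] .
  obtain \<tau> f where j: "\<tau> \<in> {0,1}" "f \<in> {0,1}" "j = side \<tau> f" using side_exists[OF ij(2)] .
  have "\<exists>\<rho>\<in>{0,1}. \<exists>Q\<in>stem_blocks \<rho>. {(0,l),(i,a),(j,b)} \<subseteq> Q"
  proof (cases "\<sigma> = \<tau>")
    case True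
    then have "e = 0" "f = 1" using i j ij(3) by (auto simp: side_def)
    then show ?thesis using stem_blocks_cover_same_side[OF l ab, of \<sigma>] i j True by simp blast
  next
    case False
    then have sides: "\<sigma> = 0" "\<tau> = 1" using i j ij(3) by (auto simp: side_def)
    show ?thesis
    proof (cases "even (l + half a + half b + int (e * f))")
      case True
      then show ?thesis using stem_blocks_cover_across[OF l ab i(2) j(2), of 0] i j sides by simp
    next
      case False
      then have "even (l + half b + half a + int (f * e) + int 1)" by (simp add: ac_simps)
      then show ?thesis
        using stem_blocks_cover_across[OF l ab(2,1) j(2) i(2), of 1] i j sides by (simp add: insert_commute)
    qed
  qed
  then show ?thesis unfolding blocks_def by blast
qed

lemma blocks_cover_three:
  assumes abc: "a \<in> {0..<2 * int k}" "b \<in> {0..<2 * int k}" "c \<in> {0..<2 * int k}"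
    and ijm: "i \<in> {1..4}" "j \<in> {1..4}" "m \<in> {1..4}" "i < j" "j < m"
  shows "\<exists>Q\<in>blocks F. {(i,a),(j,b),(m,c)} \<subseteq> Q"
proof -
  have "\<exists>\<sigma>\<in>{0,1}. \<exists>Q\<in>stem_blocks \<sigma> \<union> edge_blocks \<sigma>. {(i,a),(j,b),(m,c)} \<subseteq> Q"
  proof (cases "j = 2")
    case True
    then have i: "i = side 0 0" "j = side 0 1" "m = side 1 (m - 3)" "m - 3 \<in> {0,1}"
      using ijm by (auto simp: side_def)
    have "\<exists>Q\<in>stem_blocks 0 \<union> edge_blocks 0. {(i,a),(j,b),(m,c)} \<subseteq> Q"
      using cover_both_sides[OF abc i(4), of 0] unfolding i(1,2) by (subst i(3)) simp
    then show ?thesis by blast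
  next
    case False
    then have i: "j = side 1 0" "m = side 1 1" "i = side 0 (i - 1)" "i - 1 \<in> {0,1}"
      using ijm by (auto simp: side_def)
    have "\<exists>Q\<in>stem_blocks 1 \<union> edge_blocks 1. {(j,b),(m,c),(i,a)} \<subseteq> Q"
      using cover_both_sides[OF abc(2,3,1) i(4), of 1] unfolding i(1,2) by (subst i(3)) simp
    then show ?thesis by blast
  qed
  then show ?thesis unfolding blocks_def by blast
qed

lemma card_blocks:
  assumes F: "matchings_cover {0..<2 * int k} E F" "card F \<le> 2 * k - 1"
  shows "finite (blocks F)" "4 * card (blocks F) \<le> card (cross_triples {1..4} (2 * k) 2)"
proof -
  let ?sq = "\<lambda>\<sigma>. squares {0..<2 * int k} F (side \<sigma> 0) (side \<sigma> 1)"
  define g where "g = 2 * k"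
  have card_sq: "4 * card (?sq \<sigma>) \<le> (g - 1) * g ^ 2" for \<sigma>
  proof -
    have "4 * card (?sq \<sigma>) \<le> card F * g ^ 2"
      using card_squares(2)[OF _ F(1), of "side \<sigma> 0" "side \<sigma> 1"] by (simp add: g_def nat_mult_distrib)
    also have "\<dots> \<le> (g - 1) * g ^ 2" using F(2) by (simp add: g_def)
    finally show ?thesis .
  qed
  define half_bound where "half_bound = 8 * g ^ 2 + 5 * ((g - 1) * g ^ 2)"
  have side: "4 * card (stem_blocks \<sigma> \<union> edge_blocks \<sigma> \<union> ?sq \<sigma>) \<le> half_bound" for \<sigma>
    using card_Un_le[of "stem_blocks \<sigma> \<union> edge_blocks \<sigma>" "?sq \<sigma>"] card_Un_le[of "stem_blocks \<sigma>" "edge_blocks \<sigma>"]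
      card_stem_blocks(2)[of \<sigma>] card_edge_blocks(2)[of \<sigma>] card_sq[of \<sigma>]
    unfolding g_def half_bound_def by linarith
  have two_sides: "blocks F = (stem_blocks 0 \<union> edge_blocks 0 \<union> ?sq 0) \<union> (stem_blocks 1 \<union> edge_blocks 1 \<union> ?sq 1)"
    by (simp add: blocks_def)
  have "4 * card (blocks F) \<le> 2 * half_bound"
    unfolding two_sides using side[of 0] side[of 1]
      card_Un_le[of "stem_blocks 0 \<union> edge_blocks 0 \<union> ?sq 0" "stem_blocks 1 \<union> edge_blocks 1 \<union> ?sq 1"]
    by linarith
  also have "\<dots> = card (cross_triples {1..4} g 2)"
  proof -
    have "int (g - 1) = int g - 1" using k_pos by (simp add: g_def)
    then have "int (2 * half_bound) = int (card (cross_triples {1..4} g 2))"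
      unfolding half_bound_def card_cross_triples_4 by (simp add: algebra_simps)
    then show ?thesis by (simp only: of_nat_eq_iff)
  qed
  finally show "4 * card (blocks F) \<le> card (cross_triples {1..4} (2 * k) 2)" by (simp only: g_def)
  show "finite (blocks F)"
    using card_stem_blocks(1) card_edge_blocks(1) card_squares(1)[OF _ F(1)] by (simp add: blocks_def)
qed

lemma blocks_four_points:
  assumes "Q \<in> blocks F"
  shows "\<exists>a b c d. Q = {a,b,c,d}"
proof -
  consider (stem) \<sigma> where "Q \<in> stem_blocks \<sigma>" | (edge) \<sigma> where "Q \<in> edge_blocks \<sigma>"
    | (square) \<sigma> where "Q \<in> squares {0..<2 * int k} F (side \<sigma> 0) (side \<sigma> 1)"
    using assms unfolding blocks_def by blast
  then show ?thesis
  proof cases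
    case stem then show ?thesis unfolding stem_blocks_def by blast
  next
    case edge
    then obtain a b j e t where "Q = {(side \<sigma> 0,a),(side \<sigma> 1,b)} \<union> {side (1 - \<sigma>) j} \<times> e" "e \<in> sum_edges t"
      unfolding edge_blocks_def by blast
    moreover from this obtain r r' where "e = {r,r'}" unfolding sum_edges_def by blast
    ultimately have "Q = {(side \<sigma> 0,a),(side \<sigma> 1,b),(side (1 - \<sigma>) j,r),(side (1 - \<sigma>) j,r')}" by auto
    then show ?thesis by blast
  next
    case square then show ?thesis by (rule squares_block)
  qed
qed

lemma candelabra_system_exists:
  "\<exists>C. candelabra_system {1..4} (2 * k) 2 C \<and> stepped (group_level l) C"
proof -
  obtain F where F: "matchings_cover {0..<2 * int k} (\<noteq>) F" "card F \<le> 2 * k - 1"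
    using one_factorization[of "2 * k"] k_pos by auto
  have system: "candelabra_system {1..4} (2 * k) 2 (blocks F)"
  proof (rule candelabra_system_if_card[OF card_blocks(1)[OF F] blocks_four_points _ card_blocks(2)[OF F]])
    fix T assume "T \<in> cross_triples {1..4} (2 * k) 2"
    moreover have "0 \<notin> {1..4::nat}" by simp
    ultimately show "\<exists>Q\<in>blocks F. T \<subseteq> Q"
    proof (cases rule: cross_triples_cases)
      case (stem m i j a b)
      then have "m \<in> {0,1}" by auto
      then show ?thesis using stem blocks_cover_stem[of m a b i j F] by simp
    next
      case (two i j a a' b)
      then show ?thesis using blocks_cover_two[OF F(1), of i j a a' b] by simp
    next
      case (three i j m a b c)
      then show ?thesis using blocks_cover_three[of a b c i j m F] by simp
    qed
  qed
  let ?D = "\<Union>\<sigma>\<in>{0,1}. stem_blocks \<sigma> \<union> squares {0..<2 * int k} F (side \<sigma> 0) (side \<sigma> 1)"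
  have "aligned l ?D"
    by (simp only: aligned_UN aligned_Un) (simp add: aligned_stem_blocks aligned_squares side_def)
  then have "stepped (group_level l) ?D"
    by (intro stepped_if_aligned[OF system]) (auto simp: blocks_def)
  moreover have "stepped (group_level l) (edge_blocks \<sigma>)" if "\<sigma> \<in> {0,1}" for \<sigma>
    by (rule stepped_edge_blocks[OF that])
  ultimately have "stepped (group_level l) (blocks F)" by (simp add: blocks_def stepped_UN stepped_Un)
  then show ?thesis using system by blast
qed

end

section \<open>Three systems verified by computation\<close>

definition third_covered :: "'a list list \<Rightarrow> 'a \<Rightarrow> 'a \<Rightarrow> 'a \<Rightarrow> bool" where
  "third_covered Qs x y z \<longleftrightarrow> z = x \<or> z = y \<or> list_ex (\<lambda>Q. z \<in> set Q) Qs"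

definition pair_covered :: "'a list list \<Rightarrow> 'a list \<Rightarrow> 'a \<Rightarrow> 'a \<Rightarrow> bool" where
  "pair_covered Qs zs x y \<longleftrightarrow> list_all (third_covered (filter (\<lambda>Q. y \<in> set Q) Qs) x y) zs"

definition point_covered :: "'a list list \<Rightarrow> 'a list \<Rightarrow> 'a list \<Rightarrow> 'a \<Rightarrow> bool" where
  "point_covered Qs ys zs x \<longleftrightarrow> list_all (pair_covered (filter (\<lambda>Q. x \<in> set Q) Qs) zs x) ys"

lemma point_coveredD:
  assumes "point_covered Qs ys zs x" "y \<in> set ys" "z \<in> set zs" "z \<noteq> x" "z \<noteq> y"
  shows "\<exists>Q\<in>set Qs. {x,y,z} \<subseteq> set Q"
proof -
  have "pair_covered (filter (\<lambda>Q. x \<in> set Q) Qs) zs x y"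
    using assms(1,2) by (simp add: point_covered_def list_all_iff)
  then have "third_covered (filter (\<lambda>Q. y \<in> set Q) (filter (\<lambda>Q. x \<in> set Q) Qs)) x y z"
    using assms(3) by (simp add: pair_covered_def list_all_iff)
  then show ?thesis using assms(4,5) by (auto simp: third_covered_def list_ex_iff)
qed

lemma set_of_length_4: "length Q = 4 \<Longrightarrow> \<exists>a b c d. set Q = {a,b,c,d}"
  by (auto simp: numeral_eq_Suc length_Suc_conv) blast

lemma cross_triple_two_groups:
  assumes "T \<in> cross_triples I g s" "0 \<notin> I"
  obtains i a j b z where "T = {(i,a),(j,b),z}" "i \<in> I" "j \<in> I" "i < j" "a \<in> {0..<int g}" "b \<in> {0..<int g}"
    "z \<in> points I g s" "z \<noteq> (i,a)" "z \<noteq> (j,b)"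
  using assms
proof (cases rule: cross_triples_cases)
  case (stem l i j a b)
  then show ?thesis using assms(2) by (intro that[of i a j b "(0,l)"]) (auto simp: points_def)
next
  case (two i j a a' b)
  show ?thesis
  proof (cases "i < j")
    case True
    then show ?thesis using two by (intro that[of i a j b "(i,a')"]) (auto simp: points_def)
  next
    case False
    then show ?thesis using two by (intro that[of j b i a "(i,a')"]) (auto simp: points_def)
  qed
next
  case (three i j k a b c)
  then show ?thesis by (intro that[of i a j b "(k,c)"]) (auto simp: points_def)
qed

text \<open>
  A quadruple system of order 14 with the levels \<open>i\<close>: ten base blocks developed modulo 7, and the
  unions of two levels.
\<close>

definition blocks_14 :: "(int \<times> int) list list" where
  "blocks_14 = [map (\<lambda>(i,a). ((i + t) mod 7, a)) Q. t \<leftarrow> [0..6], Q \<leftarrow>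
     [[(0,0),(1,0),(2,0),(5,0)], [(0,0),(1,0),(2,1),(3,1)], [(0,0),(1,0),(3,0),(4,1)],
      [(0,0),(1,0),(5,1),(6,1)], [(0,0),(1,1),(2,0),(5,1)], [(0,0),(1,1),(3,0),(6,1)],
      [(0,0),(1,1),(3,1),(4,1)], [(0,0),(2,0),(4,1),(6,1)], [(0,0),(2,1),(3,0),(5,1)],
      [(0,1),(1,1),(2,1),(4,1)]]] @
     [[(i,0),(i,1),(j,0),(j,1)]. j \<leftarrow> [0..6], i \<leftarrow> [0..j - 1]]"

definition points_14 :: "(int \<times> int) list" where
  "points_14 = List.product [0..6] [0,1]"

lemma blocks_14_cover: "list_all (point_covered blocks_14 points_14 points_14) points_14"
  by code_simp

lemma blocks_14_length: "length blocks_14 = 91" "list_all (\<lambda>Q. length Q = 4) blocks_14"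
  by code_simp+

lemma stepped_blocks_14: "stepped fst (set ` set blocks_14)"
  by code_simp

text \<open>
  Orbit representatives, found by a SAT solver, of a candelabra system with three groups of 12 points
  and stem 2 that is invariant under the shift; the short orbits are fixed by its sixth power.
\<close>

definition shift :: "int \<Rightarrow> nat \<times> int \<Rightarrow> nat \<times> int" where
  "shift t x = (fst x, (snd x + t * (if fst x = 0 then 0 else if fst x = 3 then - 2 else 1)) mod 12)"

definition long_orbits :: "(nat \<times> int) list list" where
  "long_orbits =
   [[(0,l),(1,0),(2,b),(3,(3 * l - b) mod 12)]. l \<leftarrow> [0,1], b \<leftarrow> [0..11]] @
   [[(1,0),(1,3),(2,b),(3,(4 - b) mod 12)]. b \<leftarrow> [0..11]] @ [
   [(1,0),(1,1),(2,0),(3,10)], [(1,0),(1,1),(2,1),(2,6)], [(1,0),(1,1),(2,2),(2,3)],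
   [(1,0),(1,1),(2,4),(2,5)], [(1,0),(1,1),(2,7),(3,6)], [(1,0),(1,1),(2,8),(3,5)],
   [(1,0),(1,1),(2,9),(2,10)], [(1,0),(1,1),(2,11),(3,11)], [(1,0),(1,1),(3,0),(3,2)],
   [(1,0),(1,1),(3,1),(3,8)], [(1,0),(1,1),(3,3),(3,4)], [(1,0),(1,1),(3,7),(3,9)],
   [(1,0),(1,2),(2,0),(2,7)], [(1,0),(1,2),(2,1),(2,8)], [(1,0),(1,2),(2,2),(3,9)],
   [(1,0),(1,2),(2,3),(2,5)], [(1,0),(1,2),(2,4),(2,10)], [(1,0),(1,2),(2,6),(3,5)],
   [(1,0),(1,2),(2,9),(2,11)], [(1,0),(1,2),(3,0),(3,4)], [(1,0),(1,2),(3,1),(3,6)],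
   [(1,0),(1,2),(3,2),(3,7)], [(1,0),(1,2),(3,3),(3,8)], [(1,0),(1,2),(3,10),(3,11)],
   [(1,0),(1,4),(2,0),(2,4)], [(1,0),(1,4),(2,1),(2,5)], [(1,0),(1,4),(2,2),(3,8)],
   [(1,0),(1,4),(2,3),(2,9)], [(1,0),(1,4),(2,6),(2,10)], [(1,0),(1,4),(2,7),(2,11)],
   [(1,0),(1,4),(2,8),(3,2)], [(1,0),(1,4),(3,0),(3,11)], [(1,0),(1,4),(3,1),(3,5)],
   [(1,0),(1,4),(3,3),(3,7)], [(1,0),(1,4),(3,4),(3,9)], [(1,0),(1,4),(3,6),(3,10)],
   [(1,0),(1,5),(2,0),(2,10)], [(1,0),(1,5),(2,1),(2,11)], [(1,0),(1,5),(2,2),(2,7)],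
   [(1,0),(1,5),(2,3),(2,8)], [(1,0),(1,5),(2,4),(2,9)], [(1,0),(1,5),(2,5),(2,6)],
   [(1,0),(1,5),(3,0),(3,6)], [(1,0),(1,5),(3,1),(3,7)], [(1,0),(1,5),(3,2),(3,10)],
   [(1,0),(1,5),(3,3),(3,5)], [(1,0),(1,5),(3,4),(3,11)], [(1,0),(1,5),(3,8),(3,9)],
   [(1,0),(1,6),(2,2),(2,4)], [(1,0),(1,6),(2,3),(2,11)], [(1,0),(2,0),(2,2),(3,11)],
   [(1,0),(2,0),(2,3),(3,5)], [(1,0),(2,0),(2,9),(3,8)], [(1,0),(2,0),(2,11),(3,2)],
   [(1,0),(2,0),(3,6),(3,9)], [(1,0),(2,1),(2,4),(3,4)], [(1,0),(2,1),(2,10),(3,7)],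
   [(1,0),(2,1),(3,0),(3,1)], [(1,0),(2,1),(3,5),(3,8)], [(1,0),(2,1),(3,9),(3,10)],
   [(1,0),(2,2),(2,5),(3,3)], [(1,0),(2,2),(2,10),(3,0)], [(1,0),(2,2),(2,11),(3,6)],
   [(1,0),(2,2),(3,4),(3,7)], [(1,0),(2,3),(2,6),(3,2)], [(1,0),(2,3),(3,3),(3,6)],
   [(1,0),(2,3),(3,7),(3,11)], [(1,0),(2,3),(3,8),(3,10)], [(1,0),(2,4),(2,6),(3,7)],
   [(1,0),(2,4),(2,7),(3,1)], [(1,0),(2,4),(2,8),(3,6)], [(1,0),(2,4),(3,2),(3,5)],
   [(1,0),(2,5),(2,8),(3,0)], [(1,0),(2,5),(3,1),(3,4)], [(1,0),(2,5),(3,5),(3,9)],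
   [(1,0),(2,5),(3,6),(3,8)], [(1,0),(2,6),(2,7),(3,4)], [(1,0),(2,6),(2,9),(3,11)],
   [(1,0),(2,6),(3,0),(3,3)], [(1,0),(2,7),(2,8),(3,3)], [(1,0),(2,7),(2,10),(3,10)],
   [(1,0),(2,7),(3,2),(3,11)], [(1,0),(2,8),(2,11),(3,9)], [(1,0),(2,8),(3,1),(3,10)],
   [(1,0),(2,9),(3,0),(3,9)], [(1,0),(2,9),(3,1),(3,2)], [(1,0),(2,9),(3,4),(3,5)],
   [(1,0),(2,10),(2,11),(3,3)], [(1,0),(2,10),(3,8),(3,11)], [(1,0),(2,11),(3,7),(3,10)],
   [(2,0),(2,1),(3,1),(3,8)], [(2,0),(2,1),(3,2),(3,10)], [(2,0),(2,1),(3,3),(3,9)],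
   [(2,0),(2,1),(3,6),(3,7)], [(2,0),(2,2),(3,0),(3,5)], [(2,0),(2,2),(3,1),(3,6)],
   [(2,0),(2,2),(3,2),(3,7)], [(2,0),(2,2),(3,4),(3,8)], [(2,0),(2,2),(3,9),(3,10)],
   [(2,0),(2,4),(3,0),(3,7)], [(2,0),(2,4),(3,1),(3,9)], [(2,0),(2,4),(3,3),(3,11)],
   [(2,0),(2,4),(3,4),(3,5)], [(2,0),(2,4),(3,6),(3,10)], [(2,0),(2,5),(3,0),(3,2)],
   [(2,0),(2,5),(3,1),(3,3)], [(2,0),(2,5),(3,4),(3,11)], [(2,0),(2,5),(3,5),(3,6)],
   [(2,0),(2,5),(3,7),(3,9)], [(2,0),(2,5),(3,8),(3,10)]]"

definition short_orbits :: "(nat \<times> int) list list" where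
  "short_orbits = [
   [(1,0),(1,6),(2,0),(2,6)], [(1,0),(1,6),(2,1),(2,7)], [(1,0),(1,6),(3,0),(3,10)],
   [(1,0),(1,6),(3,1),(3,11)], [(1,0),(1,6),(3,2),(3,8)], [(1,0),(1,6),(3,3),(3,9)],
   [(1,0),(1,6),(3,4),(3,6)], [(1,0),(1,6),(3,5),(3,7)], [(2,0),(2,6),(3,0),(3,6)],
   [(2,0),(2,6),(3,1),(3,7)], [(2,0),(2,6),(3,2),(3,8)], [(2,0),(2,6),(3,3),(3,5)],
   [(2,0),(2,6),(3,4),(3,10)], [(2,0),(2,6),(3,9),(3,11)]]"

definition orbits :: "(nat \<times> int) list list" where
  "orbits = long_orbits @ short_orbits"

definition blocks_38 :: "(nat \<times> int) set set" where
  "blocks_38 = (\<Union>t. (`) (shift t) ` set ` set orbits)"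

definition blocks_through :: "nat \<Rightarrow> (nat \<times> int) list list" where
  "blocks_through i = [map (shift (- snd x)) Q. Q \<leftarrow> orbits, x \<leftarrow> Q, fst x = i]"

definition points_38 :: "nat list \<Rightarrow> (nat \<times> int) list" where
  "points_38 I = [(0,0),(0,1)] @ List.product I [0..11]"

lemma blocks_through_cover:
  "point_covered (blocks_through 1) (List.product [2,3] [0..11]) (points_38 [1,2,3]) (1,0)"
  "point_covered (blocks_through 2) (List.product [3] [0..11]) (points_38 [1,2,3]) (2,0)"
  by code_simp+

lemma orbits_length: "length long_orbits = 146" "length short_orbits = 14" "list_all (\<lambda>Q. length Q = 4) orbits"
  by code_simp+

lemma short_orbits_shift: "list_all (\<lambda>Q. shift 6 ` set Q = set Q) short_orbits"
  by code_simp

lemma aligned_orbits: "aligned (\<lambda>a. a mod 6) (set ` set orbits)"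
  by code_simp

definition blocks_10 :: "(nat \<times> int) list list" where
  "blocks_10 =
     [[(0,0),(1,a),(2,b),(3,(- a - b) mod 3)]. a \<leftarrow> [0..2], b \<leftarrow> [0..2]] @
     [[(i,a),(j,a),(k,(a + 1) mod 3),(k,(a + 2) mod 3)]. a \<leftarrow> [0..2], (i,j,k) \<leftarrow> [(1,2,3),(2,3,1),(3,1,2)]] @
     [[(i,a),(j,a),(i,(a + 1) mod 3),(j,(a + 1) mod 3)]. a \<leftarrow> [0..2], (i,j) \<leftarrow> [(1,2),(2,3),(3,1)]]"

lemma blocks_10_cover:
  "\<forall>i\<in>{1,2}. \<forall>a\<in>{0,1,2}.
     point_covered blocks_10 (List.product [i + 1..<4] [0..2]) ((0,0) # List.product [1,2,3] [0..2]) (i,a)"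
  by code_simp

lemma blocks_10_length: "length blocks_10 = 27" "list_all (\<lambda>Q. length Q = 4) blocks_10"
  by code_simp+

lemma exact_cover_of_lists:
  assumes Qs: "list_all (\<lambda>Q. length Q = 4) Qs"
    and TT: "\<And>T. T \<in> TT \<Longrightarrow> card T = 3" "\<And>T. T \<in> TT \<Longrightarrow> \<exists>Q\<in>set Qs. T \<subseteq> set Q"
    and few: "4 * length Qs \<le> card TT"
  shows "exact_cover (set ` set Qs) TT"
proof (rule exact_cover_if_card)
  fix Q assume "Q \<in> set ` set Qs"
  then obtain xs where "Q = set xs" "length xs = 4" using Qs by (auto simp: list_all_iff)
  then show "finite Q \<and> card Q \<le> 4" using card_length[of xs] by simp
next
  have "card (set ` set Qs) \<le> length Qs" using card_image_le[of "set Qs" set] card_length[of Qs] by simp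
  then show "4 * card (set ` set Qs) \<le> card TT" using few by simp
qed (use TT in auto)

lemma steppable_14: "steppable 14"
proof -
  let ?X = "set points_14"
  have X: "?X = {0..6} \<times> {0,1}" by (auto simp: points_14_def)
  then have card_X: "card ?X = 14" by (simp add: card_cartesian_product)
  have "exact_cover (set ` set blocks_14) (triples ?X)"
  proof (rule exact_cover_of_lists[OF blocks_14_length(2)])
    fix T assume "T \<in> triples ?X"
    then have T: "T \<subseteq> ?X" "card T = 3" by (auto simp: triples_def)
    then show "card T = 3" by simp
    obtain x y z where xyz: "T = {x,y,z}" "z \<noteq> x" "z \<noteq> y" using T(2) by (metis card_3_iff)
    have "point_covered blocks_14 points_14 points_14 x"
      using blocks_14_cover T(1) xyz(1) by (simp add: list_all_iff)
    then show "\<exists>Q\<in>set blocks_14. T \<subseteq> set Q" using point_coveredD[of _ _ _ x y z] T(1) xyz by simp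
  next
    show "4 * length blocks_14 \<le> card (triples ?X)"
      using int_choose_3[of 14] by (simp add: card_triples card_X blocks_14_length)
  qed
  moreover have "paired fst ?X"
    unfolding paired_def
  proof
    fix x assume "x \<in> ?X"
    then have "{y \<in> ?X. fst y = fst x} = {fst x} \<times> {0,1}" unfolding X by auto
    then show "card {y \<in> ?X. fst y = fst x} = 2" by (simp add: card_cartesian_product)
  qed
  ultimately show ?thesis using steppableI[of ?X fst "set ` set blocks_14"] stepped_blocks_14 card_X by simp
qed

lemma shift_shift: "shift t (shift u x) = shift (t + u) x"
  by (simp add: shift_def mod_simps algebra_simps)

lemma shift_mod: "shift (t mod 12) x = shift t x"
proof -
  have "(a + t mod 12 * w) mod 12 = (a + t * w) mod 12" for a w
    by (metis mod_add_right_eq mod_mult_left_eq)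
  then show ?thesis by (simp only: shift_def)
qed

lemma shift_0: "snd x \<in> {0..<12} \<Longrightarrow> shift 0 x = x"
  by (cases x) (simp add: shift_def)

lemma shift_points: "x \<in> points {1..3} 12 2 \<Longrightarrow> shift t x \<in> points {1..3} 12 2"
  by (auto simp: points_def shift_def)

lemma points_3: "points {1..3} g s = {0} \<times> {0..<int s} \<union> {1,2,3} \<times> {0..<int g}"
proof -
  have "{1..3} = {1,2,3::nat}" by auto
  then show ?thesis by (simp only: points_def)
qed

lemma points_38: "points {1..3} 12 2 = set (points_38 [1,2,3])"
proof -
  have "{0..<int 2} = {0,1}" "{0..<int 12} = {0..11}" by auto
  then show ?thesis unfolding points_3 points_38_def by auto
qed

lemma blocks_38I: "R \<in> set orbits \<Longrightarrow> shift t ` set R \<in> blocks_38"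
  by (auto simp: blocks_38_def)

lemma blocks_38_cover_pair:
  assumes i: "i = 1 \<or> i = 2" and j: "j \<in> {1..3}" "i < j" and ab: "a \<in> {0..<12}" "b \<in> {0..<12}"
    and z: "z \<in> points {1..3} 12 2" "z \<noteq> (i,a)" "z \<noteq> (j,b)"
  shows "\<exists>U\<in>blocks_38. {(i,a),(j,b),z} \<subseteq> U"
proof -
  let ?s = "shift (- a)"
  have inverse: "shift a (?s x) = x" if "snd x \<in> {0..<12}" for x
    using that shift_0 by (simp add: shift_shift)
  have range: "snd (i,a) \<in> {0..<12}" "snd (j,b) \<in> {0..<12}" "snd z \<in> {0..<12}"
    using ab z(1) by (auto simp: points_def)
  have base: "?s (i,a) = (i,0)" using i by (auto simp: shift_def)
  have z': "?s z \<in> set (points_38 [1,2,3])" "?s z \<noteq> (i,0)" "?s z \<noteq> ?s (j,b)"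
    using shift_points[OF z(1)] points_38 z(2,3) inverse range base by metis+
  have "fst (?s (j,b)) = j" "snd (?s (j,b)) \<in> {0..11}" by (simp_all add: shift_def)
  then have "?s (j,b) \<in> {j} \<times> {0..11}" by (simp add: mem_Times_iff)
  moreover have "i = 1 \<longrightarrow> j = 2 \<or> j = 3" "i = 2 \<longrightarrow> j = 3" using j by auto
  ultimately have y': "i = 1 \<longrightarrow> ?s (j,b) \<in> set (List.product [2,3] [0..11])"
    "i = 2 \<longrightarrow> ?s (j,b) \<in> set (List.product [3] [0..11])" by auto
  have "\<exists>Q\<in>set (blocks_through i). {(i,0), ?s (j,b), ?s z} \<subseteq> set Q"
    using i
  proof
    assume "i = 1"
    then show ?thesis using point_coveredD[OF blocks_through_cover(1)] y'(1) z' by simp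
  next
    assume "i = 2"
    then show ?thesis using point_coveredD[OF blocks_through_cover(2)] y'(2) z' by simp
  qed
  then obtain Q where Q: "Q \<in> set (blocks_through i)" "{(i,0), ?s (j,b), ?s z} \<subseteq> set Q" ..
  from Q(1) obtain R u where R: "R \<in> set orbits" "Q = map (shift u) R" by (auto simp: blocks_through_def)
  have "shift a (i,0) = (i,a)" using inverse[OF range(1)] base by simp
  then have "{(i,a),(j,b),z} = shift a ` {(i,0), ?s (j,b), ?s z}"
    by (simp only: image_insert image_empty inverse range)
  also have "\<dots> \<subseteq> shift a ` set Q" using Q(2) by blast
  also have "\<dots> = shift (a + u) ` set R" by (simp add: R(2) image_image shift_shift)
  finally show ?thesis using blocks_38I[OF R(1)] by blast
qed

lemma card_blocks_38: "finite blocks_38" "card blocks_38 \<le> 1836"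
proof -
  let ?I = "{0..<12} \<times> set long_orbits \<union> {0..<6} \<times> set short_orbits :: (int \<times> (nat \<times> int) list) set"
  have sub: "blocks_38 \<subseteq> (\<lambda>(t,R). shift t ` set R) ` ?I"
  proof
    fix U assume "U \<in> blocks_38"
    then obtain t R where U: "R \<in> set orbits" "U = shift t ` set R" by (auto simp: blocks_38_def)
    define u where "u = t mod 12"
    have u: "u \<in> {0..<12}" "U = shift u ` set R" by (simp_all add: u_def U(2) shift_mod)
    consider (long) "R \<in> set long_orbits" | (short) "R \<in> set short_orbits" "u < 6"
      | (repeated) "R \<in> set short_orbits" "u \<ge> 6"
      using U(1) by (fastforce simp: orbits_def)
    then show "U \<in> (\<lambda>(t,R). shift t ` set R) ` ?I"
    proof cases
      case repeated
      have "shift u ` set R = shift (u - 6) ` shift 6 ` set R" by (simp add: image_image shift_shift)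
      then have "U = shift (u - 6) ` set R" using u(2) short_orbits_shift repeated(1) by (simp add: list_all_iff)
      then show ?thesis using repeated u(1) by (intro image_eqI[of _ _ "(u - 6, R)"]) auto
    qed (use u in \<open>auto intro!: image_eqI[of _ _ "(u, R)"]\<close>)
  qed
  then show "finite blocks_38" by (rule finite_subset) simp
  have "card blocks_38 \<le> card ?I" using surj_card_le[OF _ sub] by simp
  also have "\<dots> \<le> card ({0..<12::int} \<times> set long_orbits) + card ({0..<6::int} \<times> set short_orbits)"
    by (rule card_Un_le)
  also have "\<dots> \<le> 12 * 146 + 6 * 14"
    using card_length[of long_orbits] card_length[of short_orbits]
    by (simp add: card_cartesian_product orbits_length)
  finally show "card blocks_38 \<le> 1836" by simp
qed

lemma candelabra_system_38: "candelabra_system {1..3} 12 2 blocks_38"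
proof (rule candelabra_system_if_card[OF card_blocks_38(1)])
  fix U assume "U \<in> blocks_38"
  then obtain t R where U: "R \<in> set orbits" "U = shift t ` set R" by (auto simp: blocks_38_def)
  then have "length R = 4" using orbits_length(3) by (simp add: list_all_iff)
  then obtain a b c d where "set R = {a,b,c,d}" using set_of_length_4 by blast
  then have "U = {shift t a, shift t b, shift t c, shift t d}" using U(2) by simp
  then show "\<exists>a b c d. U = {a,b,c,d}" by blast
next
  fix T assume "T \<in> cross_triples {1..3} 12 2"
  moreover have "0 \<notin> {1..3::nat}" by simp
  ultimately obtain i a j b z where T: "T = {(i,a),(j,b),z}" "i \<in> {1..3}" "j \<in> {1..3}" "i < j"
    "a \<in> {0..<int 12}" "b \<in> {0..<int 12}" "z \<in> points {1..3} 12 2" "z \<noteq> (i,a)" "z \<noteq> (j,b)"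
    by (rule cross_triple_two_groups)
  then have "i = 1 \<or> i = 2" by auto
  then show "\<exists>U\<in>blocks_38. T \<subseteq> U" using blocks_38_cover_pair[OF _ T(3,4) _ _ T(7-9)] T(1,5,6) by simp
next
  have "int (card (cross_triples {1..3} 12 2)) = 7344" unfolding card_cross_triples_3 by simp
  then show "4 * card blocks_38 \<le> card (cross_triples {1..3} 12 2)" using card_blocks_38(2) by simp
qed

lemma aligned_38: "aligned (\<lambda>a. a mod 6) blocks_38"
  unfolding blocks_38_def aligned_UN
proof
  fix t
  show "aligned (\<lambda>a. a mod 6) ((`) (shift t) ` set ` set orbits)"
  proof (rule aligned_image[OF aligned_orbits])
    fix x y :: "nat \<times> int"
    define c where "c = t * (if fst y = 0 then 0 else if fst y = 3 then - 2 else 1)"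
    assume "fst x = fst y" "snd (shift t x) mod 6 = snd (shift t y) mod 6"
    moreover have "snd (shift t z) mod 6 = (snd z + c) mod 6" if "fst z = fst y" for z
      using that by (simp add: shift_def mod_mod_cancel c_def)
    ultimately have "(snd x + c) mod 6 = (snd y + c) mod 6" by simp
    then show "snd x mod 6 = snd y mod 6" by (simp add: mod_eq_dvd_iff)
  qed (simp_all add: shift_def)
qed

lemma paired_mod_6: "paired (\<lambda>a. a mod 6) {0..<12::int}"
  unfolding paired_def
proof
  fix a :: int
  have "0 \<le> a mod 6" "a mod 6 < 6" by simp_all
  moreover have "b mod 6 = b \<or> b mod 6 = b - 6" if "b \<in> {0..<12}" for b :: int
    using that by simp presburger
  ultimately have "{b \<in> {0..<12}. b mod 6 = a mod 6} = {a mod 6, a mod 6 + 6}" by fastforce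
  then show "card {b \<in> {0..<12::int}. b mod 6 = a mod 6} = 2" by simp
qed

lemma candelabra_system_10: "candelabra_system {1..3} 3 1 (set ` set blocks_10)"
proof (rule exact_cover_of_lists[OF blocks_10_length(2)])
  fix T assume T: "T \<in> cross_triples {1..3} 3 1"
  then show "card T = 3" by (simp add: cross_triples_def triples_def)
  have "0 \<notin> {1..3::nat}" by simp
  with T obtain i a j b z where T: "T = {(i,a),(j,b),z}" "i \<in> {1..3}" "j \<in> {1..3}" "i < j"
    "a \<in> {0..<int 3}" "b \<in> {0..<int 3}" "z \<in> points {1..3} 3 1" "z \<noteq> (i,a)" "z \<noteq> (j,b)"
    by (rule cross_triple_two_groups)
  have z: "z \<in> set ((0,0) # List.product [1,2,3] [0..2])" using T(7) unfolding points_3 by auto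
  have i: "i \<in> {1,2}" and a: "a \<in> {0,1,2}" using T(2-5) by auto
  have "point_covered blocks_10 (List.product [i + 1..<4] [0..2]) ((0,0) # List.product [1,2,3] [0..2]) (i,a)"
    using blocks_10_cover i a by blast
  then show "\<exists>Q\<in>set blocks_10. T \<subseteq> set Q"
    unfolding T(1) by (rule point_coveredD) (use T(3,4,6,8,9) z in auto)
next
  have "int (card (cross_triples {1..3} 3 1)) = 108" unfolding card_cross_triples_3 by simp
  then show "4 * length blocks_10 \<le> card (cross_triples {1..3} 3 1)" by (simp add: blocks_10_length)
qed

section \<open>Pairs of groups of three points\<close>

text \<open>
  Groups of three points have no levels of their own: the levels consist of equal coordinates in the
  groups \<open>2 h\<close> and \<open>2 h + 1\<close>, while group 1 is paired up with the stem point.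
\<close>

definition triad_level :: "nat \<times> int \<Rightarrow> nat \<times> int" where
  "triad_level x = (fst x div 2, if fst x = 0 then 0 else if fst x = 1 then (snd x + 1) div 2 else snd x)"

definition row_aligned :: "(nat \<times> int) set set \<Rightarrow> bool" where
  "row_aligned C \<longleftrightarrow> (\<forall>Q\<in>C. \<forall>x\<in>Q. \<forall>y\<in>Q. fst x \<noteq> 0 \<longrightarrow> fst y \<noteq> 0 \<longrightarrow> fst x \<noteq> fst y \<longrightarrow> snd x = snd y \<longrightarrow>
     (\<forall>z\<in>Q - {x,y}. \<forall>w\<in>Q - {x,y}. fst z \<in> {fst x, fst y} \<longrightarrow> fst w \<in> {fst x, fst y} \<and> snd w = snd z))"

lemma row_alignedD:
  assumes "row_aligned C" "Q \<in> C" "{x,y,z,w} \<subseteq> Q" "z \<notin> {x,y}" "w \<notin> {x,y}"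
    "fst x \<noteq> 0" "fst y \<noteq> 0" "fst x \<noteq> fst y" "snd x = snd y" "fst z \<in> {fst x, fst y}"
  shows "fst w \<in> {fst x, fst y} \<and> snd w = snd z"
  using assms(1)[unfolded row_aligned_def, rule_format, of Q x y z w] assms(2-) by simp

lemma row_aligned_blocks_10: "row_aligned (set ` set blocks_10)"
  by code_simp

lemma row_aligned_relabel:
  assumes C: "row_aligned C" "\<And>Q. Q \<in> C \<Longrightarrow> fst ` Q \<subseteq> insert 0 I"
    and labelling: "inj_on e (insert 0 I)" "e 0 = 0"
  shows "row_aligned (relabel e C)"
  unfolding row_aligned_def relabel_def
proof (intro ballI impI)
  let ?h = "map_prod e id"
  fix R x' y' z' w'
  assume R: "R \<in> (`) ?h ` C" "x' \<in> R" "y' \<in> R" "z' \<in> R - {x',y'}" "w' \<in> R - {x',y'}"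
    and row: "fst x' \<noteq> 0" "fst y' \<noteq> 0" "fst x' \<noteq> fst y'" "snd x' = snd y'" "fst z' \<in> {fst x', fst y'}"
  obtain Q where Q: "Q \<in> C" "R = ?h ` Q" using R(1) by blast
  then have "x' \<in> ?h ` Q" "y' \<in> ?h ` Q" "z' \<in> ?h ` Q" "w' \<in> ?h ` Q" using R(2-5) by simp_all
  then obtain x y z w where preimages: "x \<in> Q" "y \<in> Q" "z \<in> Q" "w \<in> Q"
    and images: "x' = ?h x" "y' = ?h y" "z' = ?h z" "w' = ?h w" by (elim imageE)
  have "fst (?h u) = fst (?h v) \<longleftrightarrow> fst u = fst v" if "u \<in> Q" "v \<in> Q" for u v
  proof -
    have "fst u \<in> insert 0 I" "fst v \<in> insert 0 I" using that C(2)[OF Q(1)] by blast+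
    then show ?thesis using inj_on_eq_iff[OF labelling(1)] by simp
  qed
  then have group_mem: "fst (?h u) \<in> {fst x', fst y'} \<longleftrightarrow> fst u \<in> {fst x, fst y}" if "u \<in> Q" for u
    using that preimages(1,2) images(1,2) by simp
  have "fst x \<noteq> 0" "fst y \<noteq> 0" using row(1,2) images(1,2) labelling(2) by (metis fst_map_prod)+
  moreover have "fst x \<noteq> fst y" "snd x = snd y" using row(3,4) images(1,2) by auto
  moreover have "z \<notin> {x,y}" "w \<notin> {x,y}" using R(4,5) images by auto
  moreover have "fst z \<in> {fst x, fst y}" using row(5) group_mem[OF preimages(3)] images(3) by simp
  ultimately have "fst w \<in> {fst x, fst y} \<and> snd w = snd z"
    using preimages by (intro row_alignedD[OF C(1) Q(1)]) simp_all
  then show "fst w' \<in> {fst x', fst y'} \<and> snd w' = snd z'"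
    using group_mem[OF preimages(4)] images(3,4) by simp
qed

lemma triad_level_less: "fst x div 2 < fst y div 2 \<Longrightarrow> triad_level x < triad_level y"
  by (simp add: triad_level_def)

lemma triad_level_eqD:
  assumes "triad_level x = triad_level y" "x \<noteq> y" "fst x \<noteq> 0" "fst y \<noteq> 0" "fst x \<noteq> 1"
  shows "snd x = snd y" "fst x \<noteq> fst y" "fst x div 2 = fst y div 2" "fst y \<noteq> 1"
proof -
  show "fst x div 2 = fst y div 2" using assms(1) by (simp add: triad_level_def)
  then show "fst y \<noteq> 1" using assms(3,5) by auto
  then show "snd x = snd y" using assms(1,3-5) by (simp add: triad_level_def)
  then show "fst x \<noteq> fst y" using assms(2) by (auto simp: prod_eq_iff)
qed

definition triad_points :: "nat \<Rightarrow> (nat \<times> int) set" where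
  "triad_points n = points {1..<n} 3 1"

lemma mem_triad_points_iff:
  "x \<in> triad_points n \<longleftrightarrow> x = (0,0) \<or> fst x \<in> {1..<n} \<and> snd x \<in> {0,1,2}"
  by (cases x) (auto simp: triad_points_def points_def)

lemma card_low_triad_level:
  assumes n: "n \<ge> 2" and x: "x \<in> triad_points n" "fst x div 2 = 0"
  shows "card {y \<in> triad_points n. triad_level y = triad_level x} = 2"
proof -
  have "y \<in> triad_points n \<and> triad_level y = (0,0) \<longleftrightarrow> y \<in> {(0,0),(1,0)}"
    "y \<in> triad_points n \<and> triad_level y = (0,1) \<longleftrightarrow> y \<in> {(1,1),(1,2)}" for y
    using n by (cases y; auto simp: mem_triad_points_iff triad_level_def)+
  then have "{y \<in> triad_points n. triad_level y = (0,0)} = {(0,0),(1,0)}"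
    "{y \<in> triad_points n. triad_level y = (0,1)} = {(1,1),(1,2)}" by blast+
  moreover have "triad_level x = (0,0) \<or> triad_level x = (0,1)"
    using x by (cases x) (auto simp: mem_triad_points_iff triad_level_def)
  ultimately show ?thesis by (elim disjE) simp_all
qed

lemma card_high_triad_level:
  assumes n: "even n" and x: "x \<in> triad_points n" "fst x div 2 \<noteq> 0"
  shows "card {y \<in> triad_points n. triad_level y = triad_level x} = 2"
proof -
  let ?h = "2 * (fst x div 2)"
  have in_range: "fst x \<in> {1..<n}" "snd x \<in> {0,1,2}" using x by (auto simp: mem_triad_points_iff)
  then have less: "?h + 1 < n" using n by simp presburger
  have level: "triad_level y = (fst x div 2, snd y)" if "fst y div 2 = fst x div 2" for y
  proof -
    have "fst y \<noteq> 0" "fst y \<noteq> 1" using that x(2) by auto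
    then show ?thesis using that by (simp add: triad_level_def)
  qed
  have "y \<in> triad_points n \<and> triad_level y = triad_level x \<longleftrightarrow> y \<in> {?h, ?h + 1} \<times> {snd x}" for y
  proof
    assume "y \<in> triad_points n \<and> triad_level y = triad_level x"
    moreover from this have "fst y div 2 = fst x div 2" by (simp add: triad_level_def)
    moreover from this have "fst y \<in> {?h, ?h + 1}" by simp presburger
    ultimately show "y \<in> {?h, ?h + 1} \<times> {snd x}" using level[of y] level[of x] by (auto simp: prod_eq_iff)
  next
    assume "y \<in> {?h, ?h + 1} \<times> {snd x}"
    then have y: "fst y \<in> {?h, ?h + 1}" "snd y = snd x" by (simp_all only: mem_Times_iff singleton_iff)
    then have "fst y div 2 = fst x div 2" "fst y \<in> {1..<n}" using x(2) less by auto
    then show "y \<in> triad_points n \<and> triad_level y = triad_level x"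
      using y(2) in_range(2) level[of y] level[of x] by (simp add: mem_triad_points_iff)
  qed
  then have "{y \<in> triad_points n. triad_level y = triad_level x} = {?h, ?h + 1} \<times> {snd x}" by blast
  then show ?thesis by (simp add: card_cartesian_product)
qed

lemma paired_triad_level:
  assumes "even n" "n \<ge> 2"
  shows "paired triad_level (triad_points n)"
  unfolding paired_def
proof
  fix x assume "x \<in> triad_points n"
  then show "card {y \<in> triad_points n. triad_level y = triad_level x} = 2"
    using card_low_triad_level[OF assms(2)] card_high_triad_level[OF assms(1)]
    by (cases "fst x div 2 = 0") blast+
qed

lemma exact_cover_points_3_1: "i \<noteq> 0 \<Longrightarrow> exact_cover {points {i} 3 1} (triples (points {i} 3 1))"
  using exact_cover_at_most_4[of "points {i} 3 1"] by (simp add: finite_points card_points)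

lemma stepped_points_3_1:
  assumes "i \<noteq> 0"
  shows "stepped triad_level {points {i} 3 1}"
proof (cases "i = 1")
  case True
  have "{0..<1::int} = {0}" "{0..<3::int} = {0,1,2}" by auto
  then have "points {i} 3 1 = {(0,0),(1,0),(1,1),(1,2)}" using True by (auto simp: points_def)
  moreover have "stepped triad_level {{(0,0),(1,0),(1,1),(1,2)}}" by code_simp
  ultimately show ?thesis by simp
next
  case False
  show ?thesis
  proof (rule steppedI)
    fix Q x y assume "Q \<in> {points {i} 3 1}" "x \<in> Q" "y \<in> Q" "x \<noteq> y" "triad_level x = triad_level y"
    moreover have "i div 2 \<noteq> 0" using False assms by simp
    ultimately have False using False assms by (auto simp: points_def triad_level_def)
    then show "one_sided triad_level (triad_level x) (Q - {x,y})" ..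
  qed
qed

lemma one_sided_over_block:
  assumes A: "stepped (\<lambda>i. i div 2) A" "X \<in> A" and Q: "fst ` Q \<subseteq> X"
    and xy: "x \<in> Q" "y \<in> Q" "fst x \<noteq> fst y" "fst x div 2 = fst y div 2"
    and others: "\<And>z. z \<in> Q - {x,y} \<Longrightarrow> fst z \<notin> {fst x, fst y}"
  shows "one_sided triad_level (triad_level x) (Q - {x,y})"
proof (rule one_sided_refine)
  have "one_sided (\<lambda>i. i div 2) (fst x div 2) (X - {fst x, fst y})"
    using Q xy by (intro steppedD[OF A]) auto
  moreover have "fst z \<in> X - {fst x, fst y}" if "z \<in> Q - {x,y}" for z using that others Q by blast
  ultimately show "one_sided (\<lambda>z. fst z div 2) (fst x div 2) (Q - {x,y})" unfolding one_sided_def by metis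
qed (rule triad_level_less)

lemma stepped_triad_level_transversals:
  assumes A: "stepped (\<lambda>i. i div 2) A" "X \<in> A" "0 \<notin> X"
  shows "stepped triad_level (transversals X 3)"
proof (rule steppedI)
  fix Q x y assume Q: "Q \<in> transversals X 3" "x \<in> Q" "y \<in> Q" "x \<noteq> y" "triad_level x = triad_level y"
  have "fst ` Q \<subseteq> X" using Q(1) by (auto simp: transversals_def)
  moreover have "fst z \<noteq> fst w" if "z \<in> Q" "w \<in> Q" "z \<noteq> w" for z w
    using inj_onD[OF transversals_inj_on_fst[OF Q(1)]] that by blast
  moreover have "fst x div 2 = fst y div 2" using Q(5) by (simp add: triad_level_def)
  ultimately show "one_sided triad_level (triad_level x) (Q - {x,y})"
    using Q(2-4) by (intro one_sided_over_block[OF A(1,2)]) auto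
qed

lemma one_sided_low_triad_level:
  assumes C: "candelabra_system I 3 1 C" and Q: "Q \<in> C" "x \<in> Q" "y \<in> Q" "x \<noteq> y"
    and low: "fst x \<in> {0,1}" "fst y \<in> {0,1}"
  shows "one_sided triad_level (triad_level x) (Q - {x,y})"
proof -
  have "triad_level x < triad_level z" if "z \<in> Q - {x,y}" for z
  proof (rule triad_level_less)
    have "fst z \<notin> {0,1}"
      using candelabra_block_groups[OF C Q(1), of x y z 1] that Q(2-4) low by auto
    then have "fst z \<noteq> 0" "fst z \<noteq> 1" by auto
    then show "fst x div 2 < fst z div 2" using low(1) by auto
  qed
  then show ?thesis by (simp add: one_sided_def)
qed

lemma one_sided_parallel_triad_level:
  assumes xy: "triad_level x = triad_level y" "x \<noteq> y" "fst x \<noteq> 0" "fst y \<noteq> 0" "fst x \<noteq> 1"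
    and Z: "x \<notin> Z" "y \<notin> Z" "\<And>z. z \<in> Z \<Longrightarrow> fst z \<in> {fst x, fst y} \<and> snd z = t"
  shows "one_sided triad_level (triad_level x) Z"
proof -
  note same = triad_level_eqD[OF xy]
  have level: "triad_level z = (fst x div 2, snd z)" if "fst z \<in> {fst x, fst y}" for z
    using that same xy(3-5) by (auto simp: triad_level_def)
  have "snd z \<noteq> snd x" if "z \<in> Z" for z
    using Z(3)[OF that] Z(1,2) that same(1) by (metis insertE prod_eqI singletonD)
  then have "one_sided snd (snd x) Z" using Z(3) unfolding one_sided_def by (metis linorder_neqE)
  moreover have "triad_level z < triad_level x \<longleftrightarrow> snd z < snd x" "triad_level x < triad_level z \<longleftrightarrow> snd x < snd z"
    if "z \<in> Z" for z using level[of x] level[of z] Z(3)[OF that] by simp_all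
  ultimately show ?thesis unfolding one_sided_def by blast
qed

lemma stepped_triad_level_row_aligned:
  assumes A: "stepped (\<lambda>i. i div 2) A" "X \<in> A" "0 \<in> X"
    and C: "candelabra_system (X - {0}) 3 1 C" "row_aligned C"
  shows "stepped triad_level C"
proof (rule steppedI)
  fix Q x y assume Q: "Q \<in> C" "x \<in> Q" "y \<in> Q" "x \<noteq> y" and lev: "triad_level x = triad_level y"
  have half: "fst x div 2 = fst y div 2" using lev by (simp add: triad_level_def)
  show "one_sided triad_level (triad_level x) (Q - {x,y})"
  proof (cases "fst x div 2 = 0")
    case True
    then have "fst x \<in> {0,1}" "fst y \<in> {0,1}" using half by auto
    then show ?thesis by (rule one_sided_low_triad_level[OF C(1) Q])
  next
    case False
    then have high: "fst x \<noteq> 0" "fst y \<noteq> 0" "fst x \<noteq> 1" using half by auto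
    note same = triad_level_eqD[OF lev Q(4) high]
    show ?thesis
    proof (cases "\<exists>z\<in>Q - {x,y}. fst z \<in> {fst x, fst y}")
      case True
      then obtain z where z: "z \<in> Q - {x,y}" "fst z \<in> {fst x, fst y}" ..
      have "fst w \<in> {fst x, fst y} \<and> snd w = snd z" if "w \<in> Q - {x,y}" for w
        using that z Q(2,3) by (intro row_alignedD[OF C(2) Q(1) _ _ _ high(1,2) same(2,1)]) auto
      then show ?thesis by (intro one_sided_parallel_triad_level[OF lev Q(4) high]) auto
    next
      case False
      have "fst ` Q \<subseteq> X" using candelabra_system_fst[OF C(1) Q(1)] A(3) by auto
      then show ?thesis using False Q(2,3) same(2,3) by (intro one_sided_over_block[OF A(1,2)]) auto
    qed
  qed
qed

lemma steppable_triad: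
  assumes n: "steppable n" "even n" "n \<ge> 2"
  shows "steppable (3 * n - 2)"
proof -
  have insert_0: "insert 0 {1..<n} = {0..<n}" using n(3) by auto
  obtain A where A: "exact_cover A (triples (insert 0 {1..<n}))" "stepped (\<lambda>i. i div 2) A"
    using n(1) unfolding steppable_def insert_0 by blast
  have "\<exists>C. candelabra_system (X - {0}) 3 1 C \<and> row_aligned C" if X: "X \<in> A" "0 \<in> X" for X
  proof -
    obtain e :: "nat \<Rightarrow> nat" where labelling: "inj_on e (insert 0 {1..3})" "e 0 = 0" "e ` {1..3} = X - {0}"
      using block_labelling[OF exact_cover_block[OF A(1) X(1)] X(2)] .
    then show ?thesis
      using candelabra_system_relabel[OF candelabra_system_10 labelling(1,2)]
        row_aligned_relabel[OF row_aligned_blocks_10 candelabra_system_fst[OF candelabra_system_10] labelling(1,2)]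
      by auto
  qed
  then obtain C where C: "\<And>X. X \<in> A \<Longrightarrow> 0 \<in> X \<Longrightarrow> candelabra_system (X - {0}) 3 1 (C X)"
    "\<And>X. X \<in> A \<Longrightarrow> 0 \<in> X \<Longrightarrow> row_aligned (C X)" by metis
  let ?B = "blow_up A 3 C" and ?G = "\<Union>i\<in>{1..<n}. {points {i} 3 1}"
  have "stepped triad_level (if 0 \<in> X then C X else transversals X 3)" if "X \<in> A" for X
    using stepped_triad_level_row_aligned[OF A(2) that _ C] stepped_triad_level_transversals[OF A(2) that] that
    by simp
  then have "stepped triad_level ?B" unfolding blow_up_def stepped_UN by blast
  moreover have "stepped triad_level ?G" using stepped_points_3_1 by (simp add: stepped_UN)
  ultimately have "stepped triad_level (?B \<union> ?G)" unfolding stepped_Un ..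
  moreover have "candelabra_system {1..<n} 3 1 ?B"
    using C(1) by (intro candelabra_system_blow_up[OF A(1)]) auto
  then have "exact_cover (?B \<union> ?G) (triples (points {1..<n} 3 1))"
  proof (rule exact_cover_fill)
    show "exact_cover {} (triples (points {} 3 1))"
      using exact_cover_at_most_4[of "points {} 3 1"] by (simp add: finite_points card_points)
  qed (use n(3) exact_cover_points_3_1 in auto)
  ultimately have "steppable (card (points {1..<n} 3 1))"
    using paired_triad_level[OF n(2,3)] unfolding triad_points_def
    by (intro steppableI) (simp_all add: finite_points)
  moreover have "card (points {1..<n} 3 1) = 3 * n - 2" using n(3) by (subst card_points) auto
  ultimately show ?thesis by (simp only:)
qed

section \<open>The recursion\<close>

lemma steppable_2: "steppable 2"
proof -
  have "exact_cover {} (triples {0..<2::nat})" using exact_cover_at_most_4[of "{0..<2::nat}"] by simp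
  then show ?thesis unfolding steppable_def by (auto simp: stepped_def)
qed

lemma steppable_4: "steppable 4"
proof -
  have four: "{0..<4} = {0,1,2,3::nat}" by auto
  have "exact_cover {{0..<4}} (triples {0..<4::nat})" using exact_cover_at_most_4[of "{0..<4::nat}"] by simp
  moreover have "stepped (\<lambda>x. x div 2) {{0..<4::nat}}" unfolding four by code_simp
  ultimately show ?thesis unfolding steppable_def by blast
qed

lemma steppable_double:
  assumes "steppable n" "n \<ge> 2"
  shows "steppable (2 * n)"
proof -
  interpret tripling 0 2 2 by unfold_locales simp_all
  obtain C where "candelabra_system {1..3} 2 2 C" "aligned level C" using candelabra_system_exists by blast
  then have "steppable (2 + (n - 1) * 2)"
    using paired_level steppable_4 by (intro steppable_blow_up[OF assms]) simp_all
  moreover have "2 + (n - 1) * 2 = 2 * n" using assms(2) by simp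
  ultimately show ?thesis by (simp only:)
qed

lemma steppable_triple:
  assumes "steppable (s + g)" "g = 6 * p + s" "s = 2 \<or> s = 4"
  shows "steppable (s + 3 * g)"
proof -
  interpret tripling p s g using assms(2,3) by unfold_locales auto
  obtain C where C: "candelabra_system {1..3} g s C" "aligned level C" using candelabra_system_exists by blast
  show ?thesis
    using steppable_fill[OF C(1) stepped_if_aligned[OF C(1) order_refl C(2)] _ _ _ assms(3) paired_level assms(1)]
    by simp
qed

lemma steppable_quadruple:
  assumes "steppable (2 + 2 * k)" "k > 0"
  shows "steppable (2 + 8 * k)"
proof -
  interpret quadrupling k using assms(2) by unfold_locales
  obtain C where C: "candelabra_system {1..4} (2 * k) 2 C" "stepped (group_level (\<lambda>a. a div 2)) C"
    using candelabra_system_exists by blast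
  show ?thesis using steppable_fill[OF C _ _ _ _ paired_half assms(1)] by simp
qed

lemma steppable_dozen:
  assumes "steppable n" "n \<ge> 2"
  shows "steppable (12 * n - 10)"
proof -
  have "steppable (2 + (n - 1) * 12)"
    using steppable_blow_up[OF assms _ _ _ candelabra_system_38 aligned_38] steppable_14 paired_mod_6 by simp
  moreover have "2 + (n - 1) * 12 = 12 * n - 10" using assms(2) by simp
  ultimately show ?thesis by (simp only:)
qed

lemma mod_cases_double: "q mod (m * 2) = q mod m \<or> q mod (m * 2) = m + q mod m" for q m :: nat
proof -
  have "q div m mod 2 = 0 \<or> q div m mod 2 = 1" by linarith
  then show ?thesis using mod_mult2_eq[of q m 2] by (elim disjE) simp_all
qed

lemma mod_cases_triple:
  "q mod (m * 3) = q mod m \<or> q mod (m * 3) = m + q mod m \<or> q mod (m * 3) = 2 * m + q mod m" for q m :: nat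
proof -
  have "q div m mod 3 = 0 \<or> q div m mod 3 = 1 \<or> q div m mod 3 = 2" by linarith
  then show ?thesis using mod_mult2_eq[of q m 3] by (elim disjE) simp_all
qed

lemma residue_cases:
  fixes q :: nat
  assumes "q mod 6 = 2 \<or> q mod 6 = 4"
  obtains (mod_18_4) "q mod 18 = 4" | (mod_18_10) "q mod 18 = 10" | (mod_18_16) "q mod 18 = 16"
  | (mod_18_8) "q mod 18 = 8" | (mod_12_8) "q mod 12 = 8" | (mod_24_2) "q mod 24 = 2"
  | (mod_72_14) "q mod 72 = 14" | (mod_72_38) "q mod 72 = 38"
proof -
  have "q mod 18 = 4 \<or> q mod 18 = 10 \<or> q mod 18 = 16" if "q mod 6 = 4"
    using mod_cases_triple[of q 6] that by simp
  moreover have "q mod 12 = 2 \<or> q mod 12 = 8" if "q mod 6 = 2"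
    using mod_cases_double[of q 6] that by simp
  moreover have "q mod 24 = 2 \<or> q mod 24 = 14" if "q mod 12 = 2"
    using mod_cases_double[of q 12] that by simp
  moreover have "q mod 72 = 14 \<or> q mod 72 = 38 \<or> q mod 72 = 62" if "q mod 24 = 14"
    using mod_cases_triple[of q 24] that by simp
  moreover have "q mod 18 = 8" if "q mod 72 = 62"
    using mod_mod_cancel[of 18 72 q] that by simp
  ultimately show ?thesis using assms that by blast
qed

lemma recursion_cases:
  fixes q :: nat
  assumes "q mod 6 = 2 \<or> q mod 6 = 4" "q \<noteq> 2"
  obtains (triad) n where "q = 3 * n - 2" "n mod 6 = 2 \<or> n mod 6 = 4"
  | (triple_4) p where "q = 4 + 3 * (6 * p + 4)"
  | (triple_2) p where "q = 2 + 3 * (6 * p + 2)"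
  | (double) n where "q = 2 * n" "n mod 6 = 4"
  | (quadruple) k where "q = 2 + 24 * k" "k > 0"
  | (dozen) n where "q = 12 * n - 10" "n mod 6 = 2 \<or> n mod 6 = 4"
proof -
  have quotient: "q = m * (q div m) + r" if "q mod m = r" for m r
    using that by (metis mult_div_mod_eq)
  from assms(1) show ?thesis
  proof (cases rule: residue_cases)
    case mod_18_4
    from quotient[OF this] show ?thesis by (intro triad[of "6 * (q div 18) + 2"]) (simp_all add: mod_Suc)
  next
    case mod_18_10
    from quotient[OF this] show ?thesis by (intro triad[of "6 * (q div 18) + 4"]) simp_all
  next
    case mod_18_16
    from quotient[OF this] show ?thesis by (intro triple_4[of "q div 18"]) simp
  next
    case mod_18_8
    from quotient[OF this] show ?thesis by (intro triple_2[of "q div 18"]) simp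
  next
    case mod_12_8
    from quotient[OF this] show ?thesis by (intro double[of "6 * (q div 12) + 4"]) simp_all
  next
    case mod_24_2
    from quotient[OF this] show ?thesis using assms(2) by (intro quadruple[of "q div 24"]) simp_all
  next
    case mod_72_14
    from quotient[OF this] show ?thesis by (intro dozen[of "6 * (q div 72) + 2"]) (simp_all add: mod_Suc)
  next
    case mod_72_38
    from quotient[OF this] show ?thesis by (intro dozen[of "6 * (q div 72) + 4"]) simp_all
  qed
qed

lemma steppable_if_mod_6:
  fixes q :: nat
  assumes "q mod 6 = 2 \<or> q mod 6 = 4"
  shows "steppable q"
  using assms
proof (induction q rule: less_induct)
  case (less q)
  show ?case
  proof (cases "q = 2")
    case True then show ?thesis using steppable_2 by simp
  next
    case False
    with less.prems show ?thesis
    proof (cases rule: recursion_cases)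
      case (triad n)
      then have "2 \<le> n" using mod_less_eq_dividend[of n 6] by auto
      moreover have "even n" using triad(2) dvd_mod_iff[of 2 6 n] by auto
      ultimately show ?thesis using triad less.IH[of n] steppable_triad[of n] by simp
    next
      case (triple_4 p)
      then show ?thesis using less.IH[of "4 + (6 * p + 4)"] steppable_triple[of 4 "6 * p + 4" p] by simp
    next
      case (triple_2 p)
      then show ?thesis using less.IH[of "2 + (6 * p + 2)"] steppable_triple[of 2 "6 * p + 2" p] by simp
    next
      case (double n)
      then show ?thesis using less.IH[of n] steppable_double[of n] by simp
    next
      case (quadruple k)
      then show ?thesis using less.IH[of "2 + 6 * k"] steppable_quadruple[of "3 * k"] by (simp add: mod_Suc)
    next
      case (dozen n)
      then have "2 \<le> n" using mod_less_eq_dividend[of n 6] by auto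
      then show ?thesis using dozen less.IH[of n] steppable_dozen[of n] by simp
    qed
  qed
qed

theorem theorem3p3:
  fixes q :: nat
  assumes "q \<ge> 4" and "q mod 6 = 2 \<or> q mod 6 = 4"
  shows "\<exists>S L. is_SQS q S \<and> bij_betw L {0..<q} (B q) \<and> step_property q S L"
proof -
  obtain S where S: "exact_cover S (triples {0..<q})" "stepped (\<lambda>x. x div 2) S"
    using steppable_if_mod_6[OF assms(2)] unfolding steppable_def by blast
  have "bij_betw id {0..<q} (B q)" by (simp add: B_def)
  then show ?thesis using is_SQS_if_exact_cover[OF S(1)] step_property_if_stepped[OF S] by blast
qed

end
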